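(* Let $n\ge 1$, $a>n$, and let $\|\cdot\|$ be an arbitrary norm on $\mathbb{R}^n$ with dual norm $\|\cdot\|_*$. (i) For any $1<p<a$, with $q$ defined by $\frac1p+\frac1q=1$, the inequality $$\Big(\int_{\mathbb{R}^n} f^{\frac{ap}{a-p}}\Big)^{\frac{a-p}{ap}}\le D^+_{n,p,a}\Big(\int_{\mathbb{R}^n}\|\nabla f\|_*^p\Big)^{\frac{\theta}{p}}\Big(\int_{\mathbb{R}^n} f^{p\frac{a-1}{a-p}}\Big)^{\frac{a-p}{p(a-1)}(1-\theta)}$$ holds for any smooth nonnegative function $f$ on $\mathbb{R}^n$ such that the quantities involved are well defined (all integrals finite). Here $\theta\in[0,1]$ is the unique solution of $$\frac{a-p}{a}=\theta\,\frac{n-p}{n}+(1-\theta)\,\frac{a-p}{a-1}$$ and $D^+_{n,p,a}$ is the optimal constant, given by the extremal function $x\mapsto(1+\|x\|^q)^{\frac{p-a}{p}}$ on $\mathbb{R}^n$ (that is, $D^+_{n,p,a}$ is the constant for which this function gives equality). (ii) If $p>a$ when $a\ge n+1$, or if $p\in\big(a,\frac{n}{n+1-a}\big)$ when $a\in[n,n+1)$, then, with $q$ defined by $\frac1p+\frac1q=1$, the inequality $$\Big(\int_{\mathbb{R}^n} f^{p\frac{a-1}{a-p}}\Big)^{\frac{a-p}{p(a-1)}}\le D^-_{n,p,a}\Big(\int_{\mathbb{R}^n}\|\nabla f\|_*^p\Big)^{\frac{\theta'}{p}}\Big(\int_{\mathbb{R}^n} f^{\frac{ap}{a-p}}\Big)^{\frac{a-p}{ap}(1-\theta')}$$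 holds for any smooth positive function $f$ on $\mathbb{R}^n$ such that the quantities involved are well defined (all integrals finite). Here $\theta'\in[0,1]$ is the unique solution of $$\frac{p-a}{a-1}=\theta'\,\frac{p-n}{n}+(1-\theta')\,\frac{p-a}{a}$$ and $D^-_{n,p,a}$ is the optimal constant, given by the extremal function $x\mapsto(1+\|x\|^q)^{\frac{p-a}{p}}$ on $\mathbb{R}^n$ (that is, $D^-_{n,p,a}$ is the constant for which this function gives equality). In this case the exponents $p\frac{a-1}{a-p}$ and $\frac{ap}{a-p}$ in the integrals are negative.
   Context: All integrals are with respect to Lebesgue measure. The dual norm is $\|y\|_*=\sup_{\|x\|\le 1}x\cdot y$. *)

theory Defs
  imports "HOL-Analysis.Analysis"
begin

definition is_norm :: "('a::real_vector \<Rightarrow> real) \<Rightarrow> bool" where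
  "is_norm N \<longleftrightarrow>
     (\<forall>x. N x = 0 \<longleftrightarrow> x = 0) \<and>
     (\<forall>c x. N (c *\<^sub>R x) = \<bar>c\<bar> * N x) \<and>
     (\<forall>x y. N (x + y) \<le> N x + N y)"

definition dual_norm :: "('a::real_inner \<Rightarrow> real) \<Rightarrow> 'a \<Rightarrow> real" where
  "dual_norm N y = (SUP x\<in>{x. N x \<le> 1}. x \<bullet> y)"

text \<open>The value is unspecified at points where \<open>f\<close> is not differentiable.\<close>

definition grad :: "('a::real_inner \<Rightarrow> real) \<Rightarrow> 'a \<Rightarrow> 'a" where
  "grad f x = (THE D. GDERIV f x :> D)"

lemma grad_eqI: "GDERIV f x :> D \<Longrightarrow> grad f x = D"
  unfolding grad_def
proof (rule the_equality)
  fix D' assume "GDERIV f x :> D" "GDERIV f x :> D'"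
  then have "(\<lambda>h. h \<bullet> D) = (\<lambda>h. h \<bullet> D')"
    unfolding gderiv_def by (rule has_derivative_unique)
  then have "(D - D') \<bullet> D = (D - D') \<bullet> D'" by metis
  then have "(D - D') \<bullet> (D - D') = 0" by (simp add: inner_diff_right)
  then show "D' = D" by simp
qed

text \<open>\<open>times_cont_diff k f\<close>: \<open>f\<close> is of class \<open>C\<^sup>k\<close> on the whole space.\<close>

fun times_cont_diff :: "nat \<Rightarrow> ('a::real_normed_vector \<Rightarrow> real) \<Rightarrow> bool" where
  "times_cont_diff 0 f \<longleftrightarrow> continuous_on UNIV f"
| "times_cont_diff (Suc k) f \<longleftrightarrow>
     (\<forall>x. f differentiable (at x)) \<and>
     (\<forall>v. times_cont_diff k (\<lambda>x. frechet_derivative f (at x) v))"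

definition smooth :: "('a::real_normed_vector \<Rightarrow> real) \<Rightarrow> bool" where
  "smooth f \<longleftrightarrow> (\<forall>k. times_cont_diff k f)"

definition pow_int :: "real \<Rightarrow> ('a::euclidean_space \<Rightarrow> real) \<Rightarrow> real" where
  "pow_int r f = (\<integral>x. f x powr r \<partial>lebesgue)"

definition grad_int :: "('a::euclidean_space \<Rightarrow> real) \<Rightarrow> real \<Rightarrow> ('a \<Rightarrow> real) \<Rightarrow> real" where
  "grad_int N p f = (\<integral>x. dual_norm N (grad f x) powr p \<partial>lebesgue)"

definition finite_integrals ::
  "('a::euclidean_space \<Rightarrow> real) \<Rightarrow> real \<Rightarrow> real \<Rightarrow> ('a \<Rightarrow> real) \<Rightarrow> bool" where
  "finite_integrals N p a f \<longleftrightarrow>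
     integrable lebesgue (\<lambda>x. f x powr (a * p / (a - p))) \<and>
     integrable lebesgue (\<lambda>x. f x powr (p * (a - 1) / (a - p))) \<and>
     integrable lebesgue (\<lambda>x. dual_norm N (grad f x) powr p)"

definition GNS_plus_lhs :: "real \<Rightarrow> real \<Rightarrow> ('a::euclidean_space \<Rightarrow> real) \<Rightarrow> real" where
  "GNS_plus_lhs p a f = pow_int (a * p / (a - p)) f powr ((a - p) / (a * p))"

definition GNS_plus_rhs ::
  "('a::euclidean_space \<Rightarrow> real) \<Rightarrow> real \<Rightarrow> real \<Rightarrow> real \<Rightarrow> ('a \<Rightarrow> real) \<Rightarrow> real" where
  "GNS_plus_rhs N p a \<theta> f =
     grad_int N p f powr (\<theta> / p) *
     pow_int (p * (a - 1) / (a - p)) f powr ((a - p) / (p * (a - 1)) * (1 - \<theta>))"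

definition GNS_plus ::
  "('a::euclidean_space \<Rightarrow> real) \<Rightarrow> real \<Rightarrow> real \<Rightarrow> real \<Rightarrow> real \<Rightarrow> bool" where
  "GNS_plus N p a \<theta> D \<longleftrightarrow>
     (\<forall>f. smooth f \<and> (\<forall>x. 0 \<le> f x) \<and> finite_integrals N p a f \<longrightarrow>
        GNS_plus_lhs p a f \<le> D * GNS_plus_rhs N p a \<theta> f)"

definition GNS_minus_lhs :: "real \<Rightarrow> real \<Rightarrow> ('a::euclidean_space \<Rightarrow> real) \<Rightarrow> real" where
  "GNS_minus_lhs p a f = pow_int (p * (a - 1) / (a - p)) f powr ((a - p) / (p * (a - 1)))"

definition GNS_minus_rhs ::
  "('a::euclidean_space \<Rightarrow> real) \<Rightarrow> real \<Rightarrow> real \<Rightarrow> real \<Rightarrow> ('a \<Rightarrow> real) \<Rightarrow> real" where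
  "GNS_minus_rhs N p a \<theta> f =
     grad_int N p f powr (\<theta> / p) *
     pow_int (a * p / (a - p)) f powr ((a - p) / (a * p) * (1 - \<theta>))"

definition GNS_minus ::
  "('a::euclidean_space \<Rightarrow> real) \<Rightarrow> real \<Rightarrow> real \<Rightarrow> real \<Rightarrow> real \<Rightarrow> bool" where
  "GNS_minus N p a \<theta> D \<longleftrightarrow>
     (\<forall>f. smooth f \<and> (\<forall>x. 0 < f x) \<and> finite_integrals N p a f \<longrightarrow>
        GNS_minus_lhs p a f \<le> D * GNS_minus_rhs N p a \<theta> f)"

definition extremal ::
  "('a::euclidean_space \<Rightarrow> real) \<Rightarrow> real \<Rightarrow> real \<Rightarrow> real \<Rightarrow> 'a \<Rightarrow> real" where
  "extremal N p q a x = (1 + N x powr q) powr ((p - a) / p)"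

text \<open>
  For a general norm \<open>extremal N p q a\<close> is only locally Lipschitz, hence not itself
  \<open>smooth\<close>; its gradient is taken almost everywhere. The positivity of the integrals makes an
  equality \<open>lhs = D * rhs\<close> determine \<open>D\<close>.
\<close>

definition admissible_extremal ::
  "('a::euclidean_space \<Rightarrow> real) \<Rightarrow> real \<Rightarrow> real \<Rightarrow> ('a \<Rightarrow> real) \<Rightarrow> bool" where
  "admissible_extremal N p a h \<longleftrightarrow>
     (AE x in lebesgue. h differentiable (at x)) \<and>
     finite_integrals N p a h \<and>
     0 < pow_int (a * p / (a - p)) h \<and>
     0 < pow_int (p * (a - 1) / (a - p)) h \<and>
     0 < grad_int N p h"

end

theory Submission
  imports Defs "HOL-Probability.Weak_Convergence"
begin

text \<open>
  Put \<open>F = f powr (a p / (a - p))\<close> and \<open>G = F powr (1 - 1 / a) = f powr (p (a - 1) / (a - p))\<close>. If a Knothe map pushes a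
  density \<open>F\<close> to a density \<open>\<psi>\<close>, the arithmetic-geometric mean inequality for its diagonal derivatives (with
  weight \<open>1 / a\<close> on each of them and the remaining weight \<open>(a - n) / a\<close> on a parameter \<open>r\<close>), integration by
  parts and the duality of \<open>N\<close> and \<open>dual_norm N\<close> give an inequality between \<open>\<integral>\<psi> powr (1 - 1 / a)\<close>, \<open>\<integral>G\<close>,
  \<open>\<integral>\<psi> N powr q\<close> and \<open>\<integral>(dual_norm N (grad f)) powr p\<close>. For \<open>\<psi>\<close> proportional to \<open>(1 + N powr q) powr (- a)\<close>
  and optimal parameters it becomes a scale-invariant inequality which the extremal function turns into an equality;
  raised to the power \<open>\<theta>\<close> it is the Gagliardo-Nirenberg inequality in both ranges of \<open>p\<close>. Only the one-dimensional
  maps are constructed: an induction over the coordinates replaces the Knothe map itself by the inequality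
  that it would imply.

  The extremal function is not smooth, so the optimality of the constant is obtained by replacing \<open>N\<close> with smooth
  approximations whose gradients have dual norm at most \<open>1 + \<delta>\<close>.
\<close>

section \<open>Monotone transport on the line\<close>

text \<open>The one-dimensional maps run from the marginal of \<psi> back to that of
  \<open>F\<close>. The integration variable \<open>t\<close> is then itself the value of the Knothe
  map, and it is bounded on the support of \<psi>. No map is ever differentiated: a ratio of
  densities stands for the derivative, and integration by parts is Fubini's theorem on the region s
  < t, for which monotonicity is enough.

  The exponent 1 - 1 / a comes from the geometric mean: the n diagonal derivatives multiply to the
  ratio of the densities and each has weight 1 / a, so that a > n leaves a positive weight for the
  parameter.

  The condition n < q (a - 1) makes the powers of the extremal function integrable. Multiplied by p
  - 1 it reads 0 < p (a - 1 - n) + n. For 1 < p < a this follows from a > n, and for p > a it is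
  exactly the range of p in part (ii). Dilations of the extremal function give the moment identity n
  I = (a - 1) q J, which turns the optimized inequality into an equality for it.\<close>

lemma real_distribution_density:
  fixes m :: "real \<Rightarrow> real"
  assumes "integrable lborel m" "\<And>x. 0 \<le> m x" "integral\<^sup>L lborel m = 1"
  shows "real_distribution (density lborel m)"
proof -
  have "emeasure (density lborel m) UNIV = (\<integral>\<^sup>+x. m x \<partial>lborel)"
    using assms by (simp add: emeasure_density borel_measurable_integrable)
  also have "\<dots> = 1" using assms by (simp add: nn_integral_eq_integral)
  finally have "emeasure (density lborel m) (space (density lborel m)) = 1" by simp
  then show ?thesis
    by (intro real_distribution.intro prob_spaceI real_distribution_axioms.intro) auto
qed

lemma measure_density_singleton:
  fixes m :: "real \<Rightarrow> real"
  assumes [measurable]: "m \<in> borel_measurable borel"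
  shows "measure (density lborel m) {x} = 0" "emeasure (density lborel m) {x} = 0"
proof -
  have "AE y in lborel. y \<noteq> x" by (rule AE_lborel_singleton)
  then have "AE y in density lborel m. y \<notin> {x}"
    by (subst AE_density) (auto elim: eventually_mono)
  then have "emeasure (density lborel m) {x} = 0"
    by (subst (asm) AE_iff_measurable[OF _ refl]) auto
  then show "measure (density lborel m) {x} = 0" "emeasure (density lborel m) {x} = 0"
    by (auto simp: measure_def)
qed

text \<open>Continuity makes the sublevel set a closed half-line. Its endpoint is taken as a
  supremum because the cdf may be constant on an interval, and the intermediate value theorem puts
  the value \<open>v\<close> there.\<close>

lemma (in real_distribution) cdf_uniform:
  assumes cont: "\<And>x. isCont (cdf M) x" and v: "0 < v" "v < 1"
  shows "measure M {t. cdf M t \<le> v} = v"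
proof -
  let ?L = "{t. cdf M t \<le> v}"
  obtain a where a: "cdf M a < v"
    using order_tendstoD(2)[OF cdf_lim_at_bot v(1)]
    by (auto dest!: eventually_happens'[OF trivial_limit_at_bot_linorder])
  obtain b where b: "v < cdf M b"
    using order_tendstoD(1)[OF cdf_lim_at_top_prob v(2)]
    by (auto dest!: eventually_happens'[OF trivial_limit_at_top_linorder])
  have ab: "a \<le> b" using a b cdf_nondecreasing[of b a] by linarith
  obtain \<tau> where \<tau>: "cdf M \<tau> = v"
    using IVT[of "cdf M" a v b] a b ab cont by auto
  have cl: "closed ?L"
    by (intro closed_Collect_le continuous_intros continuous_at_imp_continuous_on) (auto simp: cont)
  have bdd: "bdd_above ?L"
  proof (rule bdd_aboveI)
    fix t assume "t \<in> ?L"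
    then show "t \<le> b" using b cdf_nondecreasing[of b t] by (cases "t \<le> b") auto
  qed
  have S: "Sup ?L \<in> ?L" using closed_contains_Sup[OF _ bdd cl] \<tau> by blast
  have "\<tau> \<le> Sup ?L" using \<tau> bdd by (auto intro: cSup_upper)
  then have eq: "cdf M (Sup ?L) = v" using cdf_nondecreasing[of \<tau> "Sup ?L"] \<tau> S by auto
  have "?L = {.. Sup ?L}"
    using cdf_nondecreasing S bdd by (auto intro: cSup_upper order_trans)
  then show ?thesis using eq by (metis cdf_def2)
qed

text \<open>\<open>cdf_uniform\<close> covers only levels strictly between 0 and 1; the two end
  levels are reached by letting the level tend to 0 and to 1.\<close>

lemma (in real_distribution) AE_cdf_strict:
  assumes cont: "\<And>x. isCont (cdf M) x"
  shows "AE t in M. 0 < cdf M t \<and> cdf M t < 1"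
proof -
  have cdf_meas[measurable]: "cdf M \<in> borel_measurable borel"
    by (intro borel_measurable_continuous_onI continuous_at_imp_continuous_on ballI cont)
  have "prob {t. cdf M t \<le> 0} \<le> e" if "0 < e" for e
  proof -
    have "prob {t. cdf M t \<le> 0} \<le> prob {t. cdf M t \<le> min e (1/2)}"
      using that by (intro finite_measure_mono) auto
    also have "\<dots> \<le> e" using that by (subst cdf_uniform[OF cont]) auto
    finally show ?thesis .
  qed
  then have "prob {t. cdf M t \<le> 0} = 0"
    by (metis field_le_epsilon add.left_neutral antisym measure_nonneg)
  then have 1: "AE t in M. \<not> cdf M t \<le> 0"
    by (subst AE_iff_measurable[OF _ refl]) (auto simp: emeasure_eq_measure)
  have "prob {t. 1 \<le> cdf M t} \<le> e" if "0 < e" for e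
  proof -
    have "prob {t. 1 \<le> cdf M t} \<le> prob (UNIV - {t. cdf M t \<le> max (1 - e) (1/2)})"
      using that by (intro finite_measure_mono) auto
    also have "\<dots> = 1 - prob {t. cdf M t \<le> max (1 - e) (1/2)}"
      using prob_compl[of "{t. cdf M t \<le> max (1 - e) (1/2)}"] by simp
    also have "\<dots> \<le> e" using that by (subst cdf_uniform[OF cont]) auto
    finally show ?thesis .
  qed
  then have "prob {t. 1 \<le> cdf M t} = 0"
    by (metis field_le_epsilon add.left_neutral antisym measure_nonneg)
  then have 2: "AE t in M. \<not> 1 \<le> cdf M t"
    by (subst AE_iff_measurable[OF _ refl]) (auto simp: emeasure_eq_measure)
  show ?thesis using 1 2 by eventually_elim auto
qed

text \<open>
  Strict monotonicity up to null sets; below and above the support of \<open>P\<close> only the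
  second and third alternatives are available.
\<close>

definition increasing_on_mass :: "real measure \<Rightarrow> (real \<Rightarrow> real) \<Rightarrow> bool" where
  "increasing_on_mass P S \<longleftrightarrow>
    (\<forall>s. (AE t in P. s < t \<longleftrightarrow> S s < S t) \<or> (AE t in P. s < t) \<or> (AE t in P. \<not> s < t)) \<and>
    (AE s in P. AE t in P. s < t \<longleftrightarrow> S s < S t)"

text \<open>\<open>S\<close> is the quantile function of \<open>Q\<close> after the cdf of
  \<open>P\<close>. Without atoms of \<open>P\<close> the cdf is uniformly distributed, which gives
  the push-forward; without atoms of \<open>Q\<close> the map is strictly increasing up to null
  sets.\<close>

lemma quantile_transport:
  fixes P Q :: "real measure"
  assumes "real_distribution P" "real_distribution Q"
    and atoms: "\<And>x. measure P {x} = 0" "\<And>x. measure Q {x} = 0"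
  obtains S where "S \<in> borel_measurable borel" "distr P borel S = Q" "increasing_on_mass P S"
proof -
  interpret P: real_distribution P by (rule assms(1))
  interpret Q: cdf_distribution Q by (rule cdf_distribution.intro, rule assms(2))
  have cont: "isCont (cdf P) x" for x
    unfolding P.isCont_cdf by (rule atoms)
  have [measurable]: "cdf P \<in> borel_measurable borel"
    by (intro borel_measurable_continuous_onI continuous_at_imp_continuous_on ballI cont)
  \<comment> \<open>The default 0 is harmless: the cdf takes the values 0 and 1 only on a
    \<open>P\<close>-null set, and \<open>Q.I\<close> is characterized only on the open unit
    interval.\<close>
  define S where "S t = (if 0 < cdf P t \<and> cdf P t < 1 then Q.I (cdf P t) else 0)" for t
  have S: "S t \<le> x \<longleftrightarrow> cdf P t \<le> cdf Q x" if "0 < cdf P t" "cdf P t < 1" for t x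
  proof -
    have "S t = Q.I (cdf P t)" using that by (simp add: S_def)
    then show ?thesis using Q.pseudoinverse[OF that, of x] by (simp only:)
  qed
  have meas[measurable]: "S \<in> borel_measurable borel"
  proof (rule borel_measurableI_le)
    fix x
    have "{t \<in> space borel. S t \<le> x} =
      {t. 0 < cdf P t \<and> cdf P t < 1 \<and> cdf P t \<le> cdf Q x} \<union>
      {t. \<not> (0 < cdf P t \<and> cdf P t < 1) \<and> 0 \<le> x}"
      using S by (auto simp: S_def)
    also have "\<dots> \<in> sets borel" by measurable
    finally show "{t \<in> space borel. S t \<le> x} \<in> sets borel" .
  qed
  have AE: "AE t in P. 0 < cdf P t \<and> cdf P t < 1"
    by (rule P.AE_cdf_strict[OF cont])
  have distr: "distr P borel S = Q"
  proof (rule cdf_unique)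
    show "real_distribution (distr P borel S)" by (rule P.real_distribution_distr) simp
    show "cdf (distr P borel S) = cdf Q"
    proof
      fix x
      have "cdf (distr P borel S) x = measure P {t. S t \<le> x}"
        by (subst cdf_def) (auto simp: measure_distr vimage_def)
      also have "\<dots> = measure P {t. cdf P t \<le> cdf Q x}"
      proof (rule P.finite_measure_eq_AE)
        show "AE t in P. t \<in> {t. S t \<le> x} \<longleftrightarrow> t \<in> {t. cdf P t \<le> cdf Q x}"
          using AE by eventually_elim (use S in auto)
      qed measurable
      also have "\<dots> = cdf Q x"
      proof -
        consider "cdf Q x = 0" | "cdf Q x = 1" | "0 < cdf Q x" "cdf Q x < 1"
          using Q.cdf_bounded_prob[of x] Q.cdf_nonneg[of x] by linarith
        then show ?thesis
        proof cases
          case 1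
          have "measure P {t. cdf P t \<le> 0} = measure P {}"
          proof (rule P.finite_measure_eq_AE)
            show "AE t in P. t \<in> {t. cdf P t \<le> 0} \<longleftrightarrow> t \<in> {}"
              using AE by eventually_elim auto
          qed measurable
          with 1 show ?thesis by simp
        next
          case 2 then show ?thesis using P.prob_space P.cdf_bounded_prob by simp
        next
          case 3 then show ?thesis using P.cdf_uniform[OF cont] by simp
        qed
      qed
      finally show "cdf (distr P borel S) x = cdf Q x" .
    qed
  qed (rule Q.real_distribution_axioms)
  \<comment> \<open>If \<open>S t = S s\<close> held on a set of positive mass in \<open>t\<close>,
    then \<open>S s\<close> would be an atom of \<open>Q\<close>. So the weak monotonicity of
    \<open>S\<close> is almost surely strict.\<close>
  have main: "AE t in P. s < t \<longleftrightarrow> S s < S t" if s: "0 < cdf P s" "cdf P s < 1" for s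
  proof -
    have "AE x in distr P borel S. x \<noteq> S s"
      unfolding distr
      by (subst AE_iff_measurable[OF _ refl]) (auto simp: Q.emeasure_eq_measure atoms)
    then have "AE t in P. S t \<noteq> S s" by (subst (asm) AE_distr_iff) auto
    with AE show ?thesis
    proof eventually_elim
      case (elim t)
      have mono: "S t1 \<le> S t2" if "t1 \<le> t2" "0 < cdf P t1" "cdf P t1 < 1" "0 < cdf P t2" "cdf P t2 < 1" for t1 t2
      proof -
        have "cdf P t2 \<le> cdf Q (S t2)" using S[of t2 "S t2"] that by simp
        then show ?thesis using S[of t1 "S t2"] that P.cdf_nondecreasing[of t1 t2] by linarith
      qed
      show ?case using mono[of t s] mono[of s t] elim s by (cases "s < t") auto
    qed
  qed
  have trich: "(AE t in P. s < t \<longleftrightarrow> S s < S t) \<or> (AE t in P. s < t) \<or> (AE t in P. \<not> s < t)" for s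
  proof -
    consider "0 < cdf P s" "cdf P s < 1" | "cdf P s = 0" | "cdf P s = 1"
      using P.cdf_bounded_prob[of s] P.cdf_nonneg[of s] by linarith
    then show ?thesis
    proof cases
      case 1 then show ?thesis using main by blast
    next
      case 2
      have "AE t in P. s < t" using AE
        by eventually_elim (use 2 P.cdf_nondecreasing[of _ s] in \<open>force simp: not_le[symmetric]\<close>)
      then show ?thesis by blast
    next
      case 3
      have "AE t in P. \<not> s < t" using AE
        by eventually_elim (use 3 P.cdf_nondecreasing[of s] in \<open>force simp: not_le[symmetric]\<close>)
      then show ?thesis by blast
    qed
  qed
  have "AE s in P. (AE t in P. s < t \<longleftrightarrow> S s < S t)"
    using AE by eventually_elim (rule main, auto)
  with trich have "increasing_on_mass P S" by (simp add: increasing_on_mass_def)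
  from that[OF meas distr this] show thesis .
qed

text \<open>With T the inverse of \<open>S\<close>, this is the integration by parts of T' g,
  written in the variable t = T x. Since T' x is \<open>m x\<close> divided by \<mu> (T x), its
  integral against \<open>g\<close> becomes that of \<open>g (S t)\<close> over the points where
  \<mu> is nonzero. It is only an inequality because gaps in the support of \<mu> contribute with
  one sign.\<close>

lemma transport_integration_by_parts:
  fixes m \<mu> d g S :: "real \<Rightarrow> real"
  assumes m: "integrable lborel m" "\<And>x. 0 \<le> m x"
    and \<mu>: "integrable lborel \<mu>" "\<And>x. 0 \<le> \<mu> x" "\<And>t. \<mu> t \<noteq> 0 \<Longrightarrow> \<bar>t\<bar> \<le> R"
    and S: "S \<in> borel_measurable borel"
      "distr (density lborel \<mu>) borel S = density lborel m"
      "increasing_on_mass (density lborel \<mu>) S"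
    and d: "integrable lborel d" "AE x in lborel. m x = 0 \<longrightarrow> d x = 0" "integral\<^sup>L lborel d = 0"
    and g: "g \<in> borel_measurable borel" "\<And>x. 0 \<le> g x" "\<And>x. g x = - (LBINT y. indicator {x<..} y * d y)"
  shows "integrable lborel (\<lambda>t. indicator {t. \<mu> t \<noteq> 0} t * g (S t))"
    and "integrable lborel (\<lambda>t. t * (\<mu> t * (d (S t) / m (S t))))"
    and "(LBINT t. indicator {t. \<mu> t \<noteq> 0} t * g (S t)) \<le> - (LBINT t. t * (\<mu> t * (d (S t) / m (S t))))"
proof -
  have [measurable]: "m \<in> borel_measurable borel" "\<mu> \<in> borel_measurable borel" "d \<in> borel_measurable borel"
    using m(1) \<mu>(1) d(1) by (auto dest: borel_measurable_integrable)
  note [measurable] = S(1) g(1)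
  let ?P = "density lborel \<mu>" and ?Q = "density lborel m"
  define k where "k x = d x / m x" for x
  have k[measurable]: "k \<in> borel_measurable borel" unfolding k_def by measurable
  have mk: "AE x in lborel. m x * k x = d x"
    using d(2) by eventually_elim (auto simp: k_def)
  have mkI: "AE x in lborel. m x * (indicator A x * k x) = indicator A x * d x" for A
    using mk by eventually_elim (auto simp: indicator_def)
  have Qint: "(\<integral>x. indicator A x * k x \<partial>?Q) = (LBINT x. indicator A x * d x)" if [measurable]: "A \<in> sets borel" for A
    using m(2) mkI[of A] by (subst integral_density) (auto intro!: integral_cong_AE)
  have Qk: "integrable ?Q k"
  proof -
    have "integrable lborel (\<lambda>x. m x * k x)" 
      using d(1) mk by (subst integrable_cong_AE[where g=d]) auto
    then show ?thesis using m(2) by (subst integrable_density) auto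
  qed
  have PkS: "integrable ?P (\<lambda>t. k (S t))"
    using Qk unfolding S(2)[symmetric] by (subst (asm) integrable_distr_eq) auto
  have \<mu>kS: "integrable lborel (\<lambda>t. \<mu> t * k (S t))"
    using PkS \<mu>(2) by (subst (asm) integrable_density) auto
  have trans: "(\<integral>t. indicator A (S t) * k (S t) \<partial>?P) = (LBINT x. indicator A x * d x)" if [measurable]: "A \<in> sets borel" for A
    unfolding Qint[OF that, symmetric] S(2)[symmetric] by (subst integral_distr) auto
  have allint: "(\<integral>t. k (S t) \<partial>?P) = 0"
    using trans[of UNIV] d(3) by simp
  \<comment> \<open>Fubini's theorem is applied to this kernel: over \<open>s\<close> it integrates
    to \<open>(t + R) * (\<mu> t * k (S t))\<close>, and over \<open>t\<close> to
    \<open>- g (S s)\<close> for almost every \<open>s\<close> with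
    \<open>\<mu> s \<noteq> 0\<close>. The cut-off at \<open>R\<close> makes it integrable.\<close>
  define f where "f s t = indicator {-R..R} s * (indicator {s<..} t * (\<mu> t * k (S t)))" for s t :: real
  have f_eq: "f s t = (if -R \<le> s \<and> s \<le> R \<and> s < t then \<mu> t * k (S t) else 0)" for s t
    by (auto simp: f_def indicator_def)
  have meas_f[measurable]: "case_prod f \<in> borel_measurable (lborel \<Otimes>\<^sub>M lborel)"
    unfolding f_eq by measurable
  have int_st: "integrable lborel (\<lambda>t. f s t)" for s
    unfolding f_def by (intro integrable_mult_right Bochner_Integration.integrable_bound[OF \<mu>kS])
       (auto simp: indicator_def)
  have int_f: "integrable (lborel \<Otimes>\<^sub>M lborel) (case_prod f)"
  proof (rule lborel_pair.Fubini_integrable)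
    have bnd: "(LBINT t. norm (f s t)) \<le> indicator {-R..R} s * (LBINT t. norm (\<mu> t * k (S t)))" for s
    proof -
      have "(LBINT t. norm (f s t)) \<le> (LBINT t. indicator {-R..R} s * norm (\<mu> t * k (S t)))"
        by (intro integral_mono integrable_norm int_st integrable_mult_right \<mu>kS)
          (auto simp: f_def indicator_def)
      then show ?thesis by simp
    qed
    show "integrable lborel (\<lambda>s. LINT t|lborel. norm (case (s, t) of (x, xa) \<Rightarrow> f x xa))"
    proof (rule Bochner_Integration.integrable_bound)
      show "integrable lborel (\<lambda>s. indicator {-R..R} s * (LBINT t. norm (\<mu> t * k (S t))))"
        by (intro integrable_mult_left) (auto simp: emeasure_lborel_Icc_eq)
      show "AE s in lborel. norm (LINT t|lborel. norm (case (s, t) of (x, xa) \<Rightarrow> f x xa))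
          \<le> norm (indicator {-R..R} s * (LBINT t. norm (\<mu> t * k (S t))))"
        using bnd by (auto intro!: AE_I2 simp: abs_mult)
    qed measurable
    show "AE s in lborel. integrable lborel (\<lambda>t. case (s, t) of (x, xa) \<Rightarrow> f x xa)"
      using int_st by auto
  qed simp
  have fs: "(LBINT s. f s t) = (t + R) * (\<mu> t * k (S t))" for t
  proof (cases "\<mu> t = 0")
    case False
    then have t: "\<bar>t\<bar> \<le> R" using \<mu>(3) by auto
    have "(LBINT s. f s t) = (LBINT s. indicator {-R..<t} s * (\<mu> t * k (S t)))"
      using t by (intro Bochner_Integration.integral_cong) (auto simp: f_def indicator_def)
    also have "\<dots> = (t + R) * (\<mu> t * k (S t))" using t by (simp add: measure_def)
    finally show ?thesis .
  qed (simp add: f_def)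
  have ft: "(LBINT t. f s t) = indicator {-R..R} s * (LBINT x. indicator A x * d x)"
    if [measurable]: "A \<in> sets borel" and A: "AE t in ?P. s < t \<longleftrightarrow> S t \<in> A" for s A
  proof -
    have "(LBINT t. f s t) = indicator {-R..R} s * (LBINT t. \<mu> t * (indicator {s<..} t * k (S t)))"
      unfolding f_def integral_mult_right_zero by (simp only: mult.left_commute)
    also have "(LBINT t. \<mu> t * (indicator {s<..} t * k (S t))) = (\<integral>t. indicator {s<..} t * k (S t) \<partial>?P)"
      using \<mu>(2) by (subst integral_density) auto
    also have "\<dots> = (\<integral>t. indicator A (S t) * k (S t) \<partial>?P)"
      using A by (intro integral_cong_AE) (auto elim!: eventually_mono simp: indicator_def)
    finally show ?thesis by (simp add: trans)
  qed
  have ft_good: "(LBINT t. f s t) = - (indicator {-R..R} s * g (S s))"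
    if "AE t in ?P. s < t \<longleftrightarrow> S s < S t" for s
    using ft[of "{S s<..}" s] that by (simp add: g(3))
  \<comment> \<open>When \<open>s\<close> lies below the mass the whole integral of \<open>d\<close>
    is left, and when it lies above only the empty one; both are 0.\<close>
  have ft_le: "(LBINT t. f s t) \<le> 0" for s
    using S(3)[unfolded increasing_on_mass_def, THEN conjunct1, THEN spec, of s]
  proof (elim disjE)
    assume "AE t in ?P. s < t \<longleftrightarrow> S s < S t"
    from ft_good[OF this] show ?thesis using g(2) by simp
  next
    assume "AE t in ?P. s < t"
    then show ?thesis using ft[of UNIV s] d(3) by simp
  next
    assume "AE t in ?P. \<not> s < t"
    then show ?thesis using ft[of "{}" s] by simp
  qed
  have good: "AE s in lborel. \<mu> s \<noteq> 0 \<longrightarrow> (LBINT t. f s t) = - g (S s)"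
  proof -
    have "AE s in lborel. 0 < \<mu> s \<longrightarrow> (AE t in ?P. s < t \<longleftrightarrow> S s < S t)"
      using S(3)[unfolded increasing_on_mass_def, THEN conjunct2] by (subst (asm) AE_density) auto
    then show ?thesis
    proof eventually_elim
      case (elim s)
      show ?case
      proof
        assume ne: "\<mu> s \<noteq> 0"
        then have "s \<in> {-R..R}" using \<mu>(3)[of s] by (simp add: abs_le_iff)
        then show "(LBINT t. f s t) = - g (S s)"
          using ft_good elim ne \<mu>(2)[of s] by simp
      qed
    qed
  qed
  have int1: "integrable lborel (\<lambda>s. \<integral>t. f s t \<partial>lborel)"
    by (rule lborel_pair.integrable_fst[OF int_f])
  have bound: "AE s in lborel. indicator {t. \<mu> t \<noteq> 0} s * g (S s) \<le> - (LBINT t. f s t)"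
    using good by eventually_elim (use ft_le in \<open>auto simp: indicator_def\<close>)
  show I1: "integrable lborel (\<lambda>t. indicator {t. \<mu> t \<noteq> 0} t * g (S t))"
  proof (rule Bochner_Integration.integrable_bound[OF integrable_minus[OF int1]])
    show "AE x in lborel. norm (indicator {t. \<mu> t \<noteq> 0} x * g (S x)) \<le> norm (- (LBINT t. f x t))"
      using bound by eventually_elim (use g(2) in \<open>simp add: abs_mult\<close>)
  qed measurable
  have eq: "(\<lambda>t. t * (\<mu> t * k (S t))) = (\<lambda>t. (LBINT s. f s t) - R * (\<mu> t * k (S t)))"
    by (simp add: fs algebra_simps)
  have int2: "integrable lborel (\<lambda>t. \<integral>s. f s t \<partial>lborel)"
    by (rule lborel_pair.integrable_snd[OF int_f])
  have I2: "integrable lborel (\<lambda>t. t * (\<mu> t * k (S t)))"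
    unfolding eq by (intro Bochner_Integration.integrable_diff int2 integrable_mult_right \<mu>kS)
  then show "integrable lborel (\<lambda>t. t * (\<mu> t * (d (S t) / m (S t))))" by (simp add: k_def)
  have "(LBINT t. indicator {t. \<mu> t \<noteq> 0} t * g (S t)) \<le> (LBINT s. - (LBINT t. f s t))"
    using int1 I1 bound by (intro integral_mono_AE) auto
  also have "\<dots> = - (LBINT t. (LBINT s. f s t))"
    using lborel_pair.Fubini_integral[OF int_f] by simp
  also have "(LBINT t. (LBINT s. f s t)) = (LBINT t. t * (\<mu> t * k (S t)) + R * (\<mu> t * k (S t)))"
    by (simp add: fs algebra_simps)
  also have "\<dots> = (LBINT t. t * (\<mu> t * k (S t))) + R * (LBINT t. \<mu> t * k (S t))"
    using I2 \<mu>kS by (subst Bochner_Integration.integral_add) auto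
  \<comment> \<open>The term with \<open>R\<close>, which stems from the left end of the cut-off,
    vanishes because \<open>k (S t)\<close> has mean zero.\<close>
  also have "(LBINT t. \<mu> t * k (S t)) = 0"
    using allint \<mu>(2) by (subst (asm) integral_density) auto
  finally show "(LBINT t. indicator {t. \<mu> t \<noteq> 0} t * g (S t)) \<le> - (LBINT t. t * (\<mu> t * (d (S t) / m (S t))))"
    by (simp add: k_def)
qed

section \<open>The fundamental theorem of calculus on the whole line\<close>

lemma integrable_tendsto_zero:
  fixes f :: "real \<Rightarrow> real"
  assumes f: "integrable lborel f" and lim: "(f \<longlongrightarrow> L) at_top"
  shows "L = 0"
proof (rule ccontr)
  assume "L \<noteq> 0"
  then have "\<forall>\<^sub>F x in at_top. \<bar>L\<bar> / 2 < \<bar>f x\<bar>"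
    using order_tendstoD(1)[OF tendsto_rabs[OF lim], of "\<bar>L\<bar> / 2"] by simp
  then obtain N where N: "\<And>x. N \<le> x \<Longrightarrow> \<bar>L\<bar> / 2 < \<bar>f x\<bar>"
    by (auto simp: eventually_at_top_linorder)
  have "integrable lborel (\<lambda>x. indicator {N..} x * (\<bar>L\<bar> / 2))"
    using N by (intro Bochner_Integration.integrable_bound[OF f]) (auto simp: indicator_def intro!: less_imp_le)
  from integrable_mult_left[OF this, of "2 / \<bar>L\<bar>"]
  have "integrable lborel (indicator {N..} :: real \<Rightarrow> real)"
    using \<open>L \<noteq> 0\<close> by simp
  then have fin: "emeasure lborel {N..} < \<infinity>"
    by (simp add: integrable_indicator_iff)
  have "emeasure lborel {N..N + (\<bar>measure lborel {N..}\<bar> + 1)} \<le> emeasure lborel {N..}"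
    by (intro emeasure_mono) auto
  also have "\<dots> = ennreal (measure lborel {N..})"
    using fin by (intro emeasure_eq_ennreal_measure) auto
  finally show False by (simp add: ennreal_le_iff2)
qed

text \<open>\<open>f'\<close> is integrable, so \<open>f\<close> has a limit at infinity, and
  \<open>f\<close> is integrable, so that limit is 0. Reflection treats minus infinity; equating the
  two formulas for \<open>f x\<close> gives the vanishing integral.\<close>

lemma integrable_FTC:
  fixes f f' :: "real \<Rightarrow> real"
  assumes f: "integrable lborel f" and f': "integrable lborel f'"
    and deriv: "\<And>x. (f has_real_derivative f' x) (at x)" and cont: "continuous_on UNIV f'"
  shows "f x = - (LBINT y. indicator {x<..} y * f' y)" and "integral\<^sup>L lborel f' = 0"
proof -
  have up: "f x = - (LBINT y. indicator {x<..} y * f' y)"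
    if f: "integrable lborel f" and f': "integrable lborel f'"
      and deriv: "\<And>x. (f has_real_derivative f' x) (at x)" and cont: "continuous_on UNIV f'"
    for f f' :: "real \<Rightarrow> real" and x
  proof -
    have i: "integrable lborel (\<lambda>y. indicator {x<..} y * f' y)"
      by (rule Bochner_Integration.integrable_bound[OF f']) (use f' in \<open>auto simp: indicator_def\<close>)
    have "((\<lambda>b. \<integral>y. indicator {.. b} y *\<^sub>R (indicator {x<..} y * f' y) \<partial>lborel) \<longlongrightarrow>
        (LBINT y. indicator {x<..} y * f' y)) at_top"
      by (rule tendsto_integral_at_top[OF _ i]) simp
    moreover have "\<forall>\<^sub>F b in at_top. (LBINT y. indicator {.. b} y *\<^sub>R (indicator {x<..} y * f' y)) = f b - f x"
      using eventually_ge_at_top[of x]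
    proof eventually_elim
      case (elim b)
      have "(LBINT y. indicator {.. b} y *\<^sub>R (indicator {x<..} y * f' y)) = (LBINT y. f' y * indicator {x..b} y)"
        using AE_lborel_singleton[of x] f'
        by (intro integral_cong_AE) (auto elim!: eventually_mono simp: indicator_def)
      also have "\<dots> = f b - f x"
        using elim deriv cont by (intro integral_FTC_Icc_real) (auto simp: continuous_on_eq_continuous_at)
      finally show ?case .
    qed
    ultimately have "((\<lambda>b. f b - f x) \<longlongrightarrow> (LBINT y. indicator {x<..} y * f' y)) at_top"
      by (rule Lim_transform_eventually)
    then have "((\<lambda>b. (f b - f x) + f x) \<longlongrightarrow> (LBINT y. indicator {x<..} y * f' y) + f x) at_top"
      by (intro tendsto_intros)
    then have "(LBINT y. indicator {x<..} y * f' y) + f x = 0"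
      by (intro integrable_tendsto_zero[OF f]) simp
    then show ?thesis by simp
  qed
  show 1: "f x = - (LBINT y. indicator {x<..} y * f' y)"
    by (rule up[OF f f' deriv cont])
  let ?h = "\<lambda>x. f (- x)" and ?h' = "\<lambda>x. - f' (- x)"
  have dh: "(?h has_real_derivative ?h' y) (at y)" for y
    using deriv[of "- y"] by (simp add: DERIV_mirror)
  have 2: "?h (-x) = - (LBINT y. indicator {-x<..} y * ?h' y)"
  proof (rule up)
    show "integrable lborel ?h" "integrable lborel ?h'"
      using lborel_integrable_real_affine[OF f, of "-1" 0] lborel_integrable_real_affine[OF f', of "-1" 0]
      by auto
    show "continuous_on UNIV ?h'"
      by (intro continuous_intros continuous_on_compose2[OF cont]) auto
  qed (rule dh)
  have "(LBINT y. indicator {-x<..} y * ?h' y) = - (LBINT y. indicator {..<x} y * f' y)"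
    by (subst lborel_integral_real_affine[where c="-1" and t=0]) (auto simp: indicator_def intro!: Bochner_Integration.integral_cong)
  with 1 2 have "(LBINT y. indicator {x<..} y * f' y) + (LBINT y. indicator {..<x} y * f' y) = 0" by simp
  moreover have "integral\<^sup>L lborel f' = (LBINT y. indicator {x<..} y * f' y + indicator {..<x} y * f' y)"
    using AE_lborel_singleton[of x] f'
    by (intro integral_cong_AE) (auto elim!: eventually_mono simp: indicator_def)
  moreover have "integrable lborel (\<lambda>y. indicator A y * f' y)" if "A \<in> sets borel" for A
    by (rule Bochner_Integration.integrable_bound[OF f']) (use f' that in \<open>auto simp: indicator_def\<close>)
  ultimately show "integral\<^sup>L lborel f' = 0" by simp
qed

text \<open>Substitution x = S t. Where \<open>m\<close> vanishes, division by 0 gives 0, hence the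
  indicator on the right.\<close>

lemma integral_transport:
  fixes m \<mu> \<phi> S :: "real \<Rightarrow> real"
  assumes m: "integrable lborel m" "\<And>x. 0 \<le> m x"
    and \<mu>: "integrable lborel \<mu>" "\<And>x. 0 \<le> \<mu> x"
    and S: "S \<in> borel_measurable borel" "distr (density lborel \<mu>) borel S = density lborel m"
    and \<phi>: "integrable lborel \<phi>"
  shows "integrable lborel (\<lambda>t. \<mu> t * (\<phi> (S t) / m (S t)))"
    and "(LBINT t. \<mu> t * (\<phi> (S t) / m (S t))) = (LBINT x. indicator {x. m x \<noteq> 0} x * \<phi> x)"
proof -
  have [measurable]: "m \<in> borel_measurable borel" "\<mu> \<in> borel_measurable borel" "\<phi> \<in> borel_measurable borel"
    using m(1) \<mu>(1) \<phi> by (auto dest: borel_measurable_integrable)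
  note [measurable] = S(1)
  have eq: "m x * (\<phi> x / m x) = indicator {x. m x \<noteq> 0} x * \<phi> x" for x by (simp add: indicator_def)
  have "integrable lborel (\<lambda>x. m x * (\<phi> x / m x))"
    unfolding eq by (rule Bochner_Integration.integrable_bound[OF \<phi>]) (auto simp: indicator_def)
  then have "integrable (density lborel m) (\<lambda>x. \<phi> x / m x)"
    using m(2) by (subst integrable_density) auto
  then have "integrable (density lborel \<mu>) (\<lambda>t. \<phi> (S t) / m (S t))"
    unfolding S(2)[symmetric] by (subst (asm) integrable_distr_eq) auto
  then show "integrable lborel (\<lambda>t. \<mu> t * (\<phi> (S t) / m (S t)))"
    using \<mu>(2) by (subst (asm) integrable_density) auto
  have "(LBINT t. \<mu> t * (\<phi> (S t) / m (S t))) = (\<integral>t. \<phi> (S t) / m (S t) \<partial>density lborel \<mu>)"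
    using \<mu>(2) by (subst integral_density) auto
  also have "\<dots> = (\<integral>x. \<phi> x / m x \<partial>density lborel m)"
    unfolding S(2)[symmetric] by (subst integral_distr) auto
  also have "\<dots> = (LBINT x. m x * (\<phi> x / m x))"
    using m(2) by (subst integral_density) auto
  finally show "(LBINT t. \<mu> t * (\<phi> (S t) / m (S t))) = (LBINT x. indicator {x. m x \<noteq> 0} x * \<phi> x)"
    unfolding eq .
qed

text \<open>\<open>ineq\<close> is integrated along y = S t, with \<mu> t / m y in the place of the
  derivative of \<open>S\<close>. By the integration by parts the bare summand \<open>g y\<close>
  and the term with \<open>d y * t\<close> together contribute at most 0.\<close>

lemma one_dimensional_transport_inequality:
  fixes m \<mu> g d u e v :: "real \<Rightarrow> real"
  assumes m: "integrable lborel m" "\<And>x. 0 \<le> m x" "integral\<^sup>L lborel m = 1"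
    and \<mu>: "integrable lborel \<mu>" "\<And>x. 0 \<le> \<mu> x" "integral\<^sup>L lborel \<mu> = 1"
    and R: "\<And>t. \<mu> t \<noteq> 0 \<Longrightarrow> \<bar>t\<bar> \<le> R"
    and d: "integrable lborel d" "AE x in lborel. m x = 0 \<longrightarrow> d x = 0" "integral\<^sup>L lborel d = 0"
    and g: "integrable lborel g" "\<And>x. 0 \<le> g x" "\<And>x. g x = - (LBINT y. indicator {x<..} y * d y)"
    and u: "integrable lborel u" "AE x in lborel. m x = 0 \<longrightarrow> 0 \<le> u x"
    and e: "integrable lborel e" and v: "integrable lborel v"
    and ev: "AE t in lborel. \<mu> t = 0 \<longrightarrow> A * e t \<le> v t"
    and B: "0 \<le> B"
    and P: "AE y in lborel. P y" and Q: "AE t in lborel. Q t"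
    and ineq: "\<And>y t. P y \<Longrightarrow> Q t \<Longrightarrow> 0 < m y \<Longrightarrow> 0 < \<mu> t \<Longrightarrow>
      A * e t \<le> (B * (\<mu> t / m y) + 1) * g y + v t + (\<mu> t / m y) * (u y + d y * t)"
  shows "A * integral\<^sup>L lborel e \<le> B * integral\<^sup>L lborel g + integral\<^sup>L lborel v + integral\<^sup>L lborel u"
proof -
  have [measurable]: "m \<in> borel_measurable borel" "\<mu> \<in> borel_measurable borel" 
    "g \<in> borel_measurable borel" "u \<in> borel_measurable borel"
    using m(1) \<mu>(1) g(1) u(1) by (auto dest: borel_measurable_integrable)
  let ?P = "density lborel \<mu>" and ?Q = "density lborel m"
  obtain S where S[measurable]: "S \<in> borel_measurable borel" and SD: "distr ?P borel S = ?Q"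
    and S3: "increasing_on_mass ?P S"
  proof (rule quantile_transport)
    show "real_distribution ?P" "real_distribution ?Q"
      by (rule real_distribution_density[OF \<mu>], rule real_distribution_density[OF m])
    show "measure ?P {x} = 0" "measure ?Q {x} = 0" for x
      by (rule measure_density_singleton, measurable)+
  qed blast
  note ibp = transport_integration_by_parts[OF m(1,2) \<mu>(1,2) R S SD S3 d \<open>g \<in> borel_measurable borel\<close> g(2,3)]
  note tr = integral_transport[OF m(1,2) \<mu>(1,2) S SD]
  have "AE y in ?Q. P y \<and> 0 < m y"
    using P by (subst AE_density) (auto elim!: eventually_mono)
  then have "AE t in ?P. P (S t) \<and> 0 < m (S t)"
    unfolding SD[symmetric] by (intro AE_distrD[of S _ borel]) auto
  then have "AE t in lborel. 0 < \<mu> t \<longrightarrow> P (S t) \<and> 0 < m (S t)"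
    by (subst (asm) AE_density) auto
  with Q ev have AE: "AE t in lborel. A * e t \<le> B * (\<mu> t * (g (S t) / m (S t))) + indicator {t. \<mu> t \<noteq> 0} t * g (S t) + v t
      + \<mu> t * (u (S t) / m (S t)) + t * (\<mu> t * (d (S t) / m (S t)))"
  proof eventually_elim
    case (elim t)
    show ?case
    proof (cases "\<mu> t = 0")
      case True then show ?thesis using elim by simp
    next
      case False
      then have "0 < \<mu> t" using \<mu>(2)[of t] by simp
      with elim have "A * e t \<le> (B * (\<mu> t / m (S t)) + 1) * g (S t) + v t + (\<mu> t / m (S t)) * (u (S t) + d (S t) * t)"
        by (intro ineq) auto
      also have "\<dots> = B * (\<mu> t * (g (S t) / m (S t))) + g (S t) + v t
          + \<mu> t * (u (S t) / m (S t)) + t * (\<mu> t * (d (S t) / m (S t)))"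
        using elim \<open>0 < \<mu> t\<close> by (simp add: field_simps)
      finally show ?thesis using False by simp
    qed
  qed
  have "A * integral\<^sup>L lborel e = (LBINT t. A * e t)" by simp
  also have "\<dots> \<le> (LBINT t. B * (\<mu> t * (g (S t) / m (S t))) + indicator {t. \<mu> t \<noteq> 0} t * g (S t) + v t
      + \<mu> t * (u (S t) / m (S t)) + t * (\<mu> t * (d (S t) / m (S t))))"
    by (intro integral_mono_AE AE Bochner_Integration.integrable_add integrable_mult_right e v tr g(1) u(1) ibp(1,2))
  also have "\<dots> = B * (LBINT x. indicator {x. m x \<noteq> 0} x * g x) + (LBINT t. indicator {t. \<mu> t \<noteq> 0} t * g (S t))
      + integral\<^sup>L lborel v + (LBINT x. indicator {x. m x \<noteq> 0} x * u x) + (LBINT t. t * (\<mu> t * (d (S t) / m (S t))))"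
    by (simp add: Bochner_Integration.integrable_add e v tr g(1) u(1) ibp(1,2) del: times_divide_eq_right times_divide_eq_left)
  \<comment> \<open>Extending the integrals to the zeros of \<open>m\<close> only increases them,
    since \<open>g\<close> and \<open>u\<close> are nonnegative there.\<close>
  also have "\<dots> \<le> B * integral\<^sup>L lborel g + integral\<^sup>L lborel v + integral\<^sup>L lborel u"
  proof -
    have "(LBINT x. indicator {x. m x \<noteq> 0} x * g x) \<le> integral\<^sup>L lborel g"
      using g(1,2) by (intro integral_mono Bochner_Integration.integrable_bound[OF g(1)]) (auto simp: indicator_def)
    moreover have "(LBINT x. indicator {x. m x \<noteq> 0} x * u x) \<le> integral\<^sup>L lborel u"
      using u(1) by (intro integral_mono_AE Bochner_Integration.integrable_bound[OF u(1)] eventually_mono[OF u(2)]) (auto simp: indicator_def)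
    ultimately show ?thesis using ibp(3) mult_left_mono[OF _ B, of "\<integral>x. indicator {x. m x \<noteq> 0} x * g x \<partial>lborel" "integral\<^sup>L lborel g"] by linarith
  qed
  finally show ?thesis .
qed

section \<open>Transport inequality in product coordinates\<close>

abbreviation lborel_PiM :: "'i set \<Rightarrow> ('i \<Rightarrow> real) measure" where
  "lborel_PiM I \<equiv> Pi\<^sub>M I (\<lambda>_. lborel)"

interpretation lborel_product: product_sigma_finite "\<lambda>_::'i. lborel :: real measure"
  by standard

lemma sigma_finite_lborel_PiM: "finite I \<Longrightarrow> sigma_finite_measure (lborel_PiM I)"
  by (rule lborel_product.sigma_finite)

lemma pair_sigma_finite_lborel_PiM: "finite I \<Longrightarrow> pair_sigma_finite (lborel_PiM I) (lborel :: real measure)"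
  by (intro pair_sigma_finite.intro sigma_finite_lborel_PiM sigma_finite_lborel)

lemma distr_fun_upd_lborel_PiM:
  assumes I: "finite I" "i \<notin> I"
  shows "distr (lborel_PiM I \<Otimes>\<^sub>M lborel) (lborel_PiM (insert i I)) (\<lambda>(x, y). x(i := y)) = lborel_PiM (insert i I)"
proof (rule lborel_product.PiM_eqI)
  interpret pair_sigma_finite "lborel_PiM I" "lborel :: real measure"
    by (rule pair_sigma_finite_lborel_PiM[OF I(1)])
  fix A :: "'a \<Rightarrow> real set" assume A: "\<And>j. j \<in> insert i I \<Longrightarrow> A j \<in> sets lborel"
  have "(\<lambda>(x, y). x(i := y)) -` Pi\<^sub>E (insert i I) A \<inter> space (lborel_PiM I \<Otimes>\<^sub>M lborel) = Pi\<^sub>E I A \<times> A i"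
  proof (rule set_eqI, clarify)
    fix x :: "'a \<Rightarrow> real" and y :: real
    show "((x, y) \<in> (\<lambda>(x, y). x(i := y)) -` Pi\<^sub>E (insert i I) A \<inter> space (lborel_PiM I \<Otimes>\<^sub>M lborel)) \<longleftrightarrow>
       ((x, y) \<in> Pi\<^sub>E I A \<times> A i)"
      using I(2) by (auto simp: space_pair_measure space_PiM PiE_iff extensional_def split: if_splits)
  qed
  then show "emeasure (distr (lborel_PiM I \<Otimes>\<^sub>M lborel) (lborel_PiM (insert i I)) (\<lambda>(x, y). x(i := y))) (Pi\<^sub>E (insert i I) A)
      = (\<Prod>j\<in>insert i I. emeasure lborel (A j))"
    using A I by (subst emeasure_distr)
      (auto simp: lborel.emeasure_pair_measure_Times lborel_product.emeasure_PiM sets_PiM_I_finite mult.commute)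
qed (use I in simp_all)

lemma measurable_fun_upd_lborel_PiM[measurable (raw)]:
  "f \<in> borel_measurable (lborel_PiM (insert i I)) \<Longrightarrow>
    (\<lambda>(x, y). f (x(i := y))) \<in> borel_measurable (lborel_PiM I \<Otimes>\<^sub>M lborel)"
proof -
  assume [measurable]: "f \<in> borel_measurable (lborel_PiM (insert i I))"
  show ?thesis by measurable
qed

lemma
  fixes f :: "('i \<Rightarrow> real) \<Rightarrow> real"
  assumes I: "finite I" "i \<notin> I" and f: "integrable (lborel_PiM (insert i I)) f"
  shows integrable_fun_upd: "integrable (lborel_PiM I \<Otimes>\<^sub>M lborel) (\<lambda>(x, y). f (x(i := y)))"
    and integrable_section: "integrable lborel (\<lambda>y. \<integral>x. f (x(i := y)) \<partial>lborel_PiM I)"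
    and AE_integrable_section: "AE y in lborel. integrable (lborel_PiM I) (\<lambda>x. f (x(i := y)))"
    and AE_integrable_line: "AE x in lborel_PiM I. integrable lborel (\<lambda>y. f (x(i := y)))"
    and integral_section: "(\<integral>y. \<integral>x. f (x(i := y)) \<partial>lborel_PiM I \<partial>lborel) = integral\<^sup>L (lborel_PiM (insert i I)) f"
proof -
  interpret pair_sigma_finite "lborel_PiM I" "lborel :: real measure"
    by (rule pair_sigma_finite_lborel_PiM[OF I(1)])
  have [measurable]: "f \<in> borel_measurable (lborel_PiM (insert i I))" using f by auto
  have upd[measurable]: "(\<lambda>(x, y). x(i := y)) \<in> lborel_PiM I \<Otimes>\<^sub>M lborel \<rightarrow>\<^sub>M lborel_PiM (insert i I)"
    by measurable
  show *: "integrable (lborel_PiM I \<Otimes>\<^sub>M lborel) (\<lambda>(x, y). f (x(i := y)))"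
    using integrable_distr[OF upd, of f] f unfolding distr_fun_upd_lborel_PiM[OF I]
    by (simp add: case_prod_unfold)
  show "integrable lborel (\<lambda>y. \<integral>x. f (x(i := y)) \<partial>lborel_PiM I)"
    "AE y in lborel. integrable (lborel_PiM I) (\<lambda>x. f (x(i := y)))"
    "AE x in lborel_PiM I. integrable lborel (\<lambda>y. f (x(i := y)))"
    using integrable_snd[OF *] AE_integrable_snd[OF *] AE_integrable_fst[OF *] by simp_all
  have "(\<integral>y. \<integral>x. f (x(i := y)) \<partial>lborel_PiM I \<partial>lborel) = (\<integral>(x, y). f (x(i := y)) \<partial>(lborel_PiM I \<Otimes>\<^sub>M lborel))"
    using integral_snd[OF *] by simp
  also have "\<dots> = integral\<^sup>L (distr (lborel_PiM I \<Otimes>\<^sub>M lborel) (lborel_PiM (insert i I)) (\<lambda>(x, y). x(i := y))) f"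
    by (subst integral_distr) (auto simp: case_prod_unfold)
  finally show "(\<integral>y. \<integral>x. f (x(i := y)) \<partial>lborel_PiM I \<partial>lborel) = integral\<^sup>L (lborel_PiM (insert i I)) f"
    unfolding distr_fun_upd_lborel_PiM[OF I] .
qed

text \<open>The one-dimensional theorem is applied on almost every line in direction
  \<open>i\<close> and only then integrated over the other coordinates, so the marginal of
  \<open>G\<close> is never differentiated.\<close>

lemma section_FTC:
  fixes G D :: "('i \<Rightarrow> real) \<Rightarrow> real"
  assumes I: "finite I" "i \<notin> I"
    and G: "integrable (lborel_PiM (insert i I)) G" and D: "integrable (lborel_PiM (insert i I)) D"
    and deriv: "\<And>x y. ((\<lambda>z. G (x(i := z))) has_real_derivative D (x(i := y))) (at y)"
    and cont: "\<And>x. continuous_on UNIV (\<lambda>y. D (x(i := y)))"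
  shows "(LINT x|lborel_PiM I. G (x(i := y))) = - (LBINT z. indicator {y<..} z * (LINT x|lborel_PiM I. D (x(i := z))))"
    and "(\<integral>y. \<integral>x. D (x(i := y)) \<partial>lborel_PiM I \<partial>lborel) = 0"
proof -
  interpret pair_sigma_finite "lborel_PiM I" "lborel :: real measure"
    by (rule pair_sigma_finite_lborel_PiM[OF I(1)])
  have [measurable]: "G \<in> borel_measurable (lborel_PiM (insert i I))" "D \<in> borel_measurable (lborel_PiM (insert i I))"
    using G D by auto
  have ftc: "AE x in lborel_PiM I. (\<forall>y. G (x(i := y)) = - (LBINT z. indicator {y<..} z * D (x(i := z)))) \<and>
      (LBINT z. D (x(i := z))) = 0"
    using AE_integrable_line[OF I G] AE_integrable_line[OF I D]
  proof eventually_elim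
    case (elim x)
    show ?case using integrable_FTC[OF elim deriv cont] by blast
  qed
  have Dint: "integrable (lborel_PiM I \<Otimes>\<^sub>M lborel) (\<lambda>(x, z). D (x(i := z)))"
    by (rule integrable_fun_upd[OF I D])
  have Dint': "integrable (lborel_PiM I \<Otimes>\<^sub>M lborel) (\<lambda>(x, z). indicator {y<..} z * D (x(i := z)))"
    by (rule Bochner_Integration.integrable_bound[OF Dint]) (auto simp: indicator_def case_prod_beta)
  have "(LINT x|lborel_PiM I. G (x(i := y))) = (\<integral>x. - (LBINT z. indicator {y<..} z * D (x(i := z))) \<partial>lborel_PiM I)"
    using ftc by (intro integral_cong_AE) (auto elim!: eventually_mono)
  also have "\<dots> = - (\<integral>z. \<integral>x. indicator {y<..} z * D (x(i := z)) \<partial>lborel_PiM I \<partial>lborel)"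
    using Fubini_integral[OF Dint'] by simp
  finally show "(LINT x|lborel_PiM I. G (x(i := y))) = - (LBINT z. indicator {y<..} z * (LINT x|lborel_PiM I. D (x(i := z))))"
    by simp
  have "(\<integral>y. \<integral>x. D (x(i := y)) \<partial>lborel_PiM I \<partial>lborel) = (\<integral>x. (LBINT y. D (x(i := y))) \<partial>lborel_PiM I)"
    by (rule Fubini_integral[OF Dint])
  also have "\<dots> = (LINT x|lborel_PiM I. 0)"
    using ftc by (intro integral_cong_AE) (auto elim!: eventually_mono)
  finally show "(\<integral>y. \<integral>x. D (x(i := y)) \<partial>lborel_PiM I \<partial>lborel) = 0" by simp
qed

text \<open>\<open>G x powr (a / (a - 1))\<close> is the density of the source and \<psi> that of
  the target. The assumption \<open>fenchel\<close> stands for the duality estimate of the gradient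
  of \<open>G\<close> against the target point. Leaving \<open>U\<close> arbitrary, even in sign,
  keeps the locale stable under sections.\<close>

locale transport_data =
  fixes I :: "'i set" and a R :: real
    and G :: "('i \<Rightarrow> real) \<Rightarrow> real" and D :: "'i \<Rightarrow> ('i \<Rightarrow> real) \<Rightarrow> real"
    and \<psi> W U :: "('i \<Rightarrow> real) \<Rightarrow> real"
  assumes fin: "finite I" and card_less: "real (card I) < a" and a_gt_1: "1 < a"
    and G_nonneg: "\<And>x. 0 \<le> G x" and \<psi>_nonneg: "\<And>t. 0 \<le> \<psi> t"
    and support: "\<And>i t. i \<in> I \<Longrightarrow> \<psi> t \<noteq> 0 \<Longrightarrow> \<bar>t i\<bar> \<le> R"
    and int_G: "integrable (lborel_PiM I) G"
    and int_D: "\<And>i. i \<in> I \<Longrightarrow> integrable (lborel_PiM I) (D i)"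
    and int_F: "integrable (lborel_PiM I) (\<lambda>x. G x powr (a / (a - 1)))"
    and int_\<psi>: "integrable (lborel_PiM I) \<psi>"
    and int_\<psi>_powr: "integrable (lborel_PiM I) (\<lambda>t. \<psi> t powr (1 - 1 / a))"
    and int_\<psi>_W: "integrable (lborel_PiM I) (\<lambda>t. \<psi> t * W t)"
    and int_U: "integrable (lborel_PiM I) U"
    and deriv: "\<And>i x y. i \<in> I \<Longrightarrow> ((\<lambda>z. G (x(i := z))) has_real_derivative D i (x(i := y))) (at y)"
    and cont: "\<And>i x. i \<in> I \<Longrightarrow> continuous_on UNIV (\<lambda>y. D i (x(i := y)))"
    and fenchel: "\<And>x t. \<psi> t \<noteq> 0 \<Longrightarrow> - (\<Sum>i\<in>I. D i x * t i) \<le> G x powr (a / (a - 1)) * W t + U x"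
begin

lemma D_eq_0: "D i x = 0" if "i \<in> I" "G x = 0"
proof -
  have "((\<lambda>z. G (x(i := z))) has_real_derivative D i x) (at (x i))"
    using deriv[OF that(1), of x "x i"] by simp
  then show ?thesis
    by (rule DERIV_local_min[where d=1]) (use that G_nonneg in auto)
qed

lemma powr_scale: "0 < m \<Longrightarrow> (G x / m powr ((a - 1) / a)) powr (a / (a - 1)) = G x powr (a / (a - 1)) / m"
  using G_nonneg a_gt_1 by (simp add: powr_divide powr_powr)

text \<open>Dividing the source density by its mass \<open>m\<close> divides \<open>G\<close> by
  \<open>m powr ((a - 1) / a)\<close>; the compensating factor \<open>m powr (1 / a)\<close> goes to
  \<open>W\<close>.\<close>

lemma scaled:
  assumes m: "0 < m" and \<mu>: "0 < \<mu>"
  shows "transport_data I a R (\<lambda>x. G x / m powr ((a - 1) / a)) (\<lambda>i x. D i x / m powr ((a - 1) / a))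
    (\<lambda>t. \<psi> t / \<mu>) (\<lambda>t. m powr (1 / a) * W t) (\<lambda>x. U x / m powr ((a - 1) / a))"
proof
  show "integrable (lborel_PiM I) (\<lambda>x. (G x / m powr ((a - 1) / a)) powr (a / (a - 1)))"
    unfolding powr_scale[OF m] using int_F by simp
  show "integrable (lborel_PiM I) (\<lambda>t. (\<psi> t / \<mu>) powr (1 - 1 / a))"
    using int_\<psi>_powr \<mu> \<psi>_nonneg by (simp add: powr_divide)
  show "integrable (lborel_PiM I) (\<lambda>t. \<psi> t / \<mu> * (m powr (1 / a) * W t))"
    using integrable_mult_right[OF int_\<psi>_W, of "m powr (1 / a) / \<mu>"] by (simp add: field_simps)
  show "((\<lambda>z. G (x(i := z)) / m powr ((a - 1) / a)) has_real_derivative D i (x(i := y)) / m powr ((a - 1) / a)) (at y)"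
    if "i \<in> I" for i x y
    by (intro DERIV_cdivide deriv that)
  show "continuous_on UNIV (\<lambda>y. D i (x(i := y)) / m powr ((a - 1) / a))" if "i \<in> I" for i x
    using m by (intro continuous_intros cont that) auto
  fix x t assume "\<psi> t / \<mu> \<noteq> 0"
  then have "- (\<Sum>i\<in>I. D i x * t i) \<le> G x powr (a / (a - 1)) * W t + U x"
    by (intro fenchel) auto
  then have "- (\<Sum>i\<in>I. D i x * t i) / m powr ((a - 1) / a) \<le> (G x powr (a / (a - 1)) * W t + U x) / m powr ((a - 1) / a)"
    by (intro divide_right_mono) auto
  moreover have "m powr (1 / a) * m powr ((a - 1) / a) = m"
    using m a_gt_1 by (simp add: powr_add[symmetric] add_divide_distrib[symmetric])
  then have "G x powr (a / (a - 1)) * W t / m powr ((a - 1) / a) = G x powr (a / (a - 1)) / m * (m powr (1 / a) * W t)"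
    using m by (simp add: field_simps)
  ultimately show "- (\<Sum>i\<in>I. D i x / m powr ((a - 1) / a) * t i)
      \<le> (G x / m powr ((a - 1) / a)) powr (a / (a - 1)) * (m powr (1 / a) * W t) + U x / m powr ((a - 1) / a)"
    unfolding powr_scale[OF m] by (simp add: sum_divide_distrib add_divide_distrib)
qed (use fin card_less a_gt_1 G_nonneg \<psi>_nonneg support int_G int_D int_\<psi> int_U \<mu> in auto)

end

text \<open>Freezing coordinate \<open>i\<close> at \<open>y\<close> in the source and at
  \<open>t\<close> in the target moves the \<open>i\<close>-th term of the sum in
  \<open>fenchel\<close> to the right, where \<open>U\<close> absorbs it.\<close>

lemma transport_data_section:
  assumes "transport_data (insert i I) a R G D \<psi> W U" and i: "i \<notin> I" and fin: "finite I"
    and int: "integrable (lborel_PiM I) (\<lambda>x. G (x(i := y)))"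
      "\<And>j. j \<in> insert i I \<Longrightarrow> integrable (lborel_PiM I) (\<lambda>x. D j (x(i := y)))"
      "integrable (lborel_PiM I) (\<lambda>x. G (x(i := y)) powr (a / (a - 1)))"
      "integrable (lborel_PiM I) (\<lambda>x. U (x(i := y)))"
      "integrable (lborel_PiM I) (\<lambda>x. \<psi> (x(i := t)))"
      "integrable (lborel_PiM I) (\<lambda>x. \<psi> (x(i := t)) powr (1 - 1 / a))"
      "integrable (lborel_PiM I) (\<lambda>x. \<psi> (x(i := t)) * W (x(i := t)))"
  shows "transport_data I a R (\<lambda>x. G (x(i := y))) (\<lambda>j x. D j (x(i := y)))
    (\<lambda>x. \<psi> (x(i := t))) (\<lambda>x. W (x(i := t))) (\<lambda>x. U (x(i := y)) + D i (x(i := y)) * t)"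
proof -
  interpret transport_data "insert i I" a R G D \<psi> W U by fact
  show ?thesis
  proof
    show "real (card I) < a" using card_less fin i by simp
    show "\<bar>s j\<bar> \<le> R" if "j \<in> I" "\<psi> (s(i := t)) \<noteq> 0" for j s
      using support[OF _ that(2), of j] that i by (auto split: if_splits)
    show "((\<lambda>z. G ((x(j := z))(i := y))) has_real_derivative D j ((x(j := z))(i := y))) (at z)" if "j \<in> I" for j x z
    proof -
      have "j \<noteq> i" using that i by auto
      then show ?thesis using deriv[of j "x(i := y)" z] that by (simp add: fun_upd_twist[of j i])
    qed
    show "continuous_on UNIV (\<lambda>z. D j ((x(j := z))(i := y)))" if "j \<in> I" for j x
    proof -
      have "j \<noteq> i" using that i by auto
      then show ?thesis using cont[of j "x(i := y)"] that by (simp add: fun_upd_twist[of j i])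
    qed
    fix x s assume "\<psi> (s(i := t)) \<noteq> 0"
    from fenchel[OF this, of "x(i := y)"]
    have "- (D i (x(i := y)) * t + (\<Sum>j\<in>I. D j (x(i := y)) * (s(i := t)) j))
        \<le> G (x(i := y)) powr (a / (a - 1)) * W (s(i := t)) + U (x(i := y))"
      using i fin by simp
    moreover have "(\<Sum>j\<in>I. D j (x(i := y)) * (s(i := t)) j) = (\<Sum>j\<in>I. D j (x(i := y)) * s j)"
      using i by (intro sum.cong) auto
    ultimately show "- (\<Sum>j\<in>I. D j (x(i := y)) * s j)
        \<le> G (x(i := y)) powr (a / (a - 1)) * W (s(i := t)) + (U (x(i := y)) + D i (x(i := y)) * t)"
      by simp
  qed (use fin a_gt_1 G_nonneg \<psi>_nonneg int in auto)
qed

text \<open>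
  The induction hypothesis is used for sections, whose masses \<open>m\<close> and \<open>\<mu>\<close> differ;
  \<open>r\<close> carries the weight that the arithmetic-geometric mean inequality leaves
  for the coordinates already treated.
\<close>

lemma transport_inequality_unnormalized:
  fixes G :: "('i \<Rightarrow> real) \<Rightarrow> real"
  assumes norm: "\<And>G D \<psi> W U. transport_data I a R G D \<psi> W U \<Longrightarrow>
      (LINT x|lborel_PiM I. G x powr (a / (a - 1))) = 1 \<Longrightarrow> integral\<^sup>L (lborel_PiM I) \<psi> = 1 \<Longrightarrow>
      a * r powr ((a - card I) / a) * (LINT t|lborel_PiM I. \<psi> t powr (1 - 1 / a)) \<le>
      (a - card I) * r * integral\<^sup>L (lborel_PiM I) G + (LINT t|lborel_PiM I. \<psi> t * W t) + integral\<^sup>L (lborel_PiM I) U"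
    and td: "transport_data I a R G D \<psi> W U"
    and m: "(LINT x|lborel_PiM I. G x powr (a / (a - 1))) = m" "0 < m"
    and \<mu>: "integral\<^sup>L (lborel_PiM I) \<psi> = \<mu>" "0 < \<mu>"
  shows "a * r powr ((a - card I) / a) * (\<mu> / m) powr (1 / a) * (LINT t|lborel_PiM I. \<psi> t powr (1 - 1 / a)) \<le>
      (a - card I) * r * (\<mu> / m) * integral\<^sup>L (lborel_PiM I) G + (LINT t|lborel_PiM I. \<psi> t * W t)
      + (\<mu> / m) * integral\<^sup>L (lborel_PiM I) U"
proof -
  interpret transport_data I a R G D \<psi> W U by fact
  let ?b = "(a - 1) / a"
  have "a * r powr ((a - card I) / a) * (LINT t|lborel_PiM I. (\<psi> t / \<mu>) powr (1 - 1 / a)) \<le>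
      (a - card I) * r * (LINT x|lborel_PiM I. G x / m powr ?b) + (LINT t|lborel_PiM I. \<psi> t / \<mu> * (m powr (1 / a) * W t))
      + (LINT x|lborel_PiM I. U x / m powr ?b)"
    using m \<mu> by (intro norm[OF scaled[OF m(2) \<mu>(2)]]) (simp_all add: powr_scale)
  also have "(\<lambda>t. \<psi> t / \<mu> * (m powr (1 / a) * W t)) = (\<lambda>t. m powr (1 / a) / \<mu> * (\<psi> t * W t))"
    by (simp add: field_simps)
  also have "(\<lambda>t. (\<psi> t / \<mu>) powr (1 - 1 / a)) = (\<lambda>t. \<psi> t powr (1 - 1 / a) / \<mu> powr (1 - 1 / a))"
    using \<mu> \<psi>_nonneg by (simp add: powr_divide)
  finally have *: "a * r powr ((a - card I) / a) * ((LINT t|lborel_PiM I. \<psi> t powr (1 - 1 / a)) / \<mu> powr (1 - 1 / a)) \<le>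
      (a - card I) * r * (integral\<^sup>L (lborel_PiM I) G / m powr ?b) + m powr (1 / a) / \<mu> * (LINT t|lborel_PiM I. \<psi> t * W t)
      + integral\<^sup>L (lborel_PiM I) U / m powr ?b" by simp
  have e1: "\<mu> / m powr (1 / a) / \<mu> powr (1 - 1 / a) = (\<mu> / m) powr (1 / a)"
    using m \<mu> by (simp add: powr_divide powr_diff)
  have e2: "\<mu> / m powr (1 / a) / m powr ?b = \<mu> / m"
    using m a_gt_1 by (simp add: powr_add[symmetric] add_divide_distrib[symmetric])
  \<comment> \<open>This factor brings the coefficient of the integral of
    \<open>\<psi> t * W t\<close> back to 1.\<close>
  from mult_left_mono[OF *, of "\<mu> / m powr (1 / a)"] m \<mu>
  have "a * r powr ((a - card I) / a) * (\<mu> / m powr (1 / a) / \<mu> powr (1 - 1 / a)) * (LINT t|lborel_PiM I. \<psi> t powr (1 - 1 / a)) \<le>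
      (a - card I) * r * (\<mu> / m powr (1 / a) / m powr ?b) * integral\<^sup>L (lborel_PiM I) G + (LINT t|lborel_PiM I. \<psi> t * W t)
      + (\<mu> / m powr (1 / a) / m powr ?b) * integral\<^sup>L (lborel_PiM I) U"
    by (simp add: distrib_left mult.assoc mult.left_commute)
  then show ?thesis unfolding e1 e2 .
qed

text \<open>For a triangular map with diagonal derivatives t_1, ..., t_n this is the integral
  against \<open>G\<close> of \<open>a r^((a-n)/a) (t_1 ... t_n)^(1/a) \<le> (a - n) r + t_1 + ... +
  t_n\<close>, followed by an integration by parts and \<open>fenchel\<close>. In the induction each
  coordinate takes its weight 1 / a from that of \<open>r\<close>.\<close>

theorem transport_inequality:
  assumes "transport_data I a R G D \<psi> W U"
    and "(LINT x|lborel_PiM I. G x powr (a / (a - 1))) = 1" and "integral\<^sup>L (lborel_PiM I) \<psi> = 1"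
    and "0 < r"
  shows "a * r powr ((a - card I) / a) * (LINT t|lborel_PiM I. \<psi> t powr (1 - 1 / a)) \<le>
    (a - card I) * r * integral\<^sup>L (lborel_PiM I) G + (LINT t|lborel_PiM I. \<psi> t * W t) + integral\<^sup>L (lborel_PiM I) U"
proof -
  have "finite I" using assms(1) by (rule transport_data.fin)
  then show ?thesis using assms
  proof (induction I arbitrary: G D \<psi> W U r rule: finite_induct)
    case empty
    interpret transport_data "{}" a R G D \<psi> W U by fact
    have I: "integral\<^sup>L (lborel_PiM {}) f = f (\<lambda>_. undefined)" for f :: "('i \<Rightarrow> real) \<Rightarrow> real"
      by (simp add: PiM_empty lebesgue_integral_count_space_finite)
    let ?o = "\<lambda>_::'i. undefined :: real"
    have \<psi>: "\<psi> ?o = 1" and F: "G ?o powr (a / (a - 1)) = 1" 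
      using empty.prems(2,3) unfolding I by simp_all
    have "G ?o = (G ?o powr (a / (a - 1))) powr ((a - 1) / a)"
      using G_nonneg a_gt_1 by (simp add: powr_powr)
    then have G: "G ?o = 1" by (simp add: F)
    have "0 \<le> W ?o + U ?o" using fenchel[of ?o ?o] \<psi> F by simp
    then show ?case using \<psi> G a_gt_1 \<open>0 < r\<close> by (simp add: I)
  next
    case (insert i I)
    interpret transport_data "insert i I" a R G D \<psi> W U by fact
    note I = insert.hyps
    define k where "k = real (card I)"
    have card: "real (card (insert i I)) = k + 1" using I by (simp add: k_def)
    have ka: "k + 1 < a" using card_less card by simp
    define m where "m y = (LINT x|lborel_PiM I. G (x(i := y)) powr (a / (a - 1)))" for y
    define \<mu> where "\<mu> t = (LINT x|lborel_PiM I. \<psi> (x(i := t)))" for t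
    define g where "g y = (LINT x|lborel_PiM I. G (x(i := y)))" for y
    define d where "d y = (LINT x|lborel_PiM I. D i (x(i := y)))" for y
    define u where "u y = (LINT x|lborel_PiM I. U (x(i := y)))" for y
    define e where "e t = (LINT x|lborel_PiM I. \<psi> (x(i := t)) powr (1 - 1 / a))" for t
    define v where "v t = (LINT x|lborel_PiM I. \<psi> (x(i := t)) * W (x(i := t)))" for t
    let ?P = "\<lambda>y. integrable (lborel_PiM I) (\<lambda>x. G (x(i := y))) \<and>
      (\<forall>j\<in>insert i I. integrable (lborel_PiM I) (\<lambda>x. D j (x(i := y)))) \<and>
      integrable (lborel_PiM I) (\<lambda>x. G (x(i := y)) powr (a / (a - 1))) \<and>
      integrable (lborel_PiM I) (\<lambda>x. U (x(i := y)))"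
    let ?Q = "\<lambda>t. integrable (lborel_PiM I) (\<lambda>x. \<psi> (x(i := t))) \<and>
      integrable (lborel_PiM I) (\<lambda>x. \<psi> (x(i := t)) powr (1 - 1 / a)) \<and>
      integrable (lborel_PiM I) (\<lambda>x. \<psi> (x(i := t)) * W (x(i := t)))"
    note aes = AE_integrable_section[OF I]
    have P: "AE y in lborel. ?P y"
      using I by (intro AE_conjI AE_finite_allI aes int_G int_D int_F int_U) auto
    have Q: "AE t in lborel. ?Q t"
      by (intro AE_conjI aes int_\<psi> int_\<psi>_powr int_\<psi>_W)
    have zero: "AE x in lborel_PiM I. G (x(i := y)) = 0" if "?P y" "m y = 0" for y
    proof -
      have "AE x in lborel_PiM I. G (x(i := y)) powr (a / (a - 1)) = 0"
        using that by (subst integral_nonneg_eq_0_iff_AE[symmetric]) (auto simp: m_def)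
      then show ?thesis by eventually_elim simp
    qed
    have "a * r powr ((a - (k + 1)) / a) * integral\<^sup>L lborel e \<le>
      (a - (k + 1)) * r * integral\<^sup>L lborel g + integral\<^sup>L lborel v + integral\<^sup>L lborel u"
    proof (rule one_dimensional_transport_inequality[where P="?P" and Q="?Q"])
      show "integrable lborel m" "integral\<^sup>L lborel m = 1"
        unfolding m_def using integrable_section[OF I int_F] integral_section[OF I int_F] insert.prems by auto
      show "integrable lborel \<mu>" "integral\<^sup>L lborel \<mu> = 1"
        unfolding \<mu>_def using integrable_section[OF I int_\<psi>] integral_section[OF I int_\<psi>] insert.prems by auto
      show "integrable lborel g" "integrable lborel u" "integrable lborel e" "integrable lborel v" "integrable lborel d"
        unfolding g_def u_def e_def v_def d_def
        by (intro integrable_section[OF I] int_G int_U int_\<psi>_powr int_\<psi>_W int_D insertI1)+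
      show "0 \<le> m x" "0 \<le> \<mu> x" "0 \<le> g x" for x
        unfolding m_def \<mu>_def g_def using \<psi>_nonneg G_nonneg by (auto intro!: Bochner_Integration.integral_nonneg)
      show "\<bar>t\<bar> \<le> R" if "\<mu> t \<noteq> 0" for t
      proof (rule ccontr)
        assume "\<not> \<bar>t\<bar> \<le> R"
        then have "\<psi> (x(i := t)) = 0" for x using support[of i "x(i := t)"] by auto
        with that show False by (simp add: \<mu>_def)
      qed
      show "AE x in lborel. m x = 0 \<longrightarrow> d x = 0"
        using P
      proof eventually_elim
        case (elim y)
        show ?case
        proof
          assume "m y = 0"
          from zero[OF elim this] have "AE x in lborel_PiM I. D i (x(i := y)) = 0"
            by eventually_elim (rule D_eq_0, auto)
          then have "d y = (LINT x|lborel_PiM I. 0)"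
            unfolding d_def using elim by (intro integral_cong_AE) auto
          then show "d y = 0" by simp
        qed
      qed
      show "g x = - (LBINT y. indicator {x<..} y * d y)" "integral\<^sup>L lborel d = 0" for x
        unfolding g_def d_def
        by (rule section_FTC[OF I int_G int_D[OF insertI1] deriv[OF insertI1] cont[OF insertI1]])+
      \<comment> \<open>\<open>fenchel\<close> speaks only of points of the target; at such a point
        and a zero of \<open>G\<close> it says that \<open>U\<close> is nonnegative.\<close>
      obtain t0 where t0: "\<psi> t0 \<noteq> 0"
      proof (rule ccontr)
        assume "\<not> thesis"
        then have "\<psi> = (\<lambda>_. 0)" using that by blast
        then show False using insert.prems(3) by simp
      qed
      show "AE x in lborel. m x = 0 \<longrightarrow> 0 \<le> u x"
        using P
      proof eventually_elim
        case (elim y)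
        show ?case
        proof
          assume "m y = 0"
          from zero[OF elim this] have "AE x in lborel_PiM I. 0 \<le> U (x(i := y))"
          proof eventually_elim
            case (elim x)
            then show ?case using fenchel[OF t0, of "x(i := y)"] D_eq_0[of _ "x(i := y)"] by simp
          qed
          then show "0 \<le> u y" unfolding u_def by (rule integral_nonneg_AE)
        qed
      qed
      show "AE t in lborel. \<mu> t = 0 \<longrightarrow> a * r powr ((a - (k + 1)) / a) * e t \<le> v t"
        using Q
      proof eventually_elim
        case (elim t)
        show ?case
        proof
          assume "\<mu> t = 0"
          then have *: "AE x in lborel_PiM I. \<psi> (x(i := t)) = 0"
            using elim \<psi>_nonneg by (subst integral_nonneg_eq_0_iff_AE[symmetric]) (auto simp: \<mu>_def)
          have "e t = 0" "v t = 0"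
            unfolding e_def v_def
            by (rule integral_eq_zero_AE, use * in eventually_elim, simp)+
          then show "a * r powr ((a - (k + 1)) / a) * e t \<le> v t" by simp
        qed
      qed
      show "0 \<le> (a - (k + 1)) * r" using ka \<open>0 < r\<close> by simp
      show "AE y in lborel. ?P y" "AE t in lborel. ?Q t" by fact+
      fix y t assume Py: "?P y" and Qt: "?Q t" and my: "0 < m y" and \<mu>t: "0 < \<mu> t"
      \<comment> \<open>\<open>s\<close> plays the derivative of the inverse map at
        \<open>y\<close>. The induction hypothesis is used with \<open>r'\<close>, the weighted
        geometric mean of \<open>r\<close> and \<open>s\<close>: its exponents make the powers of
        \<open>m y\<close> and \<open>\<mu> t\<close> cancel, and Young's inequality separates
        \<open>s\<close> from \<open>r\<close> again.\<close>
      define s where "s = m y / \<mu> t"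
      have s: "0 < s" using my \<mu>t by (simp add: s_def)
      define r' where "r' = r powr ((a - (k + 1)) / (a - k)) * s powr (1 / (a - k))"
      have r': "0 < r'" using \<open>0 < r\<close> s by (simp add: r'_def)
      have r'_powr: "r' powr ((a - k) / a) * (\<mu> t / m y) powr (1 / a) = r powr ((a - (k + 1)) / a)"
      proof -
        have "r' powr ((a - k) / a) = r powr ((a - (k + 1)) / a) * s powr (1 / a)"
          using ka by (simp add: r'_def powr_mult powr_powr)
        moreover have "s powr (1 / a) * (\<mu> t / m y) powr (1 / a) = 1"
          using my \<mu>t by (simp add: s_def powr_mult[symmetric])
        ultimately show ?thesis by simp
      qed
      have young: "(a - k) * r' \<le> (a - (k + 1)) * r + s"
      proof -
        have "r' \<le> (a - (k + 1)) / (a - k) * r + 1 / (a - k) * s"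
          unfolding r'_def using ka \<open>0 < r\<close> s
          by (intro Youngs_inequality_0) (auto simp: field_simps)
        then have "(a - k) * r' \<le> (a - k) * ((a - (k + 1)) / (a - k) * r + 1 / (a - k) * s)"
          using ka by (intro mult_left_mono) auto
        also have "\<dots> = (a - (k + 1)) * r + s"
          using ka by (simp add: distrib_left)
        finally show ?thesis .
      qed
      have td: "transport_data I a R (\<lambda>x. G (x(i := y))) (\<lambda>j x. D j (x(i := y)))
          (\<lambda>x. \<psi> (x(i := t))) (\<lambda>x. W (x(i := t))) (\<lambda>x. U (x(i := y)) + D i (x(i := y)) * t)"
        by (rule transport_data_section[OF insert.prems(1) I(2,1)]) (use Py Qt in blast)+
      have "a * r' powr ((a - k) / a) * (\<mu> t / m y) powr (1 / a) * e t \<le>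
        (a - k) * r' * (\<mu> t / m y) * g y + v t + (\<mu> t / m y) * (LINT x|lborel_PiM I. U (x(i := y)) + D i (x(i := y)) * t)"
        unfolding g_def v_def e_def k_def
        by (rule transport_inequality_unnormalized[OF insert.IH td _ my _ \<mu>t]) (use r' in \<open>auto simp: m_def \<mu>_def\<close>)
      also have "(LINT x|lborel_PiM I. U (x(i := y)) + D i (x(i := y)) * t) = u y + d y * t"
        unfolding u_def d_def using Py by simp
      also have "a * r' powr ((a - k) / a) * (\<mu> t / m y) powr (1 / a) * e t = a * r powr ((a - (k + 1)) / a) * e t"
        using r'_powr by (simp add: mult.assoc)
      also have "(a - k) * r' * (\<mu> t / m y) * g y \<le> ((a - (k + 1)) * r + s) * (\<mu> t / m y) * g y"
        using young my \<mu>t G_nonneg by (intro mult_right_mono) (auto simp: g_def intro!: Bochner_Integration.integral_nonneg)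
      also have "((a - (k + 1)) * r + s) * (\<mu> t / m y) = (a - (k + 1)) * r * (\<mu> t / m y) + 1"
        using my \<mu>t by (simp add: s_def field_simps)
      finally show "a * r powr ((a - (k + 1)) / a) * e t
         \<le> ((a - (k + 1)) * r * (\<mu> t / m y) + 1) * g y + v t + \<mu> t / m y * (u y + d y * t)"
        by simp
    qed
    then show ?case
      unfolding card e_def g_def v_def u_def
      using integral_section[OF I int_G] integral_section[OF I int_\<psi>_powr]
        integral_section[OF I int_\<psi>_W] integral_section[OF I int_U] by simp
  qed
qed

section \<open>Norms, dual norms and differentiability\<close>

locale norm_functional =
  fixes N :: "'a::euclidean_space \<Rightarrow> real"
  assumes is_norm: "is_norm N"
begin

lemma eq_0_iff [simp]: "N x = 0 \<longleftrightarrow> x = 0"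
  and scale: "N (c *\<^sub>R x) = \<bar>c\<bar> * N x"
  and triangle: "N (x + y) \<le> N x + N y"
  using is_norm by (auto simp: is_norm_def)

lemma zero [simp]: "N 0 = 0" by simp

lemma minus [simp]: "N (- x) = N x"
  using scale[of "-1" x] by simp

lemma minus_commute: "N (x - y) = N (y - x)"
  using minus[of "x - y"] by simp

lemma nonneg [simp]: "0 \<le> N x"
  using triangle[of x "- x"] by simp

lemma pos: "x \<noteq> 0 \<Longrightarrow> 0 < N x"
  using nonneg[of x] by (simp add: less_le del: nonneg)

lemma triangle_diff: "N x - N y \<le> N (x - y)"
  using triangle[of "x - y" y] by simp

lemma sum_le: "N (sum f S) \<le> (\<Sum>i\<in>S. N (f i))"
  by (induction S rule: infinite_finite_induct) (auto intro: order_trans[OF triangle])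

lemma upper_bound: "\<exists>C>0. \<forall>x. N x \<le> C * norm x"
proof (intro exI conjI allI)
  let ?C = "(\<Sum>b\<in>Basis. N b) + 1"
  show "0 < ?C" by (intro add_nonneg_pos sum_nonneg) auto
  fix x
  have "N x = N (\<Sum>b\<in>Basis. (x \<bullet> b) *\<^sub>R b)" by (simp add: euclidean_representation)
  also have "\<dots> \<le> (\<Sum>b\<in>Basis. \<bar>x \<bullet> b\<bar> * N b)"
    by (rule order_trans[OF sum_le]) (simp add: scale)
  also have "\<dots> \<le> (\<Sum>b\<in>Basis. norm x * N b)"
    by (intro sum_mono mult_right_mono Basis_le_norm) auto
  also have "\<dots> = (\<Sum>b\<in>Basis. N b) * norm x" unfolding sum_distrib_right by (simp add: mult.commute)
  also have "\<dots> \<le> ?C * norm x" by (intro mult_right_mono) auto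
  finally show "N x \<le> ?C * norm x" .
qed

lemma continuous [continuous_intros]: "continuous_on S N"
proof -
  obtain C where C: "0 < C" "\<And>x. N x \<le> C * norm x" using upper_bound by blast
  have "\<bar>N x - N y\<bar> \<le> C * norm (x - y)" for x y
    using triangle_diff[of x y] triangle_diff[of y x] C(2)[of "x - y"] minus_commute[of x y] by auto
  then have "C-lipschitz_on S N"
    using C(1) by (intro lipschitz_onI) (auto simp: dist_norm)
  then show ?thesis by (rule lipschitz_on_continuous_on)
qed

lemma borel [measurable]: "N \<in> borel_measurable borel"
  by (intro borel_measurable_continuous_onI continuous)

lemma lower_bound: "\<exists>c>0. \<forall>x. c * norm x \<le> N x"
proof -
  have "compact (sphere (0::'a) 1)" by simp
  moreover have "sphere (0::'a) 1 \<noteq> {}" by simp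
  ultimately obtain z where z: "z \<in> sphere 0 1" "\<And>y. y \<in> sphere 0 1 \<Longrightarrow> N z \<le> N y"
    using continuous_attains_inf[OF _ _ continuous] by metis
  show ?thesis
  proof (intro exI conjI allI)
    show "0 < N z" using z(1) by (intro pos) auto
    fix x
    show "N z * norm x \<le> N x"
    proof (cases "x = 0")
      case False
      then have "N z \<le> N ((1 / norm x) *\<^sub>R x)" by (intro z(2)) auto
      with False show ?thesis by (simp add: scale field_simps)
    qed simp
  qed
qed

lemma bdd_above_dual: "bdd_above ((\<lambda>x. x \<bullet> y) ` {x. N x \<le> 1})"
proof -
  obtain c where c: "0 < c" "\<And>x. c * norm x \<le> N x" using lower_bound by blast
  show ?thesis
  proof (rule bdd_aboveI2)
    fix x assume "x \<in> {x. N x \<le> 1}"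
    then have "norm x \<le> 1 / c" using c(2)[of x] c(1) by (simp add: field_simps)
    then have "norm x * norm y \<le> 1 / c * norm y" by (intro mult_right_mono) auto
    then show "x \<bullet> y \<le> 1 / c * norm y" using norm_cauchy_schwarz[of x y] by linarith
  qed
qed

lemma inner_le_dual: "x \<bullet> y \<le> N x * dual_norm N y"
proof (cases "x = 0")
  case False
  then have "((1 / N x) *\<^sub>R x) \<bullet> y \<le> dual_norm N y"
    unfolding dual_norm_def by (intro cSUP_upper bdd_above_dual) (use pos[OF False] in \<open>auto simp: scale\<close>)
  then show ?thesis using pos[OF False] by (simp add: field_simps)
qed simp

lemma abs_inner_le_dual: "\<bar>x \<bullet> y\<bar> \<le> N x * dual_norm N y"
  using inner_le_dual[of x y] inner_le_dual[of "- x" y] by (simp add: abs_le_iff)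

lemma dual_norm_le: "(\<And>x. N x \<le> 1 \<Longrightarrow> x \<bullet> y \<le> L) \<Longrightarrow> dual_norm N y \<le> L"
  unfolding dual_norm_def by (intro cSUP_least) (auto intro: exI[of _ 0])

lemma le_dual_norm: "N x \<le> 1 \<Longrightarrow> x \<bullet> y \<le> dual_norm N y"
  unfolding dual_norm_def by (intro cSUP_upper bdd_above_dual) auto

lemma dual_norm_nonneg [simp]: "0 \<le> dual_norm N y"
  using le_dual_norm[of 0 y] by simp

lemma dual_norm_zero [simp]: "dual_norm N 0 = 0"
  by (intro antisym dual_norm_le) auto

lemma dual_norm_triangle: "dual_norm N (x + y) \<le> dual_norm N x + dual_norm N y"
  by (rule dual_norm_le) (auto simp: inner_add_right intro: add_mono le_dual_norm)

lemma dual_norm_scale: "dual_norm N (c *\<^sub>R y) = \<bar>c\<bar> * dual_norm N y"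
proof -
  have le: "dual_norm N (c *\<^sub>R y) \<le> \<bar>c\<bar> * dual_norm N y" for c y
  proof (rule dual_norm_le)
    fix x assume "N x \<le> 1"
    then have "\<bar>x \<bullet> y\<bar> \<le> 1 * dual_norm N y"
      by (intro order_trans[OF abs_inner_le_dual] mult_right_mono) auto
    then have "\<bar>c\<bar> * \<bar>x \<bullet> y\<bar> \<le> \<bar>c\<bar> * dual_norm N y" by (intro mult_left_mono) auto
    moreover have "x \<bullet> (c *\<^sub>R y) \<le> \<bar>c\<bar> * \<bar>x \<bullet> y\<bar>" by (simp add: abs_mult[symmetric])
    ultimately show "x \<bullet> (c *\<^sub>R y) \<le> \<bar>c\<bar> * dual_norm N y" by linarith
  qed
  show ?thesis
  proof (cases "c = 0")
    case False
    have "dual_norm N y = dual_norm N ((1 / c) *\<^sub>R (c *\<^sub>R y))" using False by simp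
    also have "\<dots> \<le> \<bar>1 / c\<bar> * dual_norm N (c *\<^sub>R y)" by (rule le)
    finally show ?thesis using False by (intro antisym le) (simp add: field_simps)
  qed simp
qed

lemma dual_norm_le_norm: "\<exists>C>0. \<forall>y. dual_norm N y \<le> C * norm y"
proof -
  obtain c where c: "0 < c" "\<And>x. c * norm x \<le> N x" using lower_bound by blast
  show ?thesis
  proof (intro exI conjI allI)
    show "0 < 1 / c" using c by simp
    fix y show "dual_norm N y \<le> 1 / c * norm y"
    proof (rule dual_norm_le)
      fix x assume "N x \<le> 1"
      then have "norm x \<le> 1 / c" using c(2)[of x] c(1) by (simp add: field_simps)
      then have "norm x * norm y \<le> 1 / c * norm y" by (intro mult_right_mono) auto
      then show "x \<bullet> y \<le> 1 / c * norm y" using norm_cauchy_schwarz[of x y] by linarith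
    qed
  qed
qed

lemma continuous_dual_norm: "continuous_on S (dual_norm N)"
proof -
  obtain C where C: "0 < C" "\<And>y. dual_norm N y \<le> C * norm y" using dual_norm_le_norm by blast
  have "dual_norm N x - dual_norm N y \<le> C * norm (x - y)" for x y
    using dual_norm_triangle[of "x - y" y] C(2)[of "x - y"] by simp
  then have "\<bar>dual_norm N x - dual_norm N y\<bar> \<le> C * norm (x - y)" for x y
    by (metis abs_le_iff minus_diff_eq norm_minus_commute)
  then have "C-lipschitz_on S (dual_norm N)"
    using C(1) by (intro lipschitz_onI) (auto simp: dist_norm)
  then show ?thesis by (rule lipschitz_on_continuous_on)
qed

lemma borel_dual_norm [measurable]: "dual_norm N \<in> borel_measurable borel"
  by (intro borel_measurable_continuous_onI continuous_dual_norm)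

section \<open>Almost everywhere differentiability of a norm\<close>

lemma second_difference_nonneg: "2 * N x \<le> N (x + v) + N (x - v)"
  using triangle[of "x + v" "x - v"] scale[of 2 x] by (simp add: scaleR_2)

lemma slope_mono:
  assumes "0 < s" "s \<le> t"
  shows "(N (x + s *\<^sub>R e) - N x) / s \<le> (N (x + t *\<^sub>R e) - N x) / t"
proof -
  have "N (x + s *\<^sub>R e) = N ((1 - s / t) *\<^sub>R x + (s / t) *\<^sub>R (x + t *\<^sub>R e))"
    using assms by (simp add: algebra_simps)
  also have "\<dots> \<le> (1 - s / t) * N x + (s / t) * N (x + t *\<^sub>R e)"
    using assms by (intro order_trans[OF triangle]) (simp add: scale)
  finally show ?thesis using assms by (simp add: field_simps)
qed

lemma abs_slope_le: "0 < t \<Longrightarrow> \<bar>(N (x + t *\<^sub>R e) - N x) / t\<bar> \<le> N e"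
  using triangle_diff[of "x + t *\<^sub>R e" x] triangle_diff[of x "x + t *\<^sub>R e"] scale[of t e]
  by (auto simp: abs_le_iff field_simps)

text \<open>The jump at \<open>x\<close> between the one-sided derivatives of \<open>N\<close> along
  \<open>e\<close>. By convexity the quotients decrease with the step, so the infimum is their
  limit; a countable family of steps keeps it measurable.\<close>

definition kink :: "'a \<Rightarrow> 'a \<Rightarrow> real" where
  "kink e x = (INF n. (N (x + (1 / Suc n) *\<^sub>R e) + N (x - (1 / Suc n) *\<^sub>R e) - 2 * N x) * Suc n)"

text \<open>
  The second differences with step \<open>1 / M\<close> along a segment in direction \<open>e\<close> telescope to at most
  \<open>2 * N e / M\<close>, which forces the kink of \<open>N\<close> in direction \<open>e\<close> to vanish almost everywhere.
\<close>

lemma AE_kink_eq_0: "AE x in lborel. kink e x = 0"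
proof -
  define q where "q n x = (N (x + (1 / Suc n) *\<^sub>R e) + N (x - (1 / Suc n) *\<^sub>R e) - 2 * N x) * Suc n" for n x
  define k where "k x = (INF n. q n x)" for x
  have q0: "0 \<le> q n x" for n x
    using second_difference_nonneg[of x "(1 / Suc n) *\<^sub>R e"] by (simp add: q_def)
  have bdd: "bdd_below (range (\<lambda>n. q n x))" for x
    using q0 by (intro bdd_belowI2[where m=0]) auto
  have k0: "0 \<le> k x" for x unfolding k_def by (intro cINF_greatest q0) auto
  have kq: "k x \<le> q n x" for n x unfolding k_def by (intro cINF_lower bdd) auto
  have [measurable]: "q n \<in> borel_measurable borel" for n unfolding q_def by measurable
  have [measurable]: "k \<in> borel_measurable borel"
    unfolding k_def by (intro borel_measurable_cINF bdd) auto
  have shift: "(\<integral>\<^sup>+x. f (x + c) \<partial>lborel) = integral\<^sup>N lborel f" if [measurable]: "f \<in> borel_measurable borel" for f :: "'a \<Rightarrow> ennreal" and c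
  proof -
    have "integral\<^sup>N (distr lborel borel ((+) c)) f = (\<integral>\<^sup>+x. f (c + x) \<partial>lborel)"
      by (subst nn_integral_distr) auto
    then show ?thesis by (simp add: lborel_distr_plus add.commute)
  qed
  have tele: "(\<Sum>j<Suc n. q n (x + (j / Suc n) *\<^sub>R e)) \<le> 2 * N e" for n x
  proof -
    define t where "t = 1 / Suc n"
    have t: "0 < t" "t * Suc n = 1" by (auto simp: t_def)
    define y where "y j = x + (of_int j * t) *\<^sub>R e" for j :: int
    have "(\<Sum>j<m. q n (x + (j / Suc n) *\<^sub>R e)) = ((N (y (int m)) - N (y (int m - 1))) - (N (y 0) - N (y (-1)))) * Suc n" for m :: nat
    proof (induction m)
      case (Suc m)
      have 1: "x + (m / Suc n) *\<^sub>R e = y (int m)"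
        "y (int m) + (1 / Suc n) *\<^sub>R e = y (int (Suc m))"
        "y (int m) - (1 / Suc n) *\<^sub>R e = y (int m - 1)"
        by (simp_all add: y_def t_def scaleR_left_distrib[symmetric] scaleR_left_diff_distrib[symmetric]
          add_divide_distrib diff_divide_distrib)
      have "q n (x + (m / Suc n) *\<^sub>R e) = (N (y (int (Suc m))) + N (y (int m - 1)) - 2 * N (y (int m))) * Suc n"
        unfolding q_def 1 ..
      with Suc show ?case by (simp add: algebra_simps)
    qed (simp add: y_def)
    from this[of "Suc n"]
    have "(\<Sum>j<Suc n. q n (x + (j / Suc n) *\<^sub>R e)) = ((N (y (Suc n)) - N (y n)) - (N (y 0) - N (y (-1)))) * Suc n"
      by simp
    also have "\<dots> \<le> (2 * (t * N e)) * Suc n"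
    proof (intro mult_right_mono)
      have "N (y (Suc n)) - N (y n) \<le> t * N e"
        using triangle_diff[of "y (Suc n)" "y n"] t(1) by (simp add: y_def scaleR_left_diff_distrib[symmetric] scale algebra_simps)
      moreover have "N (y (-1)) - N (y 0) \<le> t * N e"
        using triangle_diff[of "y (-1)" "y 0"] t(1) by (simp add: y_def scale)
      ultimately show "N (y (Suc n)) - N (y n) - (N (y 0) - N (y (-1))) \<le> 2 * (t * N e)" by linarith
    qed auto
    also have "\<dots> = 2 * N e" using t(2) by (metis mult.assoc mult.commute mult_1)
    finally show ?thesis .
  qed
  have zero: "(\<integral>\<^sup>+x. ennreal (k x) * indicator (ball 0 r) x \<partial>lborel) = 0" for r
  proof -
    let ?B = "ball (0::'a) (r + norm e)"
    define V where "V = enn2real (emeasure lborel ?B)"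
    have V: "emeasure lborel ?B = ennreal V" "0 \<le> V" 
      unfolding V_def using emeasure_bounded_finite[of ?B] by (auto simp: less_top)
    let ?K = "\<integral>\<^sup>+x. ennreal (k x) * indicator (ball 0 r) x \<partial>lborel"
    \<comment> \<open>Translation invariance turns n + 1 copies of the integral into integrals of
      translated kinks, which the telescoping sum bounds. The shifts are at most
      \<open>norm e\<close> long, hence the larger ball.\<close>
    have le: "of_nat (Suc n) * ?K \<le> ennreal (2 * N e * V)" for n
    proof -
      have "(\<integral>\<^sup>+x. ennreal (k (x + c)) * indicator (ball 0 r) (x + c) \<partial>lborel) = ?K" for c
        by (rule shift) (auto intro!: borel_measurable_times_ennreal borel_measurable_indicator)
      note shift_K = this
      have "of_nat (Suc n) * ?K = (\<Sum>j<Suc n. ?K)" by simp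
      also have "\<dots> = (\<Sum>j<Suc n. \<integral>\<^sup>+x. ennreal (k (x + (j / Suc n) *\<^sub>R e)) * indicator (ball 0 r) (x + (j / Suc n) *\<^sub>R e) \<partial>lborel)"
        unfolding shift_K ..
      also have "\<dots> \<le> (\<Sum>j<Suc n. \<integral>\<^sup>+x. ennreal (q n (x + (j / Suc n) *\<^sub>R e)) * indicator ?B x \<partial>lborel)"
      proof (intro sum_mono nn_integral_mono mult_mono ennreal_leI kq)
        fix j x assume "j \<in> {..<Suc n}"
        then have "norm ((j / Suc n) *\<^sub>R e) \<le> norm e"
          using mult_right_mono[of "real j" "real (Suc n)" "norm e"] by (auto simp: divide_le_eq mult.commute)
        then show "indicator (ball 0 r) (x + (j / Suc n) *\<^sub>R e) \<le> (indicator ?B x :: ennreal)"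
          using norm_triangle_ineq4[of "x + (j / Suc n) *\<^sub>R e" "(j / Suc n) *\<^sub>R e"]
          by (auto simp: indicator_def)
      qed auto
      also have "\<dots> = (\<integral>\<^sup>+x. ennreal (\<Sum>j<Suc n. q n (x + (j / Suc n) *\<^sub>R e)) * indicator ?B x \<partial>lborel)"
      proof (subst nn_integral_sum[symmetric])
        show "(\<lambda>x. ennreal (q n (x + (j / Suc n) *\<^sub>R e)) * indicator ?B x) \<in> borel_measurable lborel" for j
          by (auto intro!: borel_measurable_times_ennreal borel_measurable_indicator)
        show "(\<integral>\<^sup>+x. (\<Sum>j<Suc n. ennreal (q n (x + (j / Suc n) *\<^sub>R e)) * indicator ?B x) \<partial>lborel) =
            (\<integral>\<^sup>+x. ennreal (\<Sum>j<Suc n. q n (x + (j / Suc n) *\<^sub>R e)) * indicator ?B x \<partial>lborel)"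
          by (simp only: sum_distrib_right[symmetric] sum_ennreal q0)
      qed
      also have "\<dots> \<le> (\<integral>\<^sup>+x. ennreal (2 * N e) * indicator ?B x \<partial>lborel)"
        by (intro nn_integral_mono mult_right_mono ennreal_leI tele) auto
      also have "\<dots> = ennreal (2 * N e * V)"
        using V by (subst nn_integral_cmult_indicator) (auto simp: ennreal_mult)
      finally show ?thesis .
    qed
    have fin: "?K < top" using le[of 0] by (auto simp: le_less_trans)
    define K where "K = enn2real ?K"
    have K: "?K = ennreal K" "0 \<le> K" unfolding K_def using fin by auto
    have "real (Suc n) * K \<le> 2 * N e * V" for n
      using le[of n] V(2) K(2) unfolding K(1)
      by (simp add: ennreal_of_nat_eq_real_of_nat ennreal_mult[symmetric] del: of_nat_Suc)
    note bound = this
    have "K \<le> 0"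
    proof (rule ccontr)
      assume "\<not> K \<le> 0"
      then obtain n where "2 * N e * V < real n * K" using reals_Archimedean3[of K] by auto
      also have "\<dots> \<le> real (Suc n) * K" using K(2) by (intro mult_right_mono) auto
      finally show False using bound[of n] by linarith
    qed
    then show ?thesis using K by simp
  qed
  have "AE x in lborel. \<forall>n::nat. ennreal (k x) * indicator (ball 0 (real n)) x = 0"
    unfolding AE_all_countable
    using zero by (subst nn_integral_0_iff_AE[symmetric]) (auto intro!: borel_measurable_times_ennreal borel_measurable_indicator)
  then show ?thesis
  proof eventually_elim
    case (elim x)
    obtain n where "norm x < real n" using reals_Archimedean2 by blast
    then have "k x = 0" using elim[rule_format, of n] k0[of x] by (auto simp: indicator_def split: if_splits)
    then show ?case by (simp add: k_def q_def kink_def)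
  qed
qed

text \<open>Convexity passes from the axes to all directions: the bound from above comes from
  averaging over the axes, and the bound from below from the upper bound at the reflected
  point.\<close>

lemma differentiable_of_kinks:
  assumes "\<And>e. e \<in> Basis \<Longrightarrow> kink e x = 0"
  shows "\<exists>D. GDERIV N x :> D"
proof -
  have ex: "\<exists>c. \<forall>\<epsilon>>0. \<exists>\<delta>>0. \<forall>s. \<bar>s\<bar> \<le> \<delta> \<longrightarrow> N (x + s *\<^sub>R e) - N x - c * s \<le> \<epsilon> * \<bar>s\<bar>" if e: "e \<in> Basis" for e
  proof -
    let ?sl = "\<lambda>t. (N (x + t *\<^sub>R e) - N x) / t"
    \<comment> \<open>The right derivative, which for a convex function is the infimum of the
      slopes; the vanishing kink makes it the left derivative as well.\<close>
    define c where "c = (INF t\<in>{0<..}. ?sl t)"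
    have bdd: "bdd_below (?sl ` {0<..})"
    proof (rule bdd_belowI2[where m="- N e"])
      fix t :: real assume "t \<in> {0<..}"
      then show "- N e \<le> ?sl t" using abs_slope_le[of t x e] unfolding abs_le_iff by simp
    qed
    have c_le: "c \<le> ?sl t" if "0 < t" for t unfolding c_def using that by (intro cINF_lower bdd) auto
    show ?thesis
    proof (rule exI[of _ c], intro allI impI)
      fix \<epsilon> :: real assume \<epsilon>: "0 < \<epsilon>"
      obtain t1 where t1: "0 < t1" "?sl t1 < c + \<epsilon> / 2"
        using cINF_less_iff[OF _ bdd, of "c + \<epsilon> / 2"] \<epsilon> unfolding c_def by auto
      obtain n where n: "(N (x + (1 / Suc n) *\<^sub>R e) + N (x - (1 / Suc n) *\<^sub>R e) - 2 * N x) * Suc n < \<epsilon> / 2"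
        using cInf_lessD[of "range (\<lambda>n. (N (x + (1 / Suc n) *\<^sub>R e) + N (x - (1 / Suc n) *\<^sub>R e) - 2 * N x) * Suc n)" "\<epsilon> / 2"]
          assms[OF e] \<epsilon> unfolding kink_def by auto
      define t2 where "t2 = 1 / real (Suc n)"
      have t2: "0 < t2" "?sl t2 + (N (x + t2 *\<^sub>R (- e)) - N x) / t2 < \<epsilon> / 2"
        using n by (auto simp: t2_def divide_simps algebra_simps)
      show "\<exists>\<delta>>0. \<forall>s. \<bar>s\<bar> \<le> \<delta> \<longrightarrow> N (x + s *\<^sub>R e) - N x - c * s \<le> \<epsilon> * \<bar>s\<bar>"
      proof (intro exI[of _ "min t1 t2"] conjI allI impI)
        show "0 < min t1 t2" using t1 t2 by simp
        fix s assume s: "\<bar>s\<bar> \<le> min t1 t2"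
        consider "s = 0" | "0 < s" | "s < 0" by linarith
        then show "N (x + s *\<^sub>R e) - N x - c * s \<le> \<epsilon> * \<bar>s\<bar>"
        proof cases
          case 2
          then have "?sl s \<le> ?sl t1" using s by (intro slope_mono) auto
          with t1 \<epsilon> have "?sl s \<le> c + \<epsilon>" by linarith
          then show ?thesis using 2 by (simp add: field_simps)
        next
          case 3
          define t where "t = - s"
          have t: "0 < t" "t \<le> t2" using 3 s by (auto simp: t_def)
          have "(N (x + t *\<^sub>R (- e)) - N x) / t \<le> (N (x + t2 *\<^sub>R (- e)) - N x) / t2"
            using t by (intro slope_mono) auto
          also have "\<dots> \<le> \<epsilon> / 2 - c" using t2 c_le[OF t2(1)] by linarith
          also have "\<dots> \<le> \<epsilon> - c" using \<epsilon> by simp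
          finally show ?thesis using t(1) 3 by (simp add: field_simps t_def)
        qed simp
      qed
    qed
  qed
  then obtain c where c: "\<And>e \<epsilon>. e \<in> Basis \<Longrightarrow> 0 < \<epsilon> \<Longrightarrow> \<exists>\<delta>>0. \<forall>s. \<bar>s\<bar> \<le> \<delta> \<longrightarrow> N (x + s *\<^sub>R e) - N x - c e * s \<le> \<epsilon> * \<bar>s\<bar>"
    by metis
  define D where "D = (\<Sum>e\<in>Basis. c e *\<^sub>R e)"
  define n where "n = real DIM('a)"
  have n: "0 < n" by (simp add: n_def)
  have upper: "\<exists>\<delta>>0. \<forall>v. norm v \<le> \<delta> \<longrightarrow> N (x + v) - N x - v \<bullet> D \<le> \<epsilon> * norm v" if \<epsilon>: "0 < \<epsilon>" for \<epsilon>
  proof -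
    have "\<forall>e\<in>Basis. \<exists>\<delta>>0. \<forall>s. \<bar>s\<bar> \<le> \<delta> \<longrightarrow> N (x + s *\<^sub>R e) - N x - c e * s \<le> (\<epsilon> / n) * \<bar>s\<bar>"
    proof
      fix e :: 'a assume "e \<in> Basis"
      then show "\<exists>\<delta>>0. \<forall>s. \<bar>s\<bar> \<le> \<delta> \<longrightarrow> N (x + s *\<^sub>R e) - N x - c e * s \<le> (\<epsilon> / n) * \<bar>s\<bar>"
        by (rule c) (use \<epsilon> n in simp)
    qed
    then obtain d where d: "\<And>e. e \<in> Basis \<Longrightarrow> 0 < d e"
      "\<And>e s. e \<in> Basis \<Longrightarrow> \<bar>s\<bar> \<le> d e \<Longrightarrow> N (x + s *\<^sub>R e) - N x - c e * s \<le> (\<epsilon> / n) * \<bar>s\<bar>"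
      by metis
    define \<delta> where "\<delta> = Min (d ` Basis) / n"
    have \<delta>: "0 < \<delta>" using d(1) n by (simp add: \<delta>_def)
    show ?thesis
    proof (intro exI[of _ \<delta>] conjI allI impI \<delta>)
      fix v :: 'a assume v: "norm v \<le> \<delta>"
      \<comment> \<open>A point near \<open>x\<close> is the mean of \<open>n\<close> points on the
        axes through \<open>x\<close>, at the price of displacements \<open>n\<close> times as
        long.\<close>
      have rep: "x + v = (1 / n) *\<^sub>R (\<Sum>e\<in>Basis. x + (n * (v \<bullet> e)) *\<^sub>R e)"
      proof -
        have "(\<Sum>e\<in>Basis. x + (n * (v \<bullet> e)) *\<^sub>R e) = n *\<^sub>R x + n *\<^sub>R (\<Sum>e\<in>Basis. (v \<bullet> e) *\<^sub>R e)"
          by (simp add: sum.distrib n_def scaleR_sum_right sum_constant_scaleR)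
        then show ?thesis using n by (simp add: euclidean_representation scaleR_add_right)
      qed
      have "N (x + v) \<le> (1 / n) * (\<Sum>e\<in>Basis. N (x + (n * (v \<bullet> e)) *\<^sub>R e))"
        unfolding rep scale using n by (auto intro!: divide_right_mono sum_le)
      also have "\<dots> \<le> (1 / n) * (\<Sum>e\<in>Basis. N x + c e * (n * (v \<bullet> e)) + \<epsilon> * norm v)"
      proof (intro mult_left_mono sum_mono)
        fix e :: 'a assume e: "e \<in> Basis"
        have ve: "\<bar>v \<bullet> e\<bar> \<le> norm v" using e by (rule Basis_le_norm)
        have "n * norm v \<le> Min (d ` Basis)" using v n by (simp add: \<delta>_def field_simps)
        also have "\<dots> \<le> d e" using e by simp
        finally have le: "n * norm v \<le> d e" .
        have "\<bar>n * (v \<bullet> e)\<bar> = n * \<bar>v \<bullet> e\<bar>" using n by (simp add: abs_mult)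
        also have "\<dots> \<le> n * norm v" using ve n by simp
        finally have "\<bar>n * (v \<bullet> e)\<bar> \<le> d e" using le by linarith
        from d(2)[OF e this] have "N (x + (n * (v \<bullet> e)) *\<^sub>R e) - N x - c e * (n * (v \<bullet> e)) \<le> \<epsilon> * \<bar>v \<bullet> e\<bar>"
          using n by (simp add: abs_mult)
        also have "\<dots> \<le> \<epsilon> * norm v" using ve \<epsilon> by (intro mult_left_mono) auto
        finally show "N (x + (n * (v \<bullet> e)) *\<^sub>R e) \<le> N x + c e * (n * (v \<bullet> e)) + \<epsilon> * norm v" by simp
      qed (use n in auto)
      also have "(\<Sum>e\<in>Basis. N x + c e * (n * (v \<bullet> e)) + \<epsilon> * norm v) = n * (N x + v \<bullet> D + \<epsilon> * norm v)"
      proof -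
        have "v \<bullet> D = (\<Sum>e\<in>Basis. c e * (v \<bullet> e))" by (simp add: D_def inner_sum_right)
        then show ?thesis by (simp add: sum.distrib n_def sum_distrib_left algebra_simps)
      qed
      finally show "N (x + v) - N x - v \<bullet> D \<le> \<epsilon> * norm v" using n by simp
    qed
  qed
  have "(N has_derivative (\<lambda>v. v \<bullet> D)) (at x)"
    unfolding has_derivative_within_alt
  proof (intro conjI allI impI)
    show "bounded_linear (\<lambda>v. v \<bullet> D)" by (rule bounded_linear_inner_left)
    fix \<epsilon> :: real assume "0 < \<epsilon>"
    from upper[OF this] obtain \<delta> where \<delta>: "0 < \<delta>"
      "\<And>v. norm v \<le> \<delta> \<Longrightarrow> N (x + v) - N x - v \<bullet> D \<le> \<epsilon> * norm v" by blast
    show "\<exists>d>0. \<forall>y\<in>UNIV. norm (y - x) < d \<longrightarrow> norm (N y - N x - (y - x) \<bullet> D) \<le> \<epsilon> * norm (y - x)"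
    proof (intro exI[of _ \<delta>] conjI ballI impI \<delta>(1))
      fix y assume y: "norm (y - x) < \<delta>"
      define v where "v = y - x"
      have "N (x + v) - N x - v \<bullet> D \<le> \<epsilon> * norm v" "N (x - v) - N x + v \<bullet> D \<le> \<epsilon> * norm v"
        using \<delta>(2)[of v] \<delta>(2)[of "- v"] y by (auto simp flip: v_def)
      with second_difference_nonneg[of x v] have "\<bar>N (x + v) - N x - v \<bullet> D\<bar> \<le> \<epsilon> * norm v" by linarith
      then show "norm (N y - N x - (y - x) \<bullet> D) \<le> \<epsilon> * norm (y - x)" by (simp add: v_def)
    qed
  qed
  then show ?thesis unfolding gderiv_def by blast
qed

theorem AE_differentiable: "AE x in lborel. \<exists>D. GDERIV N x :> D"
proof -
  have "AE x in lborel. \<forall>e\<in>Basis. kink e x = 0"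
    by (intro AE_finite_allI AE_kink_eq_0) simp
  then show ?thesis by eventually_elim (rule differentiable_of_kinks, blast)
qed

text \<open>Slopes of \<open>N\<close> in direction \<open>v\<close> are at most \<open>N v\<close>,
  which bounds the dual norm. Homogeneity along \<open>x\<close> gives Euler's identity, and the two
  together force equality off the origin.\<close>

lemma GDERIV_dual_norm:
  assumes D: "GDERIV N x :> D"
  shows "dual_norm N D \<le> 1" "x \<bullet> D = N x" "x \<noteq> 0 \<Longrightarrow> dual_norm N D = 1"
proof -
  have der: "((\<lambda>t. N (x + t *\<^sub>R v)) has_real_derivative v \<bullet> D) (at 0)" for v
  proof -
    have "(N has_derivative (\<lambda>h. h \<bullet> D)) (at (x + 0 *\<^sub>R v))" using D by (simp add: gderiv_def)
    moreover have "((\<lambda>t. x + t *\<^sub>R v) has_derivative (\<lambda>t. t *\<^sub>R v)) (at 0)"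
      by (auto intro!: derivative_eq_intros)
    ultimately have "((\<lambda>t. N (x + t *\<^sub>R v)) has_derivative (\<lambda>t. (t *\<^sub>R v) \<bullet> D)) (at 0)"
      by (rule has_derivative_compose[rotated])
    moreover have "(\<lambda>t. (t *\<^sub>R v) \<bullet> D) = (*) (v \<bullet> D)" by (auto simp: fun_eq_iff)
    ultimately show ?thesis by (simp add: has_field_derivative_def)
  qed
  show le: "dual_norm N D \<le> 1"
  proof (rule dual_norm_le)
    fix v assume v: "N v \<le> 1"
    have lim: "((\<lambda>t. (N (x + t *\<^sub>R v) - N x) / t) \<longlongrightarrow> v \<bullet> D) (at_right 0)"
      using der[of v] by (auto simp: has_field_derivative_iff intro: tendsto_within_subset)
    have "\<forall>\<^sub>F t in at_right 0. (N (x + t *\<^sub>R v) - N x) / t \<le> 1"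
      using eventually_at_right_less[of 0]
    proof eventually_elim
      case (elim t)
      then show ?case using abs_slope_le[of t x v] v unfolding abs_le_iff by linarith
    qed
    from tendsto_upperbound[OF lim this] show "v \<bullet> D \<le> 1" by simp
  qed
  have "((\<lambda>t. (1 + t) * N x) has_real_derivative N x) (at 0)"
    by (auto intro!: derivative_eq_intros)
  moreover have "((\<lambda>t. N (x + t *\<^sub>R x)) has_real_derivative N x) (at 0) \<longleftrightarrow> ((\<lambda>t. (1 + t) * N x) has_real_derivative N x) (at 0)"
  proof (rule DERIV_cong_ev)
    have "\<forall>\<^sub>F t in nhds 0. -1 < (t::real)" by (rule eventually_nhds_in_open[of "{-1<..}", simplified]) auto
    then show "\<forall>\<^sub>F t in nhds 0. N (x + t *\<^sub>R x) = (1 + t) * N x"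
    proof eventually_elim
      case (elim t)
      have "x + t *\<^sub>R x = (1 + t) *\<^sub>R x" by (simp add: algebra_simps)
      then show ?case using elim by (simp add: scale)
    qed
  qed simp_all
  ultimately show eq: "x \<bullet> D = N x" using DERIV_unique[OF der[of x]] by simp
  assume "x \<noteq> 0"
  then show "dual_norm N D = 1"
    using le inner_le_dual[of x D] eq pos[of x] by (intro antisym) auto
qed

end

section \<open>Integrals of the extremal function\<close>

text \<open>Lebesgue measure is complete. This serves integrands built from \<open>grad\<close>,
  which is specified only where the function is differentiable.\<close>

lemma AE_borel_imp_lebesgue_measurable:
  assumes g: "g \<in> borel_measurable lborel" and eq: "AE x in lborel. f x = g x"
  shows "f \<in> borel_measurable lebesgue"
proof (rule measurableI)
  fix A :: "'b set" assume A: "A \<in> sets borel"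
  have 1: "g -` A \<inter> space lebesgue \<in> sets lebesgue"
    using measurable_sets[OF measurable_completion[OF g] A] by simp
  have 2: "AE x in lebesgue. x \<in> g -` A \<inter> space lebesgue \<longleftrightarrow> x \<in> f -` A \<inter> space lebesgue"
    using AE_completion[OF eq] by eventually_elim auto
  show "f -` A \<inter> space lebesgue \<in> sets lebesgue"
    by (rule completion.in_sets_AE[OF 2 1]) auto
qed simp

lemma
  fixes f g :: "'a::euclidean_space \<Rightarrow> real"
  assumes g: "integrable lborel g" and eq: "AE x in lborel. f x = g x"
  shows integrable_lebesgue_AE_eq: "integrable lebesgue f"
    and integral_lebesgue_AE_eq: "integral\<^sup>L lebesgue f = integral\<^sup>L lborel g"
proof -
  have g': "g \<in> borel_measurable lborel" using g by auto
  have f: "f \<in> borel_measurable lebesgue" by (rule AE_borel_imp_lebesgue_measurable[OF g' eq])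
  have gl: "integrable lebesgue g" using g g' by (simp add: integrable_completion)
  show "integrable lebesgue f"
    using integrable_cong_AE_imp[OF gl f] AE_completion[OF eq] by (auto simp: eq_commute)
  have "integral\<^sup>L lebesgue f = integral\<^sup>L lebesgue g"
    using f borel_measurable_integrable[OF gl] AE_completion[OF eq] by (rule integral_cong_AE)
  then show "integral\<^sup>L lebesgue f = integral\<^sup>L lborel g" using g' by (simp add: integral_completion)
qed

lemma integral_lborel_scaleR:
  fixes f :: "'a::euclidean_space \<Rightarrow> real"
  assumes f: "f \<in> borel_measurable borel" and c: "0 < c"
  shows "(LBINT x. f (c *\<^sub>R x)) = integral\<^sup>L lborel f / c ^ DIM('a)"
proof -
  have "integral\<^sup>L lborel f = integral\<^sup>L (density (distr lborel borel (\<lambda>x. 0 + c *\<^sub>R x)) (\<lambda>_. \<bar>c\<bar> ^ DIM('a))) f"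
    using lborel_affine[of c "0::'a"] c by (metis less_irrefl)
  also have "\<dots> = (\<integral>x. c ^ DIM('a) * f x \<partial>distr lborel borel (\<lambda>x. 0 + c *\<^sub>R x))"
    using f c by (subst integral_density) (auto simp: ennreal_power)
  also have "\<dots> = c ^ DIM('a) * (LBINT x. f (c *\<^sub>R x))"
    using f by (subst integral_distr) auto
  finally show ?thesis using c by (simp add: field_simps)
qed

lemma powr_minus_ge_tangent:
  fixes t b :: real
  assumes "0 < t" "0 \<le> b"
  shows "1 - b * (t - 1) \<le> t powr (- b)"
proof -
  have "1 - b * (t - 1) \<le> 1 + (- b * ln t)"
    using ln_le_minus_one[OF assms(1)] mult_left_mono[OF _ assms(2), of "ln t" "t - 1"] by simp
  also have "\<dots> \<le> exp (- b * ln t)" by (rule exp_ge_add_one_self)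
  also have "\<dots> = t powr (- b)" using assms by (simp add: powr_def)
  finally show ?thesis .
qed

context norm_functional
begin

text \<open>Dyadic decomposition, with n the dimension: the set where \<open>N x\<close> is about 2
  ^ j has volume of order 2 ^ (n j), and the weight on it is of order 2 ^ (- q s j). The assumption
  \<open>qs\<close> is the convergence of the resulting geometric series.\<close>

lemma weight_integrable:
  assumes q: "0 < q" and s: "0 < s" and qs: "real DIM('a) < q * s"
  shows "integrable lborel (\<lambda>x. (1 + N x powr q) powr (- s))"
proof (rule integrableI_nonneg)
  show "(\<lambda>x. (1 + N x powr q) powr (- s)) \<in> borel_measurable lborel" by measurable
  obtain c where c: "0 < c" "\<And>x. c * norm x \<le> N x" using lower_bound by blast
  define n where "n = DIM('a)"
  define V where "V = unit_ball_vol n"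
  \<comment> \<open>For j > 0 the shell with index j only guarantees \<open>N x\<close> > 2 ^ (j -
    1); the shift by one costs the factor \<open>K\<close>.\<close>
  define K where "K = 2 powr (q * s)"
  define \<rho> where "\<rho> = 2 powr (n - q * s)"
  have V: "0 \<le> V" unfolding V_def by simp
  have \<rho>: "0 < \<rho>" "\<rho> < 1" using qs by (auto simp: \<rho>_def n_def powr_less_one)
  let ?B = "\<lambda>j. cball (0::'a) (2 ^ j / c)"
  let ?c = "\<lambda>j::nat. K * (2 powr (- (q * s))) ^ j"
  have pw: "ennreal ((1 + N x powr q) powr (- s)) \<le> (\<Sum>j. ennreal (?c j) * indicator (?B j) x)" for x
  proof -
    obtain m where "N x < 2 ^ m" using real_arch_pow[of 2 "N x"] by auto
    then have ex: "\<exists>j::nat. N x \<le> 2 ^ j" by (auto intro: less_imp_le)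
    define j where "j = (LEAST j::nat. N x \<le> 2 ^ j)"
    have j: "N x \<le> 2 ^ j" unfolding j_def by (rule LeastI_ex[OF ex])
    have "c * norm x \<le> 2 ^ j" using c(2)[of x] j by linarith
    then have xB: "x \<in> ?B j" using c(1) by (simp add: field_simps)
    have "(1 + N x powr q) powr (- s) \<le> ?c j"
    proof (cases j)
      case 0
      have "(1 + N x powr q) powr (- s) \<le> 1 powr (- s)" using s by (intro powr_mono2') auto
      also have "\<dots> \<le> ?c j" using 0 q s by (simp add: K_def ge_one_powr_ge_zero)
      finally show ?thesis .
    next
      case (Suc i)
      then have "\<not> N x \<le> 2 ^ i" unfolding j_def by (metis not_less_Least lessI)
      then have i: "2 ^ i < N x" by simp
      have "(2 ^ i) powr q \<le> N x powr q" using i q by (intro powr_mono2) auto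
      then have "(1 + N x powr q) powr (- s) \<le> ((2 ^ i) powr q) powr (- s)" using s by (intro powr_mono2') auto
      also have "\<dots> = ?c j"
        using Suc by (simp add: K_def powr_powr powr_realpow[symmetric] powr_add[symmetric] algebra_simps)
      finally show ?thesis .
    qed
    then have "ennreal ((1 + N x powr q) powr (- s)) \<le> ennreal (?c j) * indicator (?B j) x"
      using xB by (simp add: ennreal_leI)
    also have "\<dots> = (\<Sum>i\<in>{j}. ennreal (?c i) * indicator (?B i) x)"
      by (subst sum.insert) (simp_all only: finite.emptyI empty_iff not_False_eq_True sum.empty add_0_right)
    also have "\<dots> \<le> (\<Sum>j. ennreal (?c j) * indicator (?B j) x)" by (intro sum_le_suminf) auto
    finally show ?thesis .
  qed
  have shell: "ennreal (?c j) * emeasure lborel (?B j) = ennreal (K * V / c ^ n * \<rho> ^ j)" for j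
  proof -
    have "?c j * (V * (2 ^ j / c) ^ n) = K * V / c ^ n * \<rho> ^ j"
    proof -
      have "(2::real) ^ (j * n) = 2 powr (real n * real j)" by (simp add: powr_realpow[symmetric] mult.commute)
      then have "(2 powr (- (q * s))) ^ j * 2 ^ (j * n) = \<rho> ^ j"
        by (simp add: \<rho>_def powr_realpow[symmetric] powr_powr powr_add[symmetric] algebra_simps)
      then show ?thesis by (simp add: power_divide power_mult[symmetric] field_simps)
    qed
    then show ?thesis
      using c V by (simp add: emeasure_cball V_def n_def ennreal_mult'[symmetric] K_def)
  qed
  have "(\<integral>\<^sup>+x. ennreal ((1 + N x powr q) powr (- s)) \<partial>lborel) \<le> (\<integral>\<^sup>+x. (\<Sum>j. ennreal (?c j) * indicator (?B j) x) \<partial>lborel)"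
    by (intro nn_integral_mono pw)
  also have "\<dots> = (\<Sum>j. \<integral>\<^sup>+x. ennreal (?c j) * indicator (?B j) x \<partial>lborel)"
    by (intro nn_integral_suminf borel_measurable_times_ennreal borel_measurable_const borel_measurable_indicator) simp
  also have "\<dots> = (\<Sum>j. ennreal (K * V / c ^ n * \<rho> ^ j))"
    by (subst nn_integral_cmult_indicator) (auto simp: shell)
  also have "\<dots> < \<infinity>"
  proof -
    have "summable (\<lambda>j. K * V / c ^ n * \<rho> ^ j)"
      using \<rho> by (intro summable_mult summable_geometric) auto
    then show ?thesis using V \<rho> c by (subst suminf_ennreal2) (auto simp: K_def)
  qed
  finally show "(\<integral>\<^sup>+x. ennreal ((1 + N x powr q) powr (- s)) \<partial>lborel) < \<infinity>" .
qed auto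

end

lemma integral_pos:
  fixes f :: "'a::euclidean_space \<Rightarrow> real"
  assumes f: "integrable lborel f" and pos: "AE x in lborel. 0 < f x"
  shows "0 < integral\<^sup>L lborel f"
proof -
  have "AE x in lborel. 0 \<le> f x" using pos by eventually_elim simp
  then have "0 \<le> integral\<^sup>L lborel f" by (rule integral_nonneg_AE)
  moreover have "integral\<^sup>L lborel f \<noteq> 0"
  proof
    assume "integral\<^sup>L lborel f = 0"
    then have "AE x in lborel. f x = 0"
      using integral_nonneg_eq_0_iff_AE[OF f] \<open>AE x in lborel. 0 \<le> f x\<close> by simp
    with pos have "AE x in (lborel :: 'a measure). False" by eventually_elim simp
    then have "emeasure (lborel :: 'a measure) UNIV = 0"
      by (simp add: eventually_False ae_filter_eq_bot_iff)
    then show False by simp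
  qed
  ultimately show ?thesis by simp
qed

text \<open>Covers both ranges of \<open>p\<close> at once. \<open>dim_less\<close> is the
  integrability at infinity of the slowest decaying integrand,
  \<open>(1 + N x powr q) powr (1 - a)\<close>.\<close>

locale GNS_setting = norm_functional N for N :: "'a::euclidean_space \<Rightarrow> real" +
  fixes a p q :: real
  assumes a: "real DIM('a) < a" and p: "1 < p" "p \<noteq> a" and pq: "1 / p + 1 / q = 1"
    and dim_less: "real DIM('a) < q * (a - 1)"
begin

definition "nn = real DIM('a)"

lemma nn_ge_1: "1 \<le> nn" by (simp add: nn_def Suc_leI)

lemma a1: "1 < a" using a nn_ge_1 unfolding nn_def by linarith

lemma q1: "1 < q" and q_conj: "(q - 1) * p = q" and q_eq: "q = p / (p - 1)"
proof -
  have q0: "q \<noteq> 0" using pq p by auto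
  show *: "(q - 1) * p = q" using pq p q0 by (simp add: field_simps)
  show e: "q = p / (p - 1)" using * p by (simp add: field_simps)
  show "1 < q" unfolding e using p by (simp add: field_simps)
qed

section \<open>Moments of the extremal function\<close>

definition w :: "'a \<Rightarrow> real" where "w x = 1 + N x powr q"
text \<open>\<open>Z\<close> and \<open>I\<close> are the integrals of the two powers of the
  extremal function that occur in the inequalities; \<open>J\<close> is its gradient integral up to
  the factor \<kappa>.\<close>

definition Z where "Z = (LBINT x. w x powr (- a))"
definition I where "I = (LBINT x. w x powr (1 - a))"
definition J where "J = (LBINT x. N x powr q * w x powr (- a))"

lemma w_ge_1: "1 \<le> w x" by (simp add: w_def)

lemma w_pos [simp]: "0 < w x" using w_ge_1[of x] by linarith

lemma abs_w [simp]: "\<bar>w x\<bar> = w x" by (rule abs_of_pos[OF w_pos])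

lemma borel_w [measurable]: "w \<in> borel_measurable borel" unfolding w_def by measurable

lemma w_split: "w x powr (1 - a) = w x powr (- a) + N x powr q * w x powr (- a)"
proof -
  have "w x powr (1 - a) = w x * w x powr (- a)"
    using w_pos[of x] powr_add[of "w x" 1 "- a"] by simp
  then show ?thesis by (simp add: w_def algebra_simps)
qed

lemma int_w1: "integrable lborel (\<lambda>x. w x powr (1 - a))"
  using weight_integrable[of q "a - 1"] q1 a1 dim_less by (simp add: w_def)

lemma int_wN: "integrable lborel (\<lambda>x. N x powr q * w x powr (- a))"
  by (rule Bochner_Integration.integrable_bound[OF int_w1]) (auto simp: w_split)

lemma int_w0: "integrable lborel (\<lambda>x. w x powr (- a))"
  by (rule Bochner_Integration.integrable_bound[OF int_w1]) (auto simp: w_split)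

lemma AE_nonzero: "AE x in lborel. (x :: 'a) \<noteq> 0" by (rule AE_lborel_singleton)

lemma I_eq: "I = Z + J"
  unfolding I_def Z_def J_def w_split by (rule Bochner_Integration.integral_add[OF int_w0 int_wN])

lemma Z_pos: "0 < Z"
  unfolding Z_def by (rule integral_pos[OF int_w0]) (simp add: less_imp_neq[OF w_pos, symmetric])

lemma J_pos: "0 < J"
  unfolding J_def using AE_nonzero
  by (intro integral_pos[OF int_wN]) (auto elim!: eventually_mono simp: pos less_imp_neq[OF w_pos, symmetric])

lemma I_pos: "0 < I" using I_eq Z_pos J_pos by simp

text \<open>
  Dilations turn \<open>I\<close> into \<open>l powr (- nn / q) * I\<close>; comparing with the tangent of the convex function
  \<open>l \<mapsto> (1 + l * N x powr q) powr (1 - a)\<close> at \<open>l = 1\<close> identifies the derivative there.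
\<close>

lemma I_J_identity: "nn * I = (a - 1) * q * J"
proof -
  have ge: "I + (l - 1) * ((1 - a) * J) \<le> l powr (- nn / q) * I" if l: "0 < l" for l
  proof -
    define c where "c = l powr (1 / q)"
    have c: "0 < c" "c powr q = l" using l q1 unfolding c_def by (simp_all add: powr_powr)
    have eq: "w (c *\<^sub>R x) = 1 + l * N x powr q" for x
      using c l by (simp add: w_def scale powr_mult)
    have "c ^ DIM('a) = l powr (nn / q)"
      using c(1) l by (simp add: powr_realpow[symmetric] c_def powr_powr nn_def)
    then have I_scaled: "(LBINT x. w (c *\<^sub>R x) powr (1 - a)) = l powr (- nn / q) * I"
      using integral_lborel_scaleR[of "\<lambda>x. w x powr (1 - a)", OF _ c(1)]
      by (simp add: I_def powr_minus_divide)
    \<comment> \<open>A function that is not integrable has integral 0 by convention, which the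
      positive value in \<open>I_scaled\<close> excludes.\<close>
    have int: "integrable lborel (\<lambda>x. w (c *\<^sub>R x) powr (1 - a))"
    proof (rule ccontr)
      assume "\<not> ?thesis"
      then have "(LBINT x. w (c *\<^sub>R x) powr (1 - a)) = 0" by (rule not_integrable_integral_eq)
      then show False using I_scaled I_pos l by simp
    qed
    have "I + (l - 1) * ((1 - a) * J) = (LBINT x. w x powr (1 - a) + (l - 1) * ((1 - a) * (N x powr q * w x powr (- a))))"
      unfolding I_def J_def using int_w1 int_wN by simp
    also have "\<dots> \<le> (LBINT x. w (c *\<^sub>R x) powr (1 - a))"
    proof (rule integral_mono[OF _ int])
      show "integrable lborel (\<lambda>x. w x powr (1 - a) + (l - 1) * ((1 - a) * (N x powr q * w x powr (- a))))"
        using int_w1 int_wN by simp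
      fix x
      define t where "t = w (c *\<^sub>R x) / w x"
      have t: "0 < t" by (simp add: t_def)
      have "w x powr (1 - a) * (1 - (a - 1) * (t - 1)) \<le> w x powr (1 - a) * t powr (- (a - 1))"
        using a1 t by (intro mult_left_mono powr_minus_ge_tangent) auto
      also have "\<dots> = w (c *\<^sub>R x) powr (1 - a)"
        by (simp add: t_def powr_divide less_imp_le less_imp_neq[OF w_pos, symmetric])
      also have "t - 1 = (l - 1) * N x powr q / w x"
        unfolding t_def eq using w_pos[of x] by (simp add: w_def field_simps)
      also have "w x powr (1 - a) * (1 - (a - 1) * ((l - 1) * N x powr q / w x)) =
          w x powr (1 - a) + (l - 1) * ((1 - a) * (N x powr q * w x powr (- a)))"
      proof -
        have "w x powr (- a) = w x powr (1 - a) / w x"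
          using w_pos[of x] powr_diff[of "w x" "1 - a" 1] by simp
        then show ?thesis using w_pos[of x] by (simp only:) (simp add: add_divide_distrib diff_divide_distrib algebra_simps)
      qed
      finally show "w x powr (1 - a) + (l - 1) * ((1 - a) * (N x powr q * w x powr (- a))) \<le> w (c *\<^sub>R x) powr (1 - a)" .
    qed
    finally show ?thesis unfolding I_scaled .
  qed
  define \<phi> where "\<phi> l = l powr (- nn / q) * I - I - (l - 1) * ((1 - a) * J)" for l
  have "(\<phi> has_real_derivative (- nn / q) * I - (1 - a) * J) (at 1)"
    unfolding \<phi>_def by (auto intro!: derivative_eq_intros)
  then have "(- nn / q) * I - (1 - a) * J = 0"
    by (rule DERIV_local_min[where d=1]) (use ge in \<open>auto simp: \<phi>_def algebra_simps abs_real_def split: if_splits\<close>)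
  then show ?thesis using q1 by (simp add: field_simps)
qed

abbreviation "h \<equiv> extremal N p q a"
text \<open>The same two exponents serve both inequalities, with exchanged roles; both are negative
  when a < p.\<close>

definition "\<beta> = a * p / (a - p)"
definition "\<gamma> = p * (a - 1) / (a - p)"

lemma h_eq: "h x = w x powr ((p - a) / p)" by (simp add: extremal_def w_def)

lemma profile_powr:
  "(y powr ((p - a) / p)) powr \<beta> = y powr (- a)" "(y powr ((p - a) / p)) powr \<gamma> = y powr (1 - a)"
proof -
  have "(p - a) / p * \<beta> = - a" "(p - a) / p * \<gamma> = 1 - a"
    unfolding \<beta>_def \<gamma>_def using p by (auto simp: divide_simps) (auto simp: algebra_simps)
  then show "(y powr ((p - a) / p)) powr \<beta> = y powr (- a)" "(y powr ((p - a) / p)) powr \<gamma> = y powr (1 - a)"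
    by (simp_all add: powr_powr)
qed

text \<open>A general \<open>u\<close> is allowed because this is applied to \<open>N\<close> and to
  its smooth approximations.\<close>

lemma GDERIV_profile:
  assumes u: "GDERIV u x :> D" and ux: "0 < u x"
  shows "GDERIV (\<lambda>x. (1 + u x powr q) powr ((p - a) / p)) x :>
    ((p - a) / p * (1 + u x powr q) powr (- a / p) * (q * u x powr (q - 1))) *\<^sub>R D"
proof -
  have "((\<lambda>s. (1 + s powr q) powr ((p - a) / p)) has_real_derivative
      (p - a) / p * (1 + u x powr q) powr ((p - a) / p - 1) * (q * u x powr (q - 1))) (at (u x))"
    using ux by (auto intro!: derivative_eq_intros simp: add_pos_nonneg)
  moreover have "(p - a) / p - 1 = - a / p" using p by (simp add: field_simps)
  ultimately have d: "((\<lambda>s. (1 + s powr q) powr ((p - a) / p)) has_real_derivative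
      (p - a) / p * (1 + u x powr q) powr (- a / p) * (q * u x powr (q - 1))) (at (u x))" by simp
  show ?thesis
    using GDERIV_DERIV_compose[OF u d] by simp
qed

definition "\<kappa> = (\<bar>p - a\<bar> / p * q) powr p"

lemma \<kappa>_pos: "0 < \<kappa>" using p q1 by (simp add: \<kappa>_def)

text \<open>The powers close up because (q - 1) p = q; \<kappa> collects the constants of the chain
  rule.\<close>

lemma dual_norm_profile_powr:
  assumes s: "0 \<le> s"
  shows "dual_norm N (((p - a) / p * (1 + s powr q) powr (- a / p) * (q * s powr (q - 1))) *\<^sub>R D) powr p =
    \<kappa> * (s powr q * (1 + s powr q) powr (- a)) * dual_norm N D powr p"
proof -
  have "dual_norm N (((p - a) / p * (1 + s powr q) powr (- a / p) * (q * s powr (q - 1))) *\<^sub>R D) =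
      (\<bar>p - a\<bar> / p * q) * ((1 + s powr q) powr (- a / p) * s powr (q - 1)) * dual_norm N D"
    unfolding dual_norm_scale using p q1 by (simp add: abs_mult)
  moreover have "((1 + s powr q) powr (- a / p)) powr p = (1 + s powr q) powr (- a)"
    "(s powr (q - 1)) powr p = s powr q"
    using p by (simp_all add: powr_powr q_conj)
  ultimately show ?thesis
    unfolding \<kappa>_def using p q1 by (simp only: powr_mult mult_ac)
qed

lemma AE_extremal:
  "AE x in lborel. h differentiable (at x) \<and> dual_norm N (grad h x) powr p = \<kappa> * (N x powr q * w x powr (- a))"
  using AE_differentiable AE_nonzero
proof eventually_elim
  case (elim x)
  then obtain D where D: "GDERIV N x :> D" by blast
  have Nx: "0 < N x" using elim by (intro pos)
  have gd: "GDERIV h x :> ((p - a) / p * (1 + N x powr q) powr (- a / p) * (q * N x powr (q - 1))) *\<^sub>R D"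
    using GDERIV_profile[OF D Nx] unfolding extremal_def[abs_def] .
  have "h differentiable (at x)"
    using gd unfolding gderiv_def differentiable_def by blast
  moreover have "dual_norm N (grad h x) powr p = \<kappa> * (N x powr q * w x powr (- a))"
    unfolding grad_eqI[OF gd] dual_norm_profile_powr[OF nonneg]
    using GDERIV_dual_norm(3)[OF D] elim by (simp add: w_def)
  ultimately show ?case ..
qed

lemma admissible_extremal: "admissible_extremal N p a h"
  and pow_int_\<beta>_h: "pow_int \<beta> h = Z" and pow_int_\<gamma>_h: "pow_int \<gamma> h = I"
  and grad_int_h: "grad_int N p h = \<kappa> * J"
proof -
  have A: "AE x in lborel. h x powr \<beta> = w x powr (- a)" "AE x in lborel. h x powr \<gamma> = w x powr (1 - a)"
    "AE x in lborel. dual_norm N (grad h x) powr p = \<kappa> * (N x powr q * w x powr (- a))"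
    using AE_extremal by (auto simp: h_eq profile_powr elim!: eventually_mono)
  have B: "integrable lborel (\<lambda>x. \<kappa> * (N x powr q * w x powr (- a)))"
    using int_wN by simp
  show 1: "pow_int \<beta> h = Z" "pow_int \<gamma> h = I" "grad_int N p h = \<kappa> * J"
    unfolding pow_int_def grad_int_def Z_def I_def J_def
    using integral_lebesgue_AE_eq[OF int_w0 A(1)] integral_lebesgue_AE_eq[OF int_w1 A(2)]
      integral_lebesgue_AE_eq[OF B A(3)] by simp_all
  have "AE x in lebesgue. h differentiable (at x)"
    using AE_extremal by (intro AE_completion) (auto elim!: eventually_mono)
  then show "admissible_extremal N p a h"
    unfolding admissible_extremal_def finite_integrals_def
    using integrable_lebesgue_AE_eq[OF int_w0 A(1)] integrable_lebesgue_AE_eq[OF int_w1 A(2)]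
      integrable_lebesgue_AE_eq[OF B A(3)] 1 Z_pos I_pos J_pos \<kappa>_pos
    by (simp add: \<beta>_def \<gamma>_def)
qed

end

section \<open>The gradient inequality\<close>

lemma times_cont_diff_GDERIV:
  fixes f :: "'a::euclidean_space \<Rightarrow> real"
  assumes "times_cont_diff (Suc 0) f"
  shows "GDERIV f x :> grad f x" and "continuous_on UNIV (grad f)"
proof -
  let ?f' = "\<lambda>x. frechet_derivative f (at x)"
  define D where "D x = (\<Sum>b\<in>Basis. ?f' x b *\<^sub>R b)" for x
  have GD: "GDERIV f x :> D x" for x
  proof -
    have d: "(f has_derivative ?f' x) (at x)"
      using assms by (simp add: frechet_derivative_works[symmetric])
    then have lin: "linear (?f' x)" by (rule has_derivative_linear)
    have "?f' x = (\<lambda>h. h \<bullet> D x)"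
    proof
      fix h
      have "?f' x h = ?f' x (\<Sum>b\<in>Basis. (h \<bullet> b) *\<^sub>R b)" by (simp add: euclidean_representation)
      also have "\<dots> = (\<Sum>b\<in>Basis. (h \<bullet> b) * ?f' x b)"
        using lin by (simp add: linear_sum linear_cmul)
      finally show "?f' x h = h \<bullet> D x" by (simp add: D_def inner_sum_right mult.commute)
    qed
    with d show ?thesis by (simp add: gderiv_def)
  qed
  have "grad f = D" by (rule ext) (rule grad_eqI[OF GD])
  then show "GDERIV f x :> grad f x" "continuous_on UNIV (grad f)"
    using GD assms by (auto simp: D_def[abs_def] intro!: continuous_intros)
qed

text \<open>A zero of \<open>f\<close> is a minimum, so \<open>D\<close> vanishes there, and the
  exponent above 1 keeps the power differentiable. Elsewhere this is the chain rule.\<close>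

lemma DERIV_powr_nonneg:
  fixes f :: "real \<Rightarrow> real"
  assumes f: "(f has_real_derivative D) (at x)" and nn: "\<And>z. 0 \<le> f z" and c: "1 < c \<or> 0 < f x"
  shows "((\<lambda>z. f z powr c) has_real_derivative c * f x powr (c - 1) * D) (at x)"
proof (cases "f x = 0")
  case False
  then have "0 < f x" using nn[of x] by simp
  then show ?thesis using f by (auto intro!: derivative_eq_intros simp: powr_diff field_simps)
next
  case True
  then have c1: "1 < c" using c by simp
  have D: "D = 0" by (rule DERIV_local_min[OF f, of 1]) (use True nn in auto)
  have "((\<lambda>h. f (x + h) powr (c - 1) * ((f (x + h) - f x) / h)) \<longlongrightarrow> 0 powr (c - 1) * D) (at 0)"
  proof (rule tendsto_mult)
    have "isCont f x" using f by (rule DERIV_isCont)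
    then have "((\<lambda>h. f (x + h)) \<longlongrightarrow> 0) (at 0)" using True by (simp add: isCont_iff)
    then show "((\<lambda>h. f (x + h) powr (c - 1)) \<longlongrightarrow> 0 powr (c - 1)) (at 0)"
      using nn c1 by (intro tendsto_powr') auto
    show "((\<lambda>h. (f (x + h) - f x) / h) \<longlongrightarrow> D) (at 0)"
      using f by (simp add: DERIV_def)
  qed
  moreover have "(\<lambda>h. f (x + h) powr (c - 1) * ((f (x + h) - f x) / h)) = (\<lambda>h. (f (x + h) powr c - f x powr c) / h)"
  proof
    fix h
    have "f (x + h) powr c = f (x + h) powr (c - 1) * f (x + h)"
      using nn[of "x + h"] powr_add[of "f (x + h)" "c - 1" 1] by simp
    then show "f (x + h) powr (c - 1) * ((f (x + h) - f x) / h) = (f (x + h) powr c - f x powr c) / h"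
      using True c1 by simp
  qed
  ultimately show ?thesis using D by (simp add: DERIV_def)
qed

section \<open>Product coordinates on a Euclidean space\<close>

definition coord_sum :: "('a::euclidean_space \<Rightarrow> real) \<Rightarrow> 'a" where
  "coord_sum x = (\<Sum>b\<in>Basis. x b *\<^sub>R b)"

lemma coord_sum_upd:
  assumes "b \<in> Basis"
  shows "coord_sum (x(b := z)) = coord_sum (x(b := 0)) + z *\<^sub>R b"
proof -
  have "coord_sum (x(b := y)) = y *\<^sub>R b + (\<Sum>c\<in>Basis - {b}. x c *\<^sub>R c)" for y
    unfolding coord_sum_def using assms by (subst sum.remove[of _ b]) (auto intro!: sum.cong)
  from this[of z] this[of 0] show ?thesis by simp
qed

lemma coord_sum_line: "b \<in> Basis \<Longrightarrow> (\<lambda>z. coord_sum (x(b := z))) = (\<lambda>z. coord_sum (x(b := 0)) + z *\<^sub>R b)"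
  by (rule ext) (rule coord_sum_upd)

lemma inner_coord_sum: "b \<in> Basis \<Longrightarrow> coord_sum x \<bullet> b = x b"
  unfolding coord_sum_def by (simp add: inner_sum_left inner_Basis if_distrib sum.delta cong: if_cong)

lemma
  fixes g :: "'a::euclidean_space \<Rightarrow> real"
  assumes g: "integrable lborel g"
  shows integrable_coord_sum: "integrable (lborel_PiM Basis) (\<lambda>x. g (coord_sum x))"
    and integral_coord_sum: "(LINT x|lborel_PiM Basis. g (coord_sum x)) = integral\<^sup>L lborel g"
proof -
  have X: "coord_sum \<in> lborel_PiM Basis \<rightarrow>\<^sub>M (borel :: 'a measure)"
    unfolding coord_sum_def by measurable
  have eq: "(lborel :: 'a measure) = distr (lborel_PiM Basis) borel coord_sum"
    unfolding coord_sum_def by (rule lborel_eq)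
  have "integrable (distr (lborel_PiM Basis) borel coord_sum) g" using g eq by simp
  then show "integrable (lborel_PiM Basis) (\<lambda>x. g (coord_sum x))"
    using X by (rule integrable_distr[rotated])
  have "integral\<^sup>L lborel g = integral\<^sup>L (distr (lborel_PiM Basis) borel coord_sum) g" using eq by simp
  also have "\<dots> = (LINT x|lborel_PiM Basis. g (coord_sum x))"
    using X borel_measurable_integrable[OF g] by (intro integral_distr) auto
  finally show "(LINT x|lborel_PiM Basis. g (coord_sum x)) = integral\<^sup>L lborel g" ..
qed

context GNS_setting
begin

text \<open>The first relation lets Young's inequality split \<open>f powr (\<gamma> - 1)\<close>
  times the gradient into integrands that are known to be integrable; the second makes
  \<open>f powr \<beta>\<close> the source density that belongs to
  \<open>f powr \<gamma>\<close>.\<close>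

lemma \<gamma>_\<beta>: "(\<gamma> - 1) * q = \<beta>" "\<gamma> * (a / (a - 1)) = \<beta>"
  unfolding \<gamma>_def \<beta>_def q_eq using p a1 by (auto simp: divide_simps) (auto simp: algebra_simps)

lemma \<gamma>_gt_1: "p < a \<Longrightarrow> 1 < \<gamma>"
proof -
  assume "p < a"
  moreover have "a < a * p" using p a1 by simp
  ultimately show ?thesis by (simp add: \<gamma>_def field_simps)
qed

text \<open>For a < p the exponents are negative and zeros of \<open>f\<close> must be excluded; for
  p < a they are allowed because \<gamma> > 1 keeps \<open>f powr \<gamma>\<close> differentiable
  there.\<close>

definition competitor :: "('a \<Rightarrow> real) \<Rightarrow> bool" where
  "competitor f \<longleftrightarrow> (\<forall>x. GDERIV f x :> grad f x) \<and> continuous_on UNIV (grad f) \<and>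
    (\<forall>x. 0 \<le> f x) \<and> (p < a \<or> (\<forall>x. 0 < f x)) \<and>
    integrable lborel (\<lambda>x. f x powr \<beta>) \<and> integrable lborel (\<lambda>x. f x powr \<gamma>) \<and>
    integrable lborel (\<lambda>x. dual_norm N (grad f x) powr p)"

lemma competitorD:
  assumes "competitor f"
  shows "GDERIV f x :> grad f x" "continuous_on UNIV (grad f)" "0 \<le> f x" "p < a \<or> (\<forall>x. 0 < f x)"
    "integrable lborel (\<lambda>x. f x powr \<beta>)" "integrable lborel (\<lambda>x. f x powr \<gamma>)"
    "integrable lborel (\<lambda>x. dual_norm N (grad f x) powr p)"
  using assms unfolding competitor_def by blast+

text \<open>\<open>transport_inequality\<close> applied to the function
  \<open>f powr \<gamma>\<close>. Duality of the norms bounds its gradient against the target point,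
  and Young's inequality with a free scaling \<open>l\<close> separates source from target, which
  yields \<open>W\<close> and \<open>V\<close>.\<close>

lemma gradient_inequality:
  fixes f \<psi> :: "'a \<Rightarrow> real"
  assumes comp: "competitor f"
    and f_norm: "(LBINT x. f x powr \<beta>) = 1"
    and \<psi>_nonneg: "\<And>x. 0 \<le> \<psi> x" and \<psi>_supp: "\<And>x. \<psi> x \<noteq> 0 \<Longrightarrow> norm x \<le> R"
    and \<psi>_int: "integrable lborel \<psi>" "integrable lborel (\<lambda>x. \<psi> x powr (1 - 1 / a))"
      "integrable lborel (\<lambda>x. \<psi> x * N x powr q)"
    and \<psi>_norm: "integral\<^sup>L lborel \<psi> = 1"
    and l: "0 < l" and r: "0 < r"
  shows "a * r powr ((a - nn) / a) * (LBINT x. \<psi> x powr (1 - 1 / a)) \<le>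
    (a - nn) * r * (LBINT x. f x powr \<gamma>) + l powr q / q * (LBINT x. \<psi> x * N x powr q)
    + \<bar>\<gamma>\<bar> powr p / (p * l powr p) * (LBINT x. dual_norm N (grad f x) powr p)"
proof -
  note f = competitorD(1,2)[OF comp] and f_nonneg = competitorD(3)[OF comp]
    and f_pos = competitorD(4)[OF comp] and int = competitorD(5-7)[OF comp]
  let ?X = "coord_sum :: ('a \<Rightarrow> real) \<Rightarrow> 'a"
  define u where "u x = dual_norm N (grad f x)" for x
  define V where "V x = \<bar>\<gamma>\<bar> powr p / (p * l powr p) * u x powr p" for x
  define W where "W t = l powr q / q * N t powr q" for t
  define d where "d b x = \<gamma> * f x powr (\<gamma> - 1) * (grad f x \<bullet> b)" for b x
  have f_cont: "continuous_on UNIV f"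
    using f(1) unfolding gderiv_def by (intro continuous_at_imp_continuous_on ballI has_derivative_continuous) blast
  have \<gamma>1: "1 < \<gamma> \<or> 0 < f x" for x using f_pos \<gamma>_gt_1 by blast
  have [measurable]: "f \<in> borel_measurable borel" "grad f \<in> borel_measurable borel"
    by (intro borel_measurable_continuous_onI f_cont f(2))+
  have F: "(f x powr \<gamma>) powr (a / (a - 1)) = f x powr \<beta>" for x
    unfolding powr_powr \<gamma>_\<beta>(2) ..
  have F1: "(f x powr (\<gamma> - 1)) powr q = f x powr \<beta>" for x
    unfolding powr_powr \<gamma>_\<beta>(1) ..
  have qp: "1 / q + 1 / p = 1" using pq by linarith
  have young: "s * t \<le> s powr q / q + t powr p / p" if "0 \<le> s" "0 \<le> t" for s t
    by (rule Youngs_inequality[OF q1 p(1) qp that])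
  \<comment> \<open>Young's inequality bounds each partial derivative of
    \<open>f powr \<gamma>\<close> by the integrands of \<open>\<beta>\<close> and of the
    gradient.\<close>
  have int_d: "integrable lborel (d b)" for b
  proof (rule Bochner_Integration.integrable_bound)
    show "integrable lborel (\<lambda>x. \<bar>\<gamma>\<bar> * N b * (f x powr \<beta> / q + u x powr p / p))"
      using int by (simp add: u_def)
    show "d b \<in> borel_measurable lborel" unfolding d_def by measurable
    show "AE x in lborel. norm (d b x) \<le> norm (\<bar>\<gamma>\<bar> * N b * (f x powr \<beta> / q + u x powr p / p))"
    proof (rule AE_I2)
      fix x
      have "\<bar>d b x\<bar> = \<bar>\<gamma>\<bar> * f x powr (\<gamma> - 1) * \<bar>b \<bullet> grad f x\<bar>"
        by (simp add: d_def abs_mult inner_commute)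
      also have "\<dots> \<le> \<bar>\<gamma>\<bar> * f x powr (\<gamma> - 1) * (N b * u x)"
        unfolding u_def by (intro mult_left_mono abs_inner_le_dual) auto
      also have "\<dots> = \<bar>\<gamma>\<bar> * N b * (f x powr (\<gamma> - 1) * u x)" by simp
      also have "\<dots> \<le> \<bar>\<gamma>\<bar> * N b * (f x powr \<beta> / q + u x powr p / p)"
        using young[of "f x powr (\<gamma> - 1)" "u x"] by (intro mult_left_mono) (auto simp: F1 u_def)
      finally show "norm (d b x) \<le> norm (\<bar>\<gamma>\<bar> * N b * (f x powr \<beta> / q + u x powr p / p))" by simp
    qed
  qed
  have td: "transport_data (Basis :: 'a set) a R (\<lambda>x. f (?X x) powr \<gamma>) (\<lambda>b x. d b (?X x))
      (\<lambda>t. \<psi> (?X t)) (\<lambda>t. W (?X t)) (\<lambda>x. V (?X x))"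
  proof
    show "\<bar>t b\<bar> \<le> R" if "b \<in> Basis" "\<psi> (?X t) \<noteq> 0" for b t
      using \<psi>_supp[OF that(2)] Basis_le_norm[OF that(1), of "?X t"] inner_coord_sum[OF that(1), of t] by simp
    show "integrable (lborel_PiM Basis) (\<lambda>x. (f (?X x) powr \<gamma>) powr (a / (a - 1)))"
      unfolding F by (rule integrable_coord_sum[OF int(1)])
    show "integrable (lborel_PiM Basis) (\<lambda>x. f (?X x) powr \<gamma>)"
      by (rule integrable_coord_sum[OF int(2)])
    show "integrable (lborel_PiM Basis) (\<lambda>x. d b (?X x))" for b
      by (rule integrable_coord_sum[OF int_d])
    show "integrable (lborel_PiM Basis) (\<lambda>t. \<psi> (?X t))"
      by (rule integrable_coord_sum[OF \<psi>_int(1)])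
    show "integrable (lborel_PiM Basis) (\<lambda>t. \<psi> (?X t) powr (1 - 1 / a))"
      by (rule integrable_coord_sum[OF \<psi>_int(2)])
    have "integrable lborel (\<lambda>t. \<psi> t * W t)"
      using integrable_mult_left[OF \<psi>_int(3), of "l powr q / q"] by (simp add: W_def field_simps)
    then show "integrable (lborel_PiM Basis) (\<lambda>t. \<psi> (?X t) * W (?X t))"
      by (rule integrable_coord_sum)
    have "integrable lborel V" using int(3) unfolding V_def u_def by simp
    then show "integrable (lborel_PiM Basis) (\<lambda>x. V (?X x))"
      by (rule integrable_coord_sum)
    show "((\<lambda>z. f (?X (x(b := z))) powr \<gamma>) has_real_derivative d b (?X (x(b := y)))) (at y)"
      if b: "b \<in> Basis" for b x y
      unfolding d_def
    proof (rule DERIV_powr_nonneg[OF _ f_nonneg \<gamma>1])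
      define c where "c = ?X (x(b := 0))"
      have X: "?X (x(b := z)) = c + z *\<^sub>R b" for z unfolding c_def by (rule coord_sum_upd[OF b])
      have "((\<lambda>z. c + z *\<^sub>R b) has_derivative (\<lambda>z. z *\<^sub>R b)) (at y)"
        by (auto intro!: derivative_eq_intros)
      from has_derivative_compose[OF this f(1)[of "c + y *\<^sub>R b", unfolded gderiv_def]]
      have "((\<lambda>z. f (c + z *\<^sub>R b)) has_real_derivative grad f (c + y *\<^sub>R b) \<bullet> b) (at y)"
        by (simp add: has_field_derivative_def inner_commute mult_commute_abs)
      then show "((\<lambda>z. f (?X (x(b := z)))) has_real_derivative grad f (?X (x(b := y))) \<bullet> b) (at y)"
        unfolding X .
    qed
    show "continuous_on UNIV (\<lambda>y. d b (?X (x(b := y))))" if b: "b \<in> Basis" for b x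
    proof -
      have Xc: "continuous_on UNIV (\<lambda>y. ?X (x(b := y)))"
        by (subst coord_sum_line[OF b]) (intro continuous_intros)
      have fc: "continuous_on UNIV (\<lambda>y. f (?X (x(b := y))))"
        by (rule continuous_on_compose2[OF f_cont Xc]) auto
      have "continuous_on UNIV (\<lambda>y. f (?X (x(b := y))) powr (\<gamma> - 1))"
        using f_pos
      proof
        assume "p < a"
        then show ?thesis using \<gamma>_gt_1 f_nonneg by (intro continuous_on_powr' fc) auto
      next
        assume "\<forall>x. 0 < f x"
        then have "f y \<noteq> 0" for y by (metis less_irrefl)
        then show ?thesis by (intro continuous_on_powr fc continuous_intros) simp
      qed
      moreover have "continuous_on UNIV (\<lambda>y. grad f (?X (x(b := y))))"
        by (rule continuous_on_compose2[OF f(2) Xc]) auto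
      ultimately show ?thesis unfolding d_def
        by (intro continuous_on_mult continuous_on_inner continuous_on_const)
    qed
    fix x t
    let ?x = "?X x" and ?t = "?X t"
    have "(\<Sum>b\<in>Basis. d b ?x * t b) = \<gamma> * f ?x powr (\<gamma> - 1) * (grad f ?x \<bullet> ?t)"
    proof -
      have "v \<bullet> ?t = (\<Sum>b\<in>Basis. t b * (v \<bullet> b))" for v
        unfolding coord_sum_def by (simp add: inner_sum_right)
      then have "grad f ?x \<bullet> ?t = (\<Sum>b\<in>Basis. t b * (grad f ?x \<bullet> b))" .
      then show ?thesis by (simp only: d_def sum_distrib_left mult_ac)
    qed
    then have "- (\<Sum>b\<in>Basis. d b ?x * t b) \<le> \<bar>\<gamma> * f ?x powr (\<gamma> - 1) * (grad f ?x \<bullet> ?t)\<bar>"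
      using abs_ge_minus_self[of "\<Sum>b\<in>Basis. d b ?x * t b"] by simp
    also have "\<dots> = \<bar>\<gamma>\<bar> * f ?x powr (\<gamma> - 1) * \<bar>?t \<bullet> grad f ?x\<bar>"
      by (simp add: abs_mult inner_commute)
    also have "\<dots> \<le> \<bar>\<gamma>\<bar> * f ?x powr (\<gamma> - 1) * (N ?t * u ?x)"
      unfolding u_def by (intro mult_left_mono abs_inner_le_dual) auto
    also have "\<dots> = (f ?x powr (\<gamma> - 1) * l * N ?t) * (\<bar>\<gamma>\<bar> * u ?x / l)"
      using l by simp
    also have "\<dots> \<le> (f ?x powr (\<gamma> - 1) * l * N ?t) powr q / q + (\<bar>\<gamma>\<bar> * u ?x / l) powr p / p"
      using l by (intro young) (auto simp: u_def)
    also have "(f ?x powr (\<gamma> - 1) * l * N ?t) powr q = f ?x powr \<beta> * (l powr q * N ?t powr q)"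
      using l by (simp add: powr_mult F1)
    also have "(\<bar>\<gamma>\<bar> * u ?x / l) powr p = \<bar>\<gamma>\<bar> powr p * u ?x powr p / l powr p"
      using l by (simp add: powr_mult powr_divide u_def)
    finally show "- (\<Sum>b\<in>Basis. d b ?x * t b) \<le> (f ?x powr \<gamma>) powr (a / (a - 1)) * W ?t + V ?x"
      unfolding F by (simp add: W_def V_def field_simps)
  qed (simp_all add: a a1 \<psi>_nonneg)
  have "a * r powr ((a - nn) / a) * (LINT t|lborel_PiM Basis. \<psi> (?X t) powr (1 - 1 / a)) \<le>
      (a - nn) * r * (LINT x|lborel_PiM Basis. f (?X x) powr \<gamma>) + (LINT t|lborel_PiM Basis. \<psi> (?X t) * W (?X t))
      + (LINT x|lborel_PiM Basis. V (?X x))"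
    unfolding nn_def
  proof (rule transport_inequality[OF td _ _ r])
    show "(LINT x|lborel_PiM Basis. (f (?X x) powr \<gamma>) powr (a / (a - 1))) = 1"
      unfolding F using integral_coord_sum[OF int(1)] f_norm by simp
    show "(LINT t|lborel_PiM Basis. \<psi> (?X t)) = 1"
      using integral_coord_sum[OF \<psi>_int(1)] \<psi>_norm by simp
  qed
  also have "(LINT t|lborel_PiM Basis. \<psi> (?X t) powr (1 - 1 / a)) = (LBINT x. \<psi> x powr (1 - 1 / a))"
    by (rule integral_coord_sum[OF \<psi>_int(2)])
  also have "(LINT x|lborel_PiM Basis. f (?X x) powr \<gamma>) = (LBINT x. f x powr \<gamma>)"
    by (rule integral_coord_sum[OF int(2)])
  also have "(LINT t|lborel_PiM Basis. \<psi> (?X t) * W (?X t)) = (LINT t|lborel_PiM Basis. l powr q / q * (\<psi> (?X t) * N (?X t) powr q))"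
    by (intro Bochner_Integration.integral_cong) (auto simp: W_def)
  also have "\<dots> = l powr q / q * (LBINT x. \<psi> x * N x powr q)"
    using integral_coord_sum[OF \<psi>_int(3)] by simp
  also have "(LINT x|lborel_PiM Basis. V (?X x)) = \<bar>\<gamma>\<bar> powr p / (p * l powr p) * (LBINT x. dual_norm N (grad f x) powr p)"
    unfolding V_def u_def using integral_coord_sum[OF int(3)] by simp
  finally show ?thesis .
qed

end

section \<open>Removing the truncation and optimizing the parameters\<close>

lemma tendsto_integral_cball:
  fixes g :: "'a::euclidean_space \<Rightarrow> real"
  assumes g: "integrable lborel g"
  shows "(\<lambda>k. \<integral>x. indicator (cball 0 (real k)) x * g x \<partial>lborel) \<longlonglongrightarrow> integral\<^sup>L lborel g"
proof (rule integral_dominated_convergence[where w="\<lambda>x. \<bar>g x\<bar>"])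
  have [measurable]: "g \<in> borel_measurable borel" using g by auto
  show "(\<lambda>x. indicator (cball 0 (real k)) x * g x) \<in> borel_measurable lborel" for k
    by (intro borel_measurable_times borel_measurable_indicator) auto
  show "AE x in lborel. (\<lambda>k. indicator (cball 0 (real k)) x * g x) \<longlonglongrightarrow> g x"
  proof (rule AE_I2)
    fix x :: 'a
    obtain K :: nat where "norm x \<le> K" using real_arch_simple by blast
    then have "\<forall>\<^sub>F k in sequentially. indicator (cball 0 (real k)) x * g x = g x"
      by (intro eventually_sequentiallyI[of K]) (auto simp: indicator_def)
    then show "(\<lambda>k. indicator (cball 0 (real k)) x * g x) \<longlonglongrightarrow> g x" by (rule tendsto_eventually)
  qed
qed (use g in \<open>auto simp: indicator_def\<close>)

lemma integrable_indicator_cball: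
  fixes g :: "'a::euclidean_space \<Rightarrow> real"
  assumes g: "integrable lborel g"
  shows "integrable lborel (\<lambda>x. indicator (cball 0 R) x * g x)"
proof (rule Bochner_Integration.integrable_bound[OF g])
  show "(\<lambda>x. indicator (cball 0 R) x * g x) \<in> borel_measurable lborel"
    using g by (intro borel_measurable_times borel_measurable_indicator) auto
qed (auto simp: indicator_def)

context GNS_setting
begin

text \<open>The conclusion is the minimum over \<open>l\<close> of the bound in \<open>K\<close>. It
  is attained at l powr (p + q) = Y / X, and p + q = p q because the exponents are conjugate. For Y
  = 0 the infimum 0 is only approached as \<open>l\<close> tends to 0.\<close>

lemma optimize_young:
  assumes K: "\<And>l. 0 < l \<Longrightarrow> K \<le> l powr q / q * X + Y / (p * l powr p)" and X: "0 < X" and Y: "0 \<le> Y"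
  shows "K \<le> X powr (1 / q) * Y powr (1 / p)"
proof (cases "Y = 0")
  case True
  have "K \<le> 0"
  proof (rule ccontr)
    assume "\<not> K \<le> 0"
    then have K0: "0 < K * q / (2 * X)" using X q1 by simp
    \<comment> \<open>Chosen so that the bound becomes K \<le> K / 2.\<close>
    define y where "y = K * q / (2 * X)"
    define l where "l = y powr (1 / q)"
    have l: "0 < l" "l powr q = y" using K0 q1 unfolding l_def y_def[symmetric] by (simp_all add: powr_powr)
    have "K \<le> y / q * X" using K[OF l(1)] True unfolding l(2) by simp
    also have "\<dots> = K / 2" using X q1 by (simp add: y_def)
    finally show False using \<open>\<not> K \<le> 0\<close> by simp
  qed
  then show ?thesis using True p by simp
next
  case False
  define s where "s = Y / X"
  have s: "0 < s" "Y = s * X" using X Y False by (auto simp: s_def)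
  define l where "l = s powr (1 / (p * q))"
  have l: "0 < l" "l powr q = s powr (1 / p)" "l powr p = s powr (1 / q)"
    using s p q1 unfolding l_def by (simp_all add: powr_powr)
  have pq': "1 / p = 1 - 1 / q" using pq by simp
  have e: "Y / s powr (1 / q) = s powr (1 / p) * X"
    unfolding pq' powr_diff using s by simp
  have "K \<le> l powr q / q * X + Y / (p * l powr p)" by (rule K[OF l(1)])
  also have "\<dots> = s powr (1 / p) * X * (1 / q) + (Y / s powr (1 / q)) * (1 / p)"
    unfolding l by simp
  also have "\<dots> = s powr (1 / p) * X * (1 / p + 1 / q)"
    unfolding e by (simp add: algebra_simps)
  also have "\<dots> = X powr (1 / q) * Y powr (1 / p)"
  proof -
    have "X powr (1 / q) * X powr (1 / p) = X"
      using X pq by (simp add: powr_add[symmetric] add.commute)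
    moreover have "Y powr (1 / p) = s powr (1 / p) * X powr (1 / p)"
      unfolding s(2) using s(1) X by (simp add: powr_mult)
    ultimately show ?thesis using pq by (simp add: mult_ac)
  qed
  finally show ?thesis .
qed

text \<open>The density \<open>w x powr (- a) / Z\<close> lacks compact support, so its normalized
  restrictions to balls serve as targets and the radius tends to infinity.\<close>

lemma extremal_gradient_inequality:
  fixes f :: "'a \<Rightarrow> real"
  assumes comp: "competitor f"
    and f_norm: "(LBINT x. f x powr \<beta>) = 1"
    and l: "0 < l" and r: "0 < r"
  shows "a * r powr ((a - nn) / a) * (I / Z powr (1 - 1 / a)) \<le>
    (a - nn) * r * (LBINT x. f x powr \<gamma>) + l powr q / q * (J / Z)
    + \<bar>\<gamma>\<bar> powr p / (p * l powr p) * (LBINT x. dual_norm N (grad f x) powr p)"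
proof -
  define E where "E y = (a - nn) * r * (LBINT x. f x powr \<gamma>) + l powr q / q * y
    + \<bar>\<gamma>\<bar> powr p / (p * l powr p) * (LBINT x. dual_norm N (grad f x) powr p)" for y
  let ?i = "\<lambda>k x. indicator (cball (0::'a) (real k)) x :: real"
  define z where "z k = (LBINT x. ?i k x * w x powr (- a))" for k
  define i where "i k = (LBINT x. ?i k x * w x powr (1 - a))" for k
  define j where "j k = (LBINT x. ?i k x * (N x powr q * w x powr (- a)))" for k
  have z: "z \<longlonglongrightarrow> Z" and i: "i \<longlonglongrightarrow> I" and j: "j \<longlonglongrightarrow> J"
    unfolding z_def[abs_def] Z_def i_def[abs_def] I_def j_def[abs_def] J_def
    by (intro tendsto_integral_cball int_w0 int_w1 int_wN)+
  have lim: "(\<lambda>k. a * r powr ((a - nn) / a) * (i k / z k powr (1 - 1 / a))) \<longlonglongrightarrow>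
      a * r powr ((a - nn) / a) * (I / Z powr (1 - 1 / a))"
    using Z_pos by (intro tendsto_intros z i) auto
  have lim': "(\<lambda>k. E (j k / z k)) \<longlonglongrightarrow> E (J / Z)"
    unfolding E_def using Z_pos by (intro tendsto_intros z j) auto
  have "\<forall>\<^sub>F k in sequentially. 0 < z k" using order_tendstoD(1)[OF z Z_pos] .
  then have "\<forall>\<^sub>F k in sequentially. a * r powr ((a - nn) / a) * (i k / z k powr (1 - 1 / a)) \<le> E (j k / z k)"
  proof eventually_elim
    case (elim k)
    define \<psi> where "\<psi> x = ?i k x * w x powr (- a) / z k" for x
    have pw: "\<psi> x powr (1 - 1 / a) = ?i k x * w x powr (1 - a) / z k powr (1 - 1 / a)" for x
    proof -
      have "- a * (1 - 1 / a) = 1 - a" using a1 by (simp add: field_simps)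
      then have "(w x powr (- a)) powr (1 - 1 / a) = w x powr (1 - a)" by (simp only: powr_powr)
      then show ?thesis using elim a1 by (simp add: \<psi>_def indicator_def powr_divide)
    qed
    have pN: "\<psi> x * N x powr q = ?i k x * (N x powr q * w x powr (- a)) / z k" for x
      by (simp add: \<psi>_def)
    have "a * r powr ((a - nn) / a) * (LBINT x. \<psi> x powr (1 - 1 / a)) \<le> E (LBINT x. \<psi> x * N x powr q)"
      unfolding E_def
    proof (rule gradient_inequality[OF comp f_norm _ _ _ _ _ _ l r])
      show "0 \<le> \<psi> x" for x using elim by (simp add: \<psi>_def)
      show "norm x \<le> real k" if "\<psi> x \<noteq> 0" for x using that by (auto simp: \<psi>_def indicator_def split: if_splits)
      show "integrable lborel \<psi>" unfolding \<psi>_def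
        by (intro integrable_divide integrable_indicator_cball int_w0)
      show "integrable lborel (\<lambda>x. \<psi> x powr (1 - 1 / a))" unfolding pw
        by (intro integrable_divide integrable_indicator_cball int_w1)
      show "integrable lborel (\<lambda>x. \<psi> x * N x powr q)" unfolding pN
        by (intro integrable_divide integrable_indicator_cball int_wN)
      show "integral\<^sup>L lborel \<psi> = 1" unfolding \<psi>_def using elim by (simp add: z_def[symmetric])
    qed
    then show ?case unfolding pw pN by (simp add: i_def j_def)
  qed
  with lim lim' have "a * r powr ((a - nn) / a) * (I / Z powr (1 - 1 / a)) \<le> E (J / Z)"
    by (intro tendsto_le[OF _ lim' lim]) auto
  then show ?thesis unfolding E_def .
qed

text \<open>The arguments stand for the integrals of \<open>f powr \<gamma>\<close>, of the gradient
  and of \<open>f powr \<beta>\<close>. The exponents make the value invariant when \<open>f\<close>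
  is multiplied by a positive constant or dilated; its power with exponent - \<theta> is the
  quotient of the two sides of the final inequality without the constant.\<close>

definition \<Psi> :: "real \<Rightarrow> real \<Rightarrow> real \<Rightarrow> real" where
  "\<Psi> A B M = A powr ((a - nn) / nn) * B powr (1 / p) * M powr (- ((\<gamma> * ((a - nn) / nn) + 1) / \<beta>))"

text \<open>The equality case. The constants in \<kappa> and \<gamma> combine to q (a - 1), so that
  \<open>I_J_identity\<close> can replace \<open>J\<close> by \<open>I\<close>. The right side is
  what remains of the general inequality when \<open>r\<close> and \<open>l\<close> are
  optimal.\<close>

lemma \<Psi>_extremal:
  "\<Psi> I (\<kappa> * J) Z * ((J / Z) powr (1 / q) * \<bar>\<gamma>\<bar>) = nn * (I / Z powr (1 - 1 / a)) powr (a / nn)"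
proof -
  let ?\<delta> = "(a - nn) / nn"
  let ?e = "(\<gamma> * ?\<delta> + 1) / \<beta>"
  have nn0: "0 < nn" using nn_ge_1 by simp
  have \<beta>0: "\<beta> \<noteq> 0" using p a1 by (simp add: \<beta>_def)
  have d1: "a / nn = 1 + ?\<delta>" using nn0 by (simp add: field_simps)
  have e: "?e + 1 / q = (1 - 1 / a) * (1 + ?\<delta>)"
  proof -
    have "\<gamma> / \<beta> = 1 - 1 / a" "1 / \<beta> = 1 / p - 1 / a"
      using p a1 by (auto simp: \<gamma>_def \<beta>_def field_simps)
    moreover have "?e = (\<gamma> / \<beta>) * ?\<delta> + 1 / \<beta>"
      by (simp add: add_divide_distrib mult.commute)
    ultimately have "?e = (1 - 1 / a) * ?\<delta> + (1 / p - 1 / a)" by (simp only:)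
    then show ?thesis using pq by (simp add: algebra_simps)
  qed
  have \<kappa>: "\<kappa> powr (1 / p) * \<bar>\<gamma>\<bar> = q * (a - 1)"
  proof -
    have "\<kappa> powr (1 / p) = \<bar>p - a\<bar> / p * q" using p q1 by (simp add: \<kappa>_def powr_powr)
    moreover have "\<bar>\<gamma>\<bar> = p * (a - 1) / \<bar>p - a\<bar>" using p a1 by (simp add: \<gamma>_def abs_mult abs_minus_commute)
    ultimately show ?thesis using p by simp
  qed
  have J: "J powr (1 / p) * J powr (1 / q) = J"
    using J_pos pq by (simp add: powr_add[symmetric])
  have "\<Psi> I (\<kappa> * J) Z * ((J / Z) powr (1 / q) * \<bar>\<gamma>\<bar>) =
      I powr ?\<delta> * (\<kappa> powr (1 / p) * \<bar>\<gamma>\<bar>) * (J powr (1 / p) * J powr (1 / q)) * (Z powr (- ?e) / Z powr (1 / q))"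
    unfolding \<Psi>_def using \<kappa>_pos J_pos Z_pos by (simp add: powr_mult powr_divide)
  also have "\<dots> = I powr ?\<delta> * ((a - 1) * q * J) * (Z powr (- ?e) / Z powr (1 / q))"
    unfolding \<kappa> J by simp
  also have "Z powr (- ?e) / Z powr (1 / q) = 1 / Z powr (?e + 1 / q)"
    using Z_pos by (simp add: powr_minus powr_add field_simps)
  also have "\<dots> = 1 / (Z powr (1 - 1 / a)) powr (1 + ?\<delta>)"
    unfolding e by (simp add: powr_powr)
  also have "(a - 1) * q * J = nn * I" using I_J_identity by simp
  also have "I powr ?\<delta> * (nn * I) * (1 / (Z powr (1 - 1 / a)) powr (1 + ?\<delta>)) =
      nn * (I powr (1 + ?\<delta>) / (Z powr (1 - 1 / a)) powr (1 + ?\<delta>))"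
    using I_pos by (simp add: powr_add)
  also have "I powr (1 + ?\<delta>) / (Z powr (1 - 1 / a)) powr (1 + ?\<delta>) = (I / Z powr (1 - 1 / a)) powr (1 + ?\<delta>)"
    using I_pos by (simp add: powr_divide)
  finally show ?thesis unfolding d1 .
qed

lemma \<Psi>_minimal_normalized:
  fixes f :: "'a \<Rightarrow> real"
  assumes comp: "competitor f"
    and f_norm: "(LBINT x. f x powr \<beta>) = 1"
    and A: "A = (LBINT x. f x powr \<gamma>)" "0 < A"
    and B: "B = (LBINT x. dual_norm N (grad f x) powr p)"
  shows "\<Psi> I (\<kappa> * J) Z \<le> \<Psi> A B 1"
proof -
  let ?\<delta> = "(a - nn) / nn"
  define c where "c = I / Z powr (1 - 1 / a)"
  have c: "0 < c" unfolding c_def using I_pos Z_pos by simp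
  have nn0: "0 < nn" using nn_ge_1 by simp
  have B0: "0 \<le> B" unfolding B by (intro Bochner_Integration.integral_nonneg) auto
  \<comment> \<open>The maximizer over \<open>r\<close> of
    \<open>a * r powr ((a - nn) / a) * c - (a - nn) * r * A\<close>.\<close>
  define r where "r = (c / A) powr (a / nn)"
  have r: "0 < r" unfolding r_def using c A(2) by simp
  define E where "E = (c / A) powr ?\<delta>"
  have rE: "r powr ((a - nn) / a) = E" using a1 by (simp add: r_def E_def powr_powr)
  have rA: "r * A = c * E"
  proof -
    have "a / nn = 1 + ?\<delta>" using nn0 by (simp add: field_simps)
    then have "r = (c / A) * E" using c A(2) by (simp add: r_def E_def powr_add)
    then show ?thesis using A(2) by simp
  qed
  have "nn * c * E \<le> (J / Z) powr (1 / q) * (\<bar>\<gamma>\<bar> powr p * B) powr (1 / p)"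
  proof (rule optimize_young)
    fix l :: real assume l: "0 < l"
    have "a * E * c \<le> (a - nn) * (r * A) + l powr q / q * (J / Z) + \<bar>\<gamma>\<bar> powr p / (p * l powr p) * B"
      using extremal_gradient_inequality[OF comp f_norm l r]
      unfolding A(1)[symmetric] B[symmetric] c_def[symmetric] rE by simp
    then show "nn * c * E \<le> l powr q / q * (J / Z) + \<bar>\<gamma>\<bar> powr p * B / (p * l powr p)"
      unfolding rA by (simp add: algebra_simps)
  qed (use J_pos Z_pos B0 in auto)
  also have "(\<bar>\<gamma>\<bar> powr p * B) powr (1 / p) = \<bar>\<gamma>\<bar> * B powr (1 / p)"
    using p B0 by (simp add: powr_mult powr_powr)
  finally have "nn * c * E * A powr ?\<delta> \<le> (J / Z) powr (1 / q) * (\<bar>\<gamma>\<bar> * B powr (1 / p)) * A powr ?\<delta>"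
    by (intro mult_right_mono) auto
  moreover have "nn * c * E * A powr ?\<delta> = nn * c powr (a / nn)"
  proof -
    have "E * A powr ?\<delta> = c powr ?\<delta>" using c A(2) by (simp add: E_def powr_mult[symmetric])
    moreover have "a / nn = 1 + ?\<delta>" using nn0 by (simp add: field_simps)
    ultimately show ?thesis using c by (simp add: powr_add mult.assoc)
  qed
  moreover have "(J / Z) powr (1 / q) * (\<bar>\<gamma>\<bar> * B powr (1 / p)) * A powr ?\<delta> = \<Psi> A B 1 * ((J / Z) powr (1 / q) * \<bar>\<gamma>\<bar>)"
    by (simp add: \<Psi>_def mult_ac)
  ultimately have "\<Psi> I (\<kappa> * J) Z * ((J / Z) powr (1 / q) * \<bar>\<gamma>\<bar>) \<le> \<Psi> A B 1 * ((J / Z) powr (1 / q) * \<bar>\<gamma>\<bar>)"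
    unfolding \<Psi>_extremal c_def[symmetric] by (simp only:)
  moreover have "0 < (J / Z) powr (1 / q) * \<bar>\<gamma>\<bar>"
    using J_pos Z_pos p a1 by (simp add: \<gamma>_def)
  ultimately show ?thesis by (rule mult_right_le_imp_le)
qed

text \<open>Dividing \<open>f\<close> by the constant that gives \<open>f powr \<beta>\<close> mass
  1 leaves \<Psi> unchanged and reduces the claim to the normalized case.\<close>

theorem \<Psi>_minimal:
  fixes f :: "'a \<Rightarrow> real"
  assumes comp: "competitor f"
    and M: "M = (LBINT x. f x powr \<beta>)" "0 < M"
    and A: "A = (LBINT x. f x powr \<gamma>)" "0 < A"
    and B: "B = (LBINT x. dual_norm N (grad f x) powr p)"
  shows "\<Psi> I (\<kappa> * J) Z \<le> \<Psi> A B M"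
proof -
  note f = competitorD(1,2)[OF comp] and f_nonneg = competitorD(3)[OF comp]
    and f_pos = competitorD(4)[OF comp] and int = competitorD(5-7)[OF comp]
  let ?\<delta> = "(a - nn) / nn"
  have \<beta>0: "\<beta> \<noteq> 0" using p a1 by (simp add: \<beta>_def)
  define m where "m = M powr (1 / \<beta>)"
  have m: "0 < m" "m powr \<beta> = M" using M(2) \<beta>0 by (auto simp: m_def powr_powr)
  define g where "g x = f x / m" for x
  have B0: "0 \<le> B" unfolding B by (intro Bochner_Integration.integral_nonneg) auto
  have Dg: "GDERIV g x :> (1 / m) *\<^sub>R grad f x" for x
  proof -
    have "(f has_derivative (\<lambda>h. h \<bullet> grad f x)) (at x)" using f(1) by (simp add: gderiv_def)
    then have "((\<lambda>x. (1 / m) * f x) has_derivative (\<lambda>h. (1 / m) * (h \<bullet> grad f x))) (at x)"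
      by (rule has_derivative_mult_right)
    then show ?thesis by (simp add: gderiv_def g_def[abs_def])
  qed
  have grad_g: "grad g x = (1 / m) *\<^sub>R grad f x" for x by (rule grad_eqI[OF Dg])
  have g_powr: "g x powr s = f x powr s / m powr s" for x s
    using f_nonneg m by (simp add: g_def powr_divide)
  have g_dual: "dual_norm N (grad g x) powr p = dual_norm N (grad f x) powr p / m powr p" for x
    unfolding grad_g dual_norm_scale using m by (simp add: powr_divide)
  have "\<Psi> I (\<kappa> * J) Z \<le> \<Psi> (A / m powr \<gamma>) (B / m powr p) 1"
  proof (rule \<Psi>_minimal_normalized)
    show "competitor g"
      unfolding competitor_def
    proof (intro conjI allI)
      show "GDERIV g x :> grad g x" for x unfolding grad_g by (rule Dg)
      show "continuous_on UNIV (grad g)" unfolding grad_g[abs_def] by (intro continuous_intros f(2))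
      show "0 \<le> g x" for x using f_nonneg m by (simp add: g_def)
      show "p < a \<or> (\<forall>x. 0 < g x)" using f_pos m by (auto simp: g_def)
      show "integrable lborel (\<lambda>x. g x powr \<beta>)" "integrable lborel (\<lambda>x. g x powr \<gamma>)"
        "integrable lborel (\<lambda>x. dual_norm N (grad g x) powr p)"
        unfolding g_powr g_dual by (intro integrable_divide int)+
    qed
    show "(LBINT x. g x powr \<beta>) = 1" unfolding g_powr using M m by simp
    show "A / m powr \<gamma> = (LBINT x. g x powr \<gamma>)" unfolding g_powr A(1) by simp
    show "0 < A / m powr \<gamma>" using A(2) m by simp
    show "B / m powr p = (LBINT x. dual_norm N (grad g x) powr p)" unfolding g_dual B by simp
  qed
  also have "\<Psi> (A / m powr \<gamma>) (B / m powr p) 1 = \<Psi> A B M"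
  proof -
    have "(A / m powr \<gamma>) powr ?\<delta> = A powr ?\<delta> / m powr (\<gamma> * ?\<delta>)"
      using A(2) m by (simp add: powr_divide powr_powr)
    moreover have "(B / m powr p) powr (1 / p) = B powr (1 / p) / m"
      using B0 m p by (simp add: powr_divide powr_powr)
    moreover have "M powr (- ((\<gamma> * ?\<delta> + 1) / \<beta>)) = 1 / (m powr (\<gamma> * ?\<delta>) * m)"
    proof -
      have "M powr (- ((\<gamma> * ?\<delta> + 1) / \<beta>)) = m powr (\<beta> * (- ((\<gamma> * ?\<delta> + 1) / \<beta>)))"
        unfolding m(2)[symmetric] powr_powr ..
      also have "\<beta> * (- ((\<gamma> * ?\<delta> + 1) / \<beta>)) = - (\<gamma> * ?\<delta> + 1)" using \<beta>0 by simp
      also have "m powr (- (x + 1)) = 1 / (m powr x * m)" for x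
        unfolding powr_minus powr_add using m(1) by (simp add: divide_inverse)
      finally show ?thesis .
    qed
    ultimately show ?thesis unfolding \<Psi>_def by simp
  qed
  finally show ?thesis .
qed

end

section \<open>Smooth approximation of norms\<close>

lemma times_cont_diff_continuous: "times_cont_diff k f \<Longrightarrow> continuous_on UNIV f"
proof (cases k)
  case (Suc j)
  assume "times_cont_diff k f"
  then have "f differentiable (at x)" for x using Suc by simp
  then show ?thesis
    by (intro continuous_at_imp_continuous_on ballI differentiable_imp_continuous_within)
qed simp

lemma times_cont_diff_Suc_imp: "times_cont_diff (Suc k) f \<Longrightarrow> times_cont_diff k f"
proof (induction k arbitrary: f)
  case 0
  then show ?case using times_cont_diff_continuous[OF 0] by simp
next
  case (Suc k)
  then show ?case by (metis times_cont_diff.simps(2))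
qed

lemma times_cont_diff_SucD:
  "times_cont_diff (Suc k) f \<Longrightarrow> (f has_derivative frechet_derivative f (at x)) (at x)"
  by (simp add: frechet_derivative_works[symmetric])

lemma times_cont_diff_SucI:
  assumes f: "\<And>x. (f has_derivative f' x) (at x)" and f': "\<And>v. times_cont_diff k (\<lambda>x. f' x v)"
  shows "times_cont_diff (Suc k) f"
proof -
  have "frechet_derivative f (at x) = f' x" for x using frechet_derivative_at[OF f] by metis
  moreover have "f differentiable at x" for x using f by (auto simp: differentiable_def)
  ultimately show ?thesis using f' by simp
qed

lemma times_cont_diff_const: "times_cont_diff k (\<lambda>_. c)"
proof (induction k arbitrary: c)
  case (Suc k)
  then show ?case by (intro times_cont_diff_SucI[of _ "\<lambda>_ _. 0"]) auto
qed simp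

lemma times_cont_diff_inner: "times_cont_diff k (\<lambda>x. x \<bullet> y)"
proof (cases k)
  case (Suc j)
  show ?thesis unfolding Suc
    by (rule times_cont_diff_SucI[of _ "\<lambda>_ v. v \<bullet> y"])
      (auto intro!: derivative_eq_intros times_cont_diff_const)
qed (simp add: continuous_intros)

lemma times_cont_diff_add:
  "times_cont_diff k f \<Longrightarrow> times_cont_diff k g \<Longrightarrow> times_cont_diff k (\<lambda>x. f x + g x)"
proof (induction k arbitrary: f g)
  case (Suc k)
  show ?case
  proof (rule times_cont_diff_SucI[where f'="\<lambda>x v. frechet_derivative f (at x) v + frechet_derivative g (at x) v"])
    show "times_cont_diff k (\<lambda>x. frechet_derivative f (at x) v + frechet_derivative g (at x) v)" for v
      using Suc.prems by (intro Suc.IH) simp_all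
  qed (intro has_derivative_add times_cont_diff_SucD[OF Suc.prems(1)] times_cont_diff_SucD[OF Suc.prems(2)])
qed (auto intro: continuous_intros)

lemma times_cont_diff_mult:
  "times_cont_diff k f \<Longrightarrow> times_cont_diff k g \<Longrightarrow> times_cont_diff k (\<lambda>x. f x * g x)"
proof (induction k arbitrary: f g)
  case (Suc k)
  let ?f' = "\<lambda>x v. f x * frechet_derivative g (at x) v + frechet_derivative f (at x) v * g x"
  show ?case
  proof (rule times_cont_diff_SucI[where f'="?f'"])
    show "times_cont_diff k (\<lambda>x. ?f' x v)" for v
      using Suc.prems times_cont_diff_Suc_imp[OF Suc.prems(1)] times_cont_diff_Suc_imp[OF Suc.prems(2)]
      by (intro times_cont_diff_add Suc.IH) simp_all
  qed (intro has_derivative_mult times_cont_diff_SucD[OF Suc.prems(1)] times_cont_diff_SucD[OF Suc.prems(2)])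
qed (auto intro: continuous_intros)

lemma times_cont_diff_powr:
  assumes "\<And>x. 0 < f x"
  shows "times_cont_diff k f \<Longrightarrow> times_cont_diff k (\<lambda>x. f x powr s)"
\<comment> \<open>The exponent varies in the induction because differentiation lowers it.\<close>
proof (induction k arbitrary: s)
  case 0
  have "f x \<noteq> 0" for x using assms[of x] by simp
  then show ?case using 0 by (auto intro!: continuous_on_powr)
next
  case (Suc k)
  have "((\<lambda>u. u powr s) has_real_derivative s * f x powr (s - 1)) (at (f x))" for x
    using assms[of x] by (auto intro!: derivative_eq_intros)
  note d = has_derivative_compose[OF times_cont_diff_SucD[OF Suc.prems] this[unfolded has_field_derivative_def]]
  show ?case
  proof (rule times_cont_diff_SucI[OF d])
    show "times_cont_diff k (\<lambda>x. s * f x powr (s - 1) * frechet_derivative f (at x) v)" for v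
      using Suc.prems times_cont_diff_Suc_imp[OF Suc.prems]
      by (intro times_cont_diff_mult Suc.IH times_cont_diff_const) simp_all
  qed
qed

lemma smooth_const: "smooth (\<lambda>_. c)"
  and smooth_inner: "smooth (\<lambda>x. x \<bullet> y)"
  and smooth_add: "smooth f \<Longrightarrow> smooth g \<Longrightarrow> smooth (\<lambda>x. f x + g x)"
  and smooth_mult: "smooth f \<Longrightarrow> smooth g \<Longrightarrow> smooth (\<lambda>x. f x * g x)"
  and smooth_powr: "smooth f \<Longrightarrow> (\<And>x. 0 < f x) \<Longrightarrow> smooth (\<lambda>x. f x powr s)"
  unfolding smooth_def
  by (auto intro: times_cont_diff_const times_cont_diff_inner times_cont_diff_add times_cont_diff_mult times_cont_diff_powr)

lemma smooth_power: "smooth f \<Longrightarrow> smooth (\<lambda>x. f x ^ k)"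
  by (induction k) (auto intro: smooth_const smooth_mult)

lemma smooth_sum: "(\<And>i. i \<in> S \<Longrightarrow> smooth (f i)) \<Longrightarrow> smooth (\<lambda>x. \<Sum>i\<in>S. f i x)"
  by (induction S rule: infinite_finite_induct) (auto intro: smooth_const smooth_add)

lemma smooth_GDERIV:
  fixes f :: "'a::euclidean_space \<Rightarrow> real"
  assumes "smooth f"
  shows "GDERIV f x :> grad f x" and "continuous_on UNIV (grad f)"
  using times_cont_diff_GDERIV[of f] assms[unfolded smooth_def, THEN spec, of "Suc 0"] by auto

lemma AE_lborel_imp_dense:
  assumes "AE x in (lborel :: 'a::euclidean_space measure). P x" and "open U" "U \<noteq> {}"
  shows "\<exists>x\<in>U. P x"
proof (rule ccontr)
  assume "\<not> ?thesis"
  then have "AE x in (lborel :: 'a measure). x \<notin> U" using assms(1) by (auto elim: eventually_mono)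
  then have "emeasure lborel U = 0" using assms(2)
    by (subst (asm) AE_iff_measurable[OF _ refl]) auto
  moreover have "emeasure lborel U \<noteq> 0" using open_not_negligible[OF assms(2,3)] assms(2)
    by (auto simp: negligible_iff_emeasure0)
  ultimately show False by simp
qed

context norm_functional
begin

text \<open>The functionals are gradients of \<open>N\<close>: each has dual norm at most 1 and
  attains \<open>N\<close> at its own base point. Points of differentiability are dense, and balls
  around finitely many of them cover the compact unit sphere of \<open>N\<close>.\<close>

lemma finite_norming_set:
  assumes \<delta>: "0 < \<delta>"
  shows "\<exists>Y. finite Y \<and> (\<forall>y\<in>Y. dual_norm N y \<le> 1) \<and> (\<forall>x. \<exists>y\<in>Y. (1 - \<delta>) * N x \<le> x \<bullet> y)"
proof -
  let ?S = "{x. N x = 1}"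
  \<comment> \<open>Half of \<delta> is lost in passing from \<open>u\<close> to \<open>z\<close>
    inside \<open>N\<close>, and half inside the functional.\<close>
  let ?U = "\<lambda>z. {x. N (x - z) < \<delta> / 2}"
  have opn: "open (?U z)" for z
    by (intro open_Collect_less continuous_on_compose2[OF continuous[of UNIV]] continuous_intros) auto
  have ne: "?U z \<noteq> {}" for z using \<delta> by (auto intro: exI[of _ z])
  have "compact ?S"
  proof -
    obtain c where c: "0 < c" "\<And>x. c * norm x \<le> N x" using lower_bound by blast
    have "closed ?S" by (intro closed_Collect_eq continuous continuous_intros)
    moreover have "bounded ?S"
      unfolding bounded_iff using c by (intro exI[of _ "1 / c"]) (auto simp: field_simps, metis)
    ultimately show ?thesis by (simp add: compact_eq_bounded_closed)
  qed
  define G where "G = {z. \<exists>D. GDERIV N z :> D}"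
  have cover: "?S \<subseteq> \<Union> (?U ` G)"
  proof
    fix x assume "x \<in> ?S"
    from AE_lborel_imp_dense[OF AE_differentiable opn[of x] ne[of x]]
    obtain z where "z \<in> G" "N (z - x) < \<delta> / 2" by (auto simp: G_def)
    then show "x \<in> \<Union> (?U ` G)" using minus_commute[of x z] by (intro UN_I[of z]) auto
  qed
  obtain T where T: "T \<subseteq> G" "finite T" "?S \<subseteq> \<Union> (?U ` T)"
    using compactE_image[OF \<open>compact ?S\<close> _ cover] opn by metis
  have "\<forall>z\<in>T. \<exists>D. GDERIV N z :> D" using T(1) unfolding G_def by blast
  from bchoice[OF this] obtain D where D: "\<And>z. z \<in> T \<Longrightarrow> GDERIV N z :> D z" by blast
  show ?thesis
  proof (intro exI[of _ "insert 0 (D ` T)"] conjI ballI allI)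
    show "finite (insert 0 (D ` T))" using T(2) by simp
    show "dual_norm N y \<le> 1" if "y \<in> insert 0 (D ` T)" for y
      using that GDERIV_dual_norm(1)[OF D] by auto
    fix x
    show "\<exists>y\<in>insert 0 (D ` T). (1 - \<delta>) * N x \<le> x \<bullet> y"
    proof (cases "x = 0")
      case False
      define u where "u = (1 / N x) *\<^sub>R x"
      have Nx: "0 < N x" using False by (rule pos)
      have u: "N u = 1" using False by (simp add: u_def scale)
      then obtain z where z: "z \<in> T" "N (u - z) < \<delta> / 2" using T(3) by auto
      have "- ((u - z) \<bullet> D z) \<le> N (u - z) * dual_norm N (D z)" 
        using abs_inner_le_dual[of "u - z" "D z"] by (simp add: abs_le_iff)
      also have "\<dots> \<le> N (u - z) * 1"
        by (intro mult_left_mono GDERIV_dual_norm(1)[OF D[OF z(1)]]) auto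
      finally have "N z - N (u - z) \<le> u \<bullet> D z"
        using GDERIV_dual_norm(2)[OF D[OF z(1)]] by (simp add: inner_diff_left)
      moreover have "N u - N z \<le> N (u - z)" by (rule triangle_diff)
      ultimately have "1 - \<delta> \<le> u \<bullet> D z" using z(2) u by linarith
      then have "(1 - \<delta>) * N x \<le> (u \<bullet> D z) * N x" using Nx by (intro mult_right_mono) auto
      also have "\<dots> = x \<bullet> D z" using Nx by (simp add: u_def)
      finally show ?thesis using z(1) by blast
    qed auto
  qed
qed

text \<open>The approximation is an \<open>\<ell>\<^sup>2\<^sup>k\<close>-norm of a finite norming family, regularized at the origin.\<close>

lemma smooth_norm_approximation:
  assumes \<delta>: "0 < \<delta>" "\<delta> < 1"
  shows "\<exists>\<rho>. smooth \<rho> \<and> (\<forall>x. 0 < \<rho> x \<and> (1 - \<delta>) * N x \<le> \<rho> x \<and> \<rho> x \<le> (1 + \<delta>) * (N x + \<delta>) \<and>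
    dual_norm N (grad \<rho> x) \<le> 1 + \<delta>)"
proof -
  obtain Y where Y: "finite Y" "\<And>y. y \<in> Y \<Longrightarrow> dual_norm N y \<le> 1" "\<And>x. \<exists>y\<in>Y. (1 - \<delta>) * N x \<le> x \<bullet> y"
    using finite_norming_set[OF \<delta>(1)] by blast
  \<comment> \<open>The extra 1 accounts for the regularizing term \<open>\<delta> ^ k\<close> of
    \<open>P\<close>. The exponent \<open>k\<close> is even and so large that the k-th root of
    \<open>m\<close> is at most 1 + \<delta>.\<close>
  define m where "m = real (card Y) + 1"
  have m: "0 < m" by (simp add: m_def)
  obtain j where "m < (1 + \<delta>) ^ j" using real_arch_pow[of "1 + \<delta>" m] \<delta> by auto
  define k where "k = 2 * Suc j"
  have k: "even k" "0 < k" by (auto simp: k_def)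
  define e where "e = 1 / real k"
  have e: "0 < e" "e \<le> 1" "e * real k = 1" using k by (auto simp: e_def)
  have mk: "m \<le> (1 + \<delta>) ^ k"
    using \<open>m < (1 + \<delta>) ^ j\<close> power_increasing[of j k "1 + \<delta>"] \<delta> by (auto simp: k_def)
  have root: "(c ^ k) powr e = c" if "0 \<le> c" for c
  proof (cases "c = 0")
    case False
    then show ?thesis using that e by (simp add: powr_realpow[symmetric] powr_powr mult.commute)
  qed (use k in simp)
  have me: "m powr e \<le> 1 + \<delta>"
    using powr_mono2[OF _ _ mk, of e] e m \<delta> root[of "1 + \<delta>"] by simp
  define P where "P x = \<delta> ^ k + (\<Sum>y\<in>Y. (x \<bullet> y) ^ k)" for x
  define \<rho> where "\<rho> x = P x powr e" for x
  have sum0: "0 \<le> (\<Sum>y\<in>Y. (x \<bullet> y) ^ k)" for x using k by (intro sum_nonneg) (simp add: zero_le_even_power)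
  have P: "0 < P x" for x unfolding P_def using \<delta> by (intro add_pos_nonneg sum0) auto
  have "smooth \<rho>"
    unfolding \<rho>_def[abs_def] using P
    by (intro smooth_powr) (auto simp: P_def[abs_def] intro!: smooth_add smooth_const smooth_sum smooth_power smooth_inner)
  moreover have "0 < \<rho> x" for x using P[of x] by (simp add: \<rho>_def)
  moreover have "(1 - \<delta>) * N x \<le> \<rho> x" for x
  proof -
    obtain y where y: "y \<in> Y" "(1 - \<delta>) * N x \<le> x \<bullet> y" using Y(3) by blast
    have "((1 - \<delta>) * N x) ^ k \<le> (x \<bullet> y) ^ k" using y \<delta> by (intro power_mono) auto
    also have "\<dots> \<le> (\<Sum>y\<in>Y. (x \<bullet> y) ^ k)"
      using y Y(1) k by (intro member_le_sum) (auto simp: zero_le_even_power)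
    also have "\<dots> \<le> P x" using \<delta> by (simp add: P_def)
    finally have "(((1 - \<delta>) * N x) ^ k) powr e \<le> \<rho> x" unfolding \<rho>_def using e \<delta> by (intro powr_mono2) auto
    then show ?thesis using \<delta> by (simp add: root)
  qed
  moreover have "\<rho> x \<le> (1 + \<delta>) * (N x + \<delta>)" for x
  proof -
    have xy: "(x \<bullet> y) ^ k \<le> (N x + \<delta>) ^ k" if "y \<in> Y" for y
    proof -
      have "\<bar>x \<bullet> y\<bar> \<le> N x * dual_norm N y" by (rule abs_inner_le_dual)
      also have "\<dots> \<le> N x * 1" using Y(2)[OF that] by (intro mult_left_mono) auto
      finally have "\<bar>x \<bullet> y\<bar> ^ k \<le> (N x + \<delta>) ^ k" using \<delta> by (intro power_mono) auto
      then show ?thesis using k by (simp add: power_even_abs)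
    qed
    have "\<delta> ^ k \<le> (N x + \<delta>) ^ k" using \<delta> by (intro power_mono) auto
    moreover have "(\<Sum>y\<in>Y. (x \<bullet> y) ^ k) \<le> card Y * (N x + \<delta>) ^ k"
      using sum_bounded_above[of Y "\<lambda>y. (x \<bullet> y) ^ k", OF xy] by simp
    ultimately have "P x \<le> m * (N x + \<delta>) ^ k" unfolding P_def m_def by (simp add: algebra_simps)
    then have "\<rho> x \<le> (m * (N x + \<delta>) ^ k) powr e" unfolding \<rho>_def using P[of x] e by (intro powr_mono2) auto
    also have "\<dots> = m powr e * (N x + \<delta>)" using \<delta> m by (simp add: powr_mult root)
    also have "\<dots> \<le> (1 + \<delta>) * (N x + \<delta>)" using me \<delta> by (intro mult_right_mono) auto
    finally show ?thesis .
  qed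
  moreover have "dual_norm N (grad \<rho> x) \<le> 1 + \<delta>" for x
  proof -
    define g where "g = (\<Sum>y\<in>Y. (x \<bullet> y) ^ (k - 1) *\<^sub>R y)"
    have "(P has_derivative (\<lambda>h. real k * (h \<bullet> g))) (at x)"
      unfolding P_def[abs_def] g_def
      by (auto intro!: derivative_eq_intros simp: inner_sum_right sum_distrib_left mult_ac fun_eq_iff)
    then have "GDERIV P x :> real k *\<^sub>R g" by (simp add: gderiv_def)
    moreover have "((\<lambda>s. s powr e) has_real_derivative e * P x powr (e - 1)) (at (P x))"
      using P[of x] by (auto intro!: derivative_eq_intros)
    ultimately have "GDERIV \<rho> x :> (e * P x powr (e - 1)) *\<^sub>R (real k *\<^sub>R g)"
      unfolding \<rho>_def[abs_def] by (rule GDERIV_DERIV_compose)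
    then have grad: "grad \<rho> x = P x powr (e - 1) *\<^sub>R g"
      using e by (simp add: grad_eqI mult_ac)
    \<comment> \<open>With this \<open>s\<close> the second terms of Young's inequality add up over
      \<open>Y\<close> to at most \<open>e * P x\<close>. The sum that dominates the dual norm of
      \<open>g\<close> is then at most \<open>P x / s\<close>, and the gradient of \<rho> has dual
      norm at most \<open>m powr e\<close>.\<close>
    define s where "s = (P x / m) powr e"
    have s: "0 < s" "s ^ k = P x / m"
      using P[of x] m e unfolding s_def by (simp_all add: powr_realpow[symmetric] powr_powr)
    have young: "c ^ (k - 1) * s \<le> (1 - e) * c ^ k + e * s ^ k" if c: "0 \<le> c" for c
    proof (cases "c = 0")
      case True
      moreover have "0 \<le> e * s ^ k" using e s(1) by simp
      ultimately show ?thesis by (simp add: k_def)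
    next
      case False
      then have c: "0 < c" using that by simp
      have "real k * (1 - e) = real (k - 1)" using e k by (simp add: algebra_simps)
      then have "(c ^ k) powr (1 - e) = c ^ (k - 1)"
        using c by (simp add: powr_realpow[symmetric] powr_powr)
      then show ?thesis
        using Youngs_inequality_0[of "1 - e" e "c ^ k" "s ^ k"] e c s(1) root[of s] by simp
    qed
    have "dual_norm N g \<le> (\<Sum>y\<in>Y. \<bar>x \<bullet> y\<bar> ^ (k - 1))"
    proof (rule dual_norm_le)
      fix v assume v: "N v \<le> 1"
      have "v \<bullet> g = (\<Sum>y\<in>Y. (x \<bullet> y) ^ (k - 1) * (v \<bullet> y))" by (simp add: g_def inner_sum_right)
      also have "\<dots> \<le> (\<Sum>y\<in>Y. \<bar>x \<bullet> y\<bar> ^ (k - 1) * 1)"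
      proof (rule sum_mono)
        fix y assume y: "y \<in> Y"
        have "\<bar>v \<bullet> y\<bar> \<le> N v * dual_norm N y" by (rule abs_inner_le_dual)
        also have "\<dots> \<le> 1 * 1" using v Y(2)[OF y] by (intro mult_mono) auto
        finally have "\<bar>x \<bullet> y\<bar> ^ (k - 1) * \<bar>v \<bullet> y\<bar> \<le> \<bar>x \<bullet> y\<bar> ^ (k - 1) * 1" by (intro mult_left_mono) auto
        then show "(x \<bullet> y) ^ (k - 1) * (v \<bullet> y) \<le> \<bar>x \<bullet> y\<bar> ^ (k - 1) * 1"
          using abs_ge_self[of "(x \<bullet> y) ^ (k - 1) * (v \<bullet> y)"] by (simp add: abs_mult power_abs)
      qed
      finally show "v \<bullet> g \<le> (\<Sum>y\<in>Y. \<bar>x \<bullet> y\<bar> ^ (k - 1))" by simp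
    qed
    moreover have "(\<Sum>y\<in>Y. \<bar>x \<bullet> y\<bar> ^ (k - 1)) * s \<le> P x"
    proof -
      have "(\<Sum>y\<in>Y. \<bar>x \<bullet> y\<bar> ^ (k - 1)) * s \<le> (\<Sum>y\<in>Y. (1 - e) * (x \<bullet> y) ^ k + e * s ^ k)"
        unfolding sum_distrib_right using young[of "\<bar>x \<bullet> _\<bar>"] k
        by (intro sum_mono) (metis abs_ge_zero power_even_abs young)
      also have "\<dots> = (1 - e) * (\<Sum>y\<in>Y. (x \<bullet> y) ^ k) + e * (card Y * (P x / m))"
        by (simp add: sum.distrib sum_distrib_left s(2))
      also have "\<dots> \<le> (1 - e) * P x + e * P x"
      proof (intro add_mono mult_left_mono)
        show "(\<Sum>y\<in>Y. (x \<bullet> y) ^ k) \<le> P x" using \<delta> by (simp add: P_def)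
        show "card Y * (P x / m) \<le> P x" using P[of x] m by (simp add: m_def field_simps)
      qed (use e in auto)
      finally show ?thesis by (simp add: algebra_simps)
    qed
    ultimately have "dual_norm N g \<le> P x / s" using s(1) by (simp add: pos_le_divide_eq mult_right_mono order_trans[OF mult_right_mono[of _ _ s]])
    then have "dual_norm N (grad \<rho> x) \<le> P x powr (e - 1) * (P x / s)"
      using mult_left_mono[of "dual_norm N g" "P x / s" "P x powr (e - 1)"]
      unfolding grad dual_norm_scale by simp
    also have "\<dots> = m powr e"
      using P[of x] m by (simp add: s_def powr_divide powr_diff)
    finally show ?thesis using me by simp
  qed
  ultimately show ?thesis by blast
qed

end

section \<open>Sharp constants\<close>

context GNS_setting
begin

text \<open>The integrands of a smooth function are Borel measurable, so the completed measure can
  be replaced by \<open>lborel\<close>.\<close>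

lemma finite_integrals_lborel:
  assumes f: "smooth f"
  shows "pow_int r f = (LBINT x. f x powr r)"
    and "grad_int N p f = (LBINT x. dual_norm N (grad f x) powr p)"
    and "finite_integrals N p a f \<longleftrightarrow> integrable lborel (\<lambda>x. f x powr \<beta>) \<and> integrable lborel (\<lambda>x. f x powr \<gamma>) \<and>
      integrable lborel (\<lambda>x. dual_norm N (grad f x) powr p)"
proof -
  have [measurable]: "f \<in> borel_measurable borel" "grad f \<in> borel_measurable borel"
    using smooth_GDERIV(2)[OF f] times_cont_diff_continuous[OF f[unfolded smooth_def, THEN spec]]
    by (auto intro: borel_measurable_continuous_onI)
  show "pow_int r f = (LBINT x. f x powr r)"
    unfolding pow_int_def by (rule integral_completion) measurable
  show "grad_int N p f = (LBINT x. dual_norm N (grad f x) powr p)"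
    unfolding grad_int_def by (rule integral_completion) measurable
  show "finite_integrals N p a f \<longleftrightarrow> integrable lborel (\<lambda>x. f x powr \<beta>) \<and> integrable lborel (\<lambda>x. f x powr \<gamma>) \<and>
      integrable lborel (\<lambda>x. dual_norm N (grad f x) powr p)"
    unfolding finite_integrals_def \<beta>_def[symmetric] \<gamma>_def[symmetric]
    by (simp add: integrable_completion)
qed

lemma pow_int_pos:
  assumes "smooth f" "\<And>x. 0 < f x" "finite_integrals N p a f"
  shows "0 < pow_int \<gamma> f" "0 < pow_int \<beta> f"
  using assms integral_pos[of "\<lambda>x. f x powr _"] finite_integrals_lborel(1,3)[OF assms(1)]
  by (simp_all add: less_imp_neq[OF assms(2), symmetric])

definition "\<Psi>\<^sub>0 = \<Psi> I (\<kappa> * J) Z"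

lemma \<Psi>\<^sub>0_pos: "0 < \<Psi>\<^sub>0"
  using I_pos J_pos Z_pos \<kappa>_pos by (simp add: \<Psi>\<^sub>0_def \<Psi>_def)

lemma \<Psi>_bound:
  assumes f: "smooth f" "\<And>x. 0 \<le> f x" "p < a \<or> (\<forall>x. 0 < f x)" "finite_integrals N p a f"
    and M: "0 < pow_int \<beta> f"
  shows "0 < pow_int \<gamma> f" "0 < grad_int N p f" "\<Psi>\<^sub>0 \<le> \<Psi> (pow_int \<gamma> f) (grad_int N p f) (pow_int \<beta> f)"
proof -
  note int = finite_integrals_lborel(3)[OF f(1), THEN iffD1, OF f(4)]
  note eq = finite_integrals_lborel(1,2)[OF f(1)]
  have "0 \<le> pow_int \<gamma> f" unfolding eq by (intro Bochner_Integration.integral_nonneg) auto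
  moreover have "pow_int \<gamma> f \<noteq> 0"
  proof
    assume "pow_int \<gamma> f = 0"
    then have "AE x in lborel. f x powr \<gamma> = 0"
      using int unfolding eq by (subst (asm) integral_nonneg_eq_0_iff_AE) auto
    \<comment> \<open>Both powers vanish exactly at the zeros of \<open>f\<close>.\<close>
    then have "AE x in lborel. f x powr \<beta> = 0" by eventually_elim simp
    then have "pow_int \<beta> f = 0" unfolding eq by (rule integral_eq_zero_AE)
    with M show False by simp
  qed
  ultimately show A: "0 < pow_int \<gamma> f" by simp
  show le: "\<Psi>\<^sub>0 \<le> \<Psi> (pow_int \<gamma> f) (grad_int N p f) (pow_int \<beta> f)"
    unfolding \<Psi>\<^sub>0_def
  proof (rule \<Psi>_minimal)
    show "competitor f" unfolding competitor_def using smooth_GDERIV[OF f(1)] f(2,3) int by blast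
  qed (use M A in \<open>auto simp: eq\<close>)
  have "0 \<le> grad_int N p f" unfolding eq by (intro Bochner_Integration.integral_nonneg) auto
  \<comment> \<open>A vanishing gradient integral would make \<Psi> zero, below the positive
    \<open>\<Psi>\<^sub>0\<close>.\<close>
  moreover have "grad_int N p f \<noteq> 0"
    using le \<Psi>\<^sub>0_pos by (auto simp: \<Psi>_def)
  ultimately show "0 < grad_int N p f" by simp
qed

text \<open>
  Only an upper bound for the limit of the gradient integrals is needed, so the gradients of the
  approximants need not converge.
\<close>

lemma smooth_extremal_approximation:
  obtains F :: "nat \<Rightarrow> 'a \<Rightarrow> real" and B :: "nat \<Rightarrow> real"
  where "\<And>k. smooth (F k)" "\<And>k x. 0 < F k x" "\<And>k. finite_integrals N p a (F k)"
    "(\<lambda>k. pow_int \<beta> (F k)) \<longlonglongrightarrow> Z" "(\<lambda>k. pow_int \<gamma> (F k)) \<longlonglongrightarrow> I"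
    "\<And>k. grad_int N p (F k) \<le> B k" "B \<longlonglongrightarrow> \<kappa> * J"
proof -
  \<comment> \<open>The shift by 2 keeps \<open>\<delta> k\<close> at most 1 / 2, so that one
    dominating function works for all \<open>k\<close>.\<close>
  define \<delta> where "\<delta> k = 1 / (real k + 2)" for k
  have \<delta>: "0 < \<delta> k" "\<delta> k < 1" "\<delta> k \<le> 1 / 2" for k by (auto simp: \<delta>_def field_simps)
  have \<delta>_lim: "\<delta> \<longlonglongrightarrow> 0" 
    using LIMSEQ_ignore_initial_segment[OF lim_1_over_n, of 2] unfolding \<delta>_def[abs_def] by (simp add: add.commute)
  from smooth_norm_approximation[OF \<delta>(1,2)]
  obtain \<rho> where \<rho>: "\<And>k. smooth (\<rho> k)" "\<And>k x. 0 < \<rho> k x" "\<And>k x. (1 - \<delta> k) * N x \<le> \<rho> k x"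
    "\<And>k x. \<rho> k x \<le> (1 + \<delta> k) * (N x + \<delta> k)" "\<And>k x. dual_norm N (grad (\<rho> k) x) \<le> 1 + \<delta> k"
    by metis
  define W where "W k x = 1 + \<rho> k x powr q" for k x
  have W1: "1 \<le> W k x" for k x by (simp add: W_def)
  then have W0: "0 < W k x" for k x by (meson less_le_trans zero_less_one)
  define F where "F k x = W k x powr ((p - a) / p)" for k x
  have smooth_W: "smooth (W k)" for k
    unfolding W_def[abs_def] by (intro smooth_add smooth_const smooth_powr \<rho>)
  have smooth_F: "smooth (F k)" for k
    unfolding F_def[abs_def] by (intro smooth_powr smooth_W W0)
  have F_powr: "F k x powr \<beta> = W k x powr (- a)" "F k x powr \<gamma> = W k x powr (1 - a)" for k x
    by (simp_all add: F_def profile_powr)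
  have dom: "W k x powr (- s) \<le> (1 / 2) powr (- (q * s)) * w x powr (- s)" if s: "0 \<le> s" for k x s
  proof -
    have "(1 / 2) * N x \<le> (1 - \<delta> k) * N x" using \<delta>(3)[of k] by (intro mult_right_mono) auto
    then have "((1 / 2) * N x) powr q \<le> \<rho> k x powr q" using \<rho>(3)[of k x] q1 by (intro powr_mono2) auto
    moreover have "(1 / 2) powr q \<le> (1 :: real)" using q1 by (intro powr_le1) auto
    moreover have "(1 / 2) powr q * w x = (1 / 2) powr q + ((1 / 2) * N x) powr q"
      by (simp only: w_def powr_mult distrib_left mult_1_right)
    ultimately have "(1 / 2) powr q * w x \<le> W k x" unfolding W_def by linarith
    then have "W k x powr (- s) \<le> ((1 / 2) powr q * w x) powr (- s)" using s by (intro powr_mono2') auto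
    also have "\<dots> = (1 / 2) powr (- (q * s)) * w x powr (- s)"
      using w_pos[of x] by (simp add: powr_mult powr_powr)
    finally show ?thesis .
  qed
  have lim: "(\<lambda>k. W k x powr (- s)) \<longlonglongrightarrow> w x powr (- s)" for x s
  proof -
    have "(\<lambda>k. \<rho> k x) \<longlonglongrightarrow> N x"
    proof (rule real_tendsto_sandwich)
      show "\<forall>\<^sub>F k in sequentially. (1 - \<delta> k) * N x \<le> \<rho> k x"
        "\<forall>\<^sub>F k in sequentially. \<rho> k x \<le> (1 + \<delta> k) * (N x + \<delta> k)" using \<rho> by simp_all
      have "(\<lambda>k. (1 - \<delta> k) * N x) \<longlonglongrightarrow> (1 - 0) * N x" by (intro tendsto_intros \<delta>_lim)
      then show "(\<lambda>k. (1 - \<delta> k) * N x) \<longlonglongrightarrow> N x" by simp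
      have "(\<lambda>k. (1 + \<delta> k) * (N x + \<delta> k)) \<longlonglongrightarrow> (1 + 0) * (N x + 0)" by (intro tendsto_intros \<delta>_lim)
      then show "(\<lambda>k. (1 + \<delta> k) * (N x + \<delta> k)) \<longlonglongrightarrow> N x" by simp
    qed
    then have "(\<lambda>k. \<rho> k x powr q) \<longlonglongrightarrow> N x powr q"
      using q1 \<rho>(2) by (intro tendsto_powr') (auto intro!: always_eventually less_imp_le)
    then have "(\<lambda>k. W k x) \<longlonglongrightarrow> w x" unfolding W_def w_def by (intro tendsto_add tendsto_const)
    moreover have "w x \<noteq> 0" using w_pos[of x] by linarith
    ultimately show ?thesis by (intro tendsto_powr tendsto_const)
  qed
  have W_meas[measurable]: "W k \<in> borel_measurable borel" for k
    using times_cont_diff_continuous[OF smooth_W[unfolded smooth_def, THEN spec]]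
    by (rule borel_measurable_continuous_onI)
  have int: "integrable lborel (\<lambda>x. W k x powr (- s))"
    and lim_int: "(\<lambda>k. \<integral>x. W k x powr (- s) \<partial>lborel) \<longlonglongrightarrow> (LBINT x. w x powr (- s))"
    if s: "0 \<le> s" "integrable lborel (\<lambda>x. w x powr (- s))" for k s
  proof -
    let ?d = "\<lambda>x. (1 / 2) powr (- (q * s)) * w x powr (- s)"
    have d: "integrable lborel ?d" using s(2) by simp
    show "integrable lborel (\<lambda>x. W k x powr (- s))"
      using dom[OF s(1)] by (intro Bochner_Integration.integrable_bound[OF d]) auto
    show "(\<lambda>k. \<integral>x. W k x powr (- s) \<partial>lborel) \<longlonglongrightarrow> (LBINT x. w x powr (- s))"
      using dom[OF s(1)] lim by (intro integral_dominated_convergence[OF _ _ d]) auto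
  qed
  have s0: "0 \<le> a" "0 \<le> a - 1" using a1 by auto
  have int0: "integrable lborel (\<lambda>x. W k x powr (- a))" for k by (rule int[OF s0(1) int_w0])
  have int1: "integrable lborel (\<lambda>x. W k x powr (1 - a))" for k
    using int[OF s0(2)] int_w1 by simp
  note pow = finite_integrals_lborel(1)[OF smooth_F]
  have limZ: "(\<lambda>k. pow_int \<beta> (F k)) \<longlonglongrightarrow> Z"
    unfolding pow F_powr Z_def by (rule lim_int[OF s0(1) int_w0])
  have limI: "(\<lambda>k. pow_int \<gamma> (F k)) \<longlonglongrightarrow> I"
    unfolding pow F_powr I_def using lim_int[OF s0(2)] int_w1 by simp
  \<comment> \<open>By this splitting the bound for the gradient integral involves only the
    difference of the two integrals whose limits are known, and I - Z = J.\<close>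
  have W_split: "\<rho> k x powr q * W k x powr (- a) = W k x powr (1 - a) - W k x powr (- a)" for k x
  proof -
    have "W k x powr (1 - a) = W k x * W k x powr (- a)"
      using W0[of k x] powr_add[of "W k x" 1 "- a"] by simp
    then show ?thesis by (simp add: W_def algebra_simps)
  qed
  define u where "u k x = \<kappa> * (\<rho> k x powr q * W k x powr (- a)) * (1 + \<delta> k) powr p" for k x
  have dual: "dual_norm N (grad (F k) x) powr p \<le> u k x" for k x
  proof -
    have "grad (F k) x = ((p - a) / p * (1 + \<rho> k x powr q) powr (- a / p) * (q * \<rho> k x powr (q - 1))) *\<^sub>R grad (\<rho> k) x"
      unfolding F_def[abs_def] W_def
      by (rule grad_eqI[OF GDERIV_profile[OF smooth_GDERIV(1)[OF \<rho>(1)] \<rho>(2)]])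
    then have "dual_norm N (grad (F k) x) powr p =
        \<kappa> * (\<rho> k x powr q * W k x powr (- a)) * dual_norm N (grad (\<rho> k) x) powr p"
      using dual_norm_profile_powr[OF less_imp_le[OF \<rho>(2)]] by (simp add: W_def)
    also have "\<dots> \<le> u k x"
      unfolding u_def using \<kappa>_pos p \<rho>(5) by (intro mult_left_mono powr_mono2) auto
    finally show ?thesis .
  qed
  have u_int: "integrable lborel (u k)" for k
    unfolding u_def[abs_def] W_split using int0 int1 by simp
  have grad_meas: "grad (F k) \<in> borel_measurable borel" for k
    by (rule borel_measurable_continuous_onI[OF smooth_GDERIV(2)[OF smooth_F]])
  have dual_int: "integrable lborel (\<lambda>x. dual_norm N (grad (F k) x) powr p)" for k
  proof (rule Bochner_Integration.integrable_bound[OF u_int])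
    show "(\<lambda>x. dual_norm N (grad (F k) x) powr p) \<in> borel_measurable lborel"
      using grad_meas[of k] by measurable
    show "AE x in lborel. norm (dual_norm N (grad (F k) x) powr p) \<le> norm (u k x)"
      by (intro AE_I2) (auto intro: order_trans[OF dual abs_ge_self])
  qed
  define B where "B k = \<kappa> * (pow_int \<gamma> (F k) - pow_int \<beta> (F k)) * (1 + \<delta> k) powr p" for k
  have "integral\<^sup>L lborel (u k) = B k" for k
    unfolding B_def pow F_powr u_def[abs_def] W_split using int0 int1 by simp
  then have le: "grad_int N p (F k) \<le> B k" for k
    unfolding finite_integrals_lborel(2)[OF smooth_F]
    using integral_mono[OF dual_int u_int dual] by metis
  have "B \<longlonglongrightarrow> \<kappa> * (I - Z) * (1 + 0) powr p"
    unfolding B_def[abs_def] by (intro tendsto_intros limI limZ \<delta>_lim) auto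
  then have limB: "B \<longlonglongrightarrow> \<kappa> * J" by (simp add: I_eq)
  have fin: "finite_integrals N p a (F k)" for k
    unfolding finite_integrals_lborel(3)[OF smooth_F] F_powr using int0 int1 dual_int by simp
  show thesis
    by (rule that[OF smooth_F _ fin limZ limI le limB]) (simp add: F_def W0 less_imp_neq[OF W0, symmetric])
qed

lemma sharp_constant:
  fixes \<theta> u v u' v' :: real
  defines "L \<equiv> \<lambda>f. pow_int \<gamma> f powr u * pow_int \<beta> f powr v"
    and "R \<equiv> \<lambda>f. grad_int N p f powr (\<theta> / p) * (pow_int \<gamma> f powr u' * pow_int \<beta> f powr v')"
  assumes \<theta>: "0 \<le> \<theta>" and u: "u' - u = \<theta> * ((a - nn) / nn)"
    and v: "v - v' = \<theta> * ((\<gamma> * ((a - nn) / nn) + 1) / \<beta>)"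
  shows "\<And>f. smooth f \<Longrightarrow> (\<And>x. 0 \<le> f x) \<Longrightarrow> p < a \<or> (\<forall>x. 0 < f x) \<Longrightarrow> finite_integrals N p a f \<Longrightarrow>
      0 < pow_int \<beta> f \<Longrightarrow> L f \<le> \<Psi>\<^sub>0 powr (- \<theta>) * R f"
    and "\<And>C. (\<And>f. smooth f \<Longrightarrow> (\<And>x. 0 < f x) \<Longrightarrow> finite_integrals N p a f \<Longrightarrow> L f \<le> C * R f) \<Longrightarrow>
      \<Psi>\<^sub>0 powr (- \<theta>) \<le> C"
    and "L h = \<Psi>\<^sub>0 powr (- \<theta>) * R h"
proof -
  let ?\<delta> = "(a - nn) / nn"
  have id: "A powr u * M powr v = \<Psi> A B M powr (- \<theta>) * (B powr (\<theta> / p) * (A powr u' * M powr v'))"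
    if "0 < A" "0 < B" "0 < M" for A B M
  proof -
    have "\<Psi> A B M powr (- \<theta>) = A powr (u - u') * B powr (- (\<theta> / p)) * M powr (v - v')"
    proof -
      have e: "?\<delta> * (- \<theta>) = u - u'" "- ((\<gamma> * ?\<delta> + 1) / \<beta>) * (- \<theta>) = v - v'" "1 / p * (- \<theta>) = - (\<theta> / p)"
        using u v by (simp_all add: mult.commute)
      have "\<Psi> A B M powr (- \<theta>) = (A powr ?\<delta>) powr (- \<theta>) * (B powr (1 / p)) powr (- \<theta>)
          * (M powr (- ((\<gamma> * ?\<delta> + 1) / \<beta>))) powr (- \<theta>)"
        unfolding \<Psi>_def by (simp only: powr_mult powr_ge_zero mult_nonneg_nonneg)
      then show ?thesis unfolding powr_powr e .
    qed
    moreover have "A powr (u - u') * A powr u' = A powr u" "M powr (v - v') * M powr v' = M powr v"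
      "B powr (- (\<theta> / p)) * B powr (\<theta> / p) = 1"
      using that by (simp_all add: powr_add[symmetric])
    ultimately show ?thesis by (simp add: mult_ac)
  qed
  show "L f \<le> \<Psi>\<^sub>0 powr (- \<theta>) * R f"
    if f: "smooth f" "\<And>x. 0 \<le> f x" "p < a \<or> (\<forall>x. 0 < f x)" "finite_integrals N p a f" "0 < pow_int \<beta> f" for f
  proof -
    note b = \<Psi>_bound[OF f]
    have "L f = \<Psi> (pow_int \<gamma> f) (grad_int N p f) (pow_int \<beta> f) powr (- \<theta>) * R f"
      unfolding L_def R_def by (rule id[OF b(1,2) f(5)])
    also have "\<dots> \<le> \<Psi>\<^sub>0 powr (- \<theta>) * R f"
      using b(3) \<Psi>\<^sub>0_pos \<theta> by (intro mult_right_mono powr_mono2') (auto simp: R_def)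
    finally show ?thesis .
  qed
  show eq: "L h = \<Psi>\<^sub>0 powr (- \<theta>) * R h"
    unfolding L_def R_def pow_int_\<beta>_h pow_int_\<gamma>_h grad_int_h \<Psi>\<^sub>0_def
    using I_pos J_pos Z_pos \<kappa>_pos by (intro id) auto
  show "\<Psi>\<^sub>0 powr (- \<theta>) \<le> C"
    if C: "\<And>f. smooth f \<Longrightarrow> (\<And>x. 0 < f x) \<Longrightarrow> finite_integrals N p a f \<Longrightarrow> L f \<le> C * R f" for C
  proof -
    obtain F B where F: "\<And>k. smooth (F k)" "\<And>k x. 0 < F k x" "\<And>k. finite_integrals N p a (F k)"
      and lim: "(\<lambda>k. pow_int \<beta> (F k)) \<longlonglongrightarrow> Z" "(\<lambda>k. pow_int \<gamma> (F k)) \<longlonglongrightarrow> I"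
      and B: "\<And>k. grad_int N p (F k) \<le> B k" "B \<longlonglongrightarrow> \<kappa> * J"
      by (rule smooth_extremal_approximation) blast
    have ev: "\<forall>\<^sub>F k in sequentially. 0 < pow_int \<beta> (F k) \<and> 0 < pow_int \<gamma> (F k)"
      using order_tendstoD(1)[OF lim(1) Z_pos] order_tendstoD(1)[OF lim(2) I_pos] by eventually_elim simp
    have R0: "0 \<le> R f" for f by (simp add: R_def)
    obtain k where "0 < pow_int \<beta> (F k)" "0 < pow_int \<gamma> (F k)"
      using ev by (auto dest: eventually_happens)
    then have "0 < L (F k)" by (simp add: L_def)
    also have "L (F k) \<le> C * R (F k)" by (intro C F)
    \<comment> \<open>Gradient integrals are controlled only from above, so \<open>C\<close> must be
      nonnegative for the bounds \<open>B k\<close> to be inserted.\<close>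
    finally have C0: "0 \<le> C" using R0[of "F k"] by (auto simp: zero_less_mult_iff)
    have limL: "(\<lambda>k. L (F k)) \<longlonglongrightarrow> L h"
      unfolding L_def pow_int_\<beta>_h pow_int_\<gamma>_h using Z_pos I_pos by (intro tendsto_intros lim) auto
    have limR: "(\<lambda>k. C * (B k powr (\<theta> / p) * (pow_int \<gamma> (F k) powr u' * pow_int \<beta> (F k) powr v'))) \<longlonglongrightarrow> C * R h"
      unfolding R_def pow_int_\<beta>_h pow_int_\<gamma>_h grad_int_h using Z_pos I_pos J_pos \<kappa>_pos
      by (intro tendsto_intros lim B) auto
    have "L (F k) \<le> C * (B k powr (\<theta> / p) * (pow_int \<gamma> (F k) powr u' * pow_int \<beta> (F k) powr v'))" for k
    proof -
      have "0 \<le> grad_int N p (F k)"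
        unfolding finite_integrals_lborel(2)[OF F(1)] by (intro Bochner_Integration.integral_nonneg) auto
      then have "R (F k) \<le> B k powr (\<theta> / p) * (pow_int \<gamma> (F k) powr u' * pow_int \<beta> (F k) powr v')"
        unfolding R_def using B(1) \<theta> p by (intro mult_right_mono powr_mono2) auto
      then have "C * R (F k) \<le> C * (B k powr (\<theta> / p) * (pow_int \<gamma> (F k) powr u' * pow_int \<beta> (F k) powr v'))"
        using C0 by (rule mult_left_mono)
      moreover have "L (F k) \<le> C * R (F k)" by (intro C F)
      ultimately show ?thesis by linarith
    qed
    then have "L h \<le> C * R h" using limL limR by (intro LIMSEQ_le) auto
    moreover have "0 < R h"
      unfolding R_def pow_int_\<beta>_h pow_int_\<gamma>_h grad_int_h using I_pos J_pos Z_pos \<kappa>_pos by simp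
    ultimately show ?thesis unfolding eq by simp
  qed
qed

section \<open>The two ranges of p\<close>

lemma GNS_plus_sharp:
  assumes pa: "p < a"
    and \<theta>: "0 \<le> \<theta>" "(1 - \<theta>) / \<gamma> = \<theta> * ((a - nn) / nn)"
  shows "\<exists>D. GNS_plus N p a \<theta> D \<and> (\<forall>C. GNS_plus N p a \<theta> C \<longrightarrow> D \<le> C) \<and>
    GNS_plus_lhs p a h = D * GNS_plus_rhs N p a \<theta> h"
proof -
  have \<gamma>: "1 < \<gamma>" by (rule \<gamma>_gt_1[OF pa])
  have \<beta>: "0 < \<beta>" using pa a1 p by (simp add: \<beta>_def)
  have v: "1 / \<beta> - 0 = \<theta> * ((\<gamma> * ((a - nn) / nn) + 1) / \<beta>)"
  proof -
    have "\<theta> * (\<gamma> * ((a - nn) / nn)) = \<gamma> * ((1 - \<theta>) / \<gamma>)" unfolding \<theta>(2) by simp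
    then have "\<theta> * (\<gamma> * ((a - nn) / nn) + 1) = 1" using \<gamma> by (simp add: distrib_left)
    then show ?thesis by (simp add: times_divide_eq_right)
  qed
  have u: "(1 - \<theta>) / \<gamma> - 0 = \<theta> * ((a - nn) / nn)" using \<theta>(2) by simp
  note sharp = sharp_constant[OF \<theta>(1) u v]
  \<comment> \<open>A power with exponent 0 is 1 only for a nonzero base, hence the positivity
    assumptions.\<close>
  have lhs: "GNS_plus_lhs p a f = pow_int \<gamma> f powr 0 * pow_int \<beta> f powr (1 / \<beta>)"
    and rhs: "GNS_plus_rhs N p a \<theta> f = grad_int N p f powr (\<theta> / p) *
      (pow_int \<gamma> f powr ((1 - \<theta>) / \<gamma>) * pow_int \<beta> f powr 0)"
    if "0 < pow_int \<gamma> f" "0 < pow_int \<beta> f" for f :: "'a \<Rightarrow> real"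
    using that by (simp_all add: GNS_plus_lhs_def GNS_plus_rhs_def \<beta>_def \<gamma>_def mult.commute)
  \<comment> \<open>Functions whose integral of \<open>f powr \<beta>\<close> is 0 fall outside
    \<open>sharp_constant\<close>; for them the left side is 0 and the right side is
    nonnegative.\<close>
  have zero: "GNS_plus_lhs p a f = 0" if "\<not> 0 < pow_int \<beta> f" "smooth f" for f :: "'a \<Rightarrow> real"
  proof -
    have "0 \<le> pow_int \<beta> f" unfolding finite_integrals_lborel(1)[OF that(2)]
      by (intro Bochner_Integration.integral_nonneg) auto
    then have "pow_int \<beta> f = 0" using that(1) by simp
    then show ?thesis by (simp add: GNS_plus_lhs_def \<beta>_def)
  qed
  show ?thesis
  proof (intro exI[of _ "\<Psi>\<^sub>0 powr (- \<theta>)"] conjI allI impI)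
    show "GNS_plus N p a \<theta> (\<Psi>\<^sub>0 powr (- \<theta>))"
      unfolding GNS_plus_def
    proof (intro allI impI, elim conjE)
      fix f assume f: "smooth f" "\<forall>x. 0 \<le> f x" "finite_integrals N p a f"
      show "GNS_plus_lhs p a f \<le> \<Psi>\<^sub>0 powr (- \<theta>) * GNS_plus_rhs N p a \<theta> f"
      proof (cases "0 < pow_int \<beta> f")
        case True
        have A: "0 < pow_int \<gamma> f" using f True pa by (intro \<Psi>_bound(1)) auto
        show ?thesis unfolding lhs[OF A True] rhs[OF A True]
          using f True pa by (intro sharp(1)) auto
      qed (simp add: zero[OF _ f(1)] GNS_plus_rhs_def)
    qed
    show "\<Psi>\<^sub>0 powr (- \<theta>) \<le> C" if C: "GNS_plus N p a \<theta> C" for C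
    proof (rule sharp(2))
      fix f :: "'a \<Rightarrow> real" assume f: "smooth f" "\<And>x. 0 < f x" "finite_integrals N p a f"
      have "GNS_plus_lhs p a f \<le> C * GNS_plus_rhs N p a \<theta> f"
        using C f unfolding GNS_plus_def by (auto intro: less_imp_le)
      then show "pow_int \<gamma> f powr 0 * pow_int \<beta> f powr (1 / \<beta>) \<le> C * (grad_int N p f powr (\<theta> / p) *
          (pow_int \<gamma> f powr ((1 - \<theta>) / \<gamma>) * pow_int \<beta> f powr 0))"
        unfolding lhs[OF pow_int_pos[OF f]] rhs[OF pow_int_pos[OF f]] .
    qed
    show "GNS_plus_lhs p a h = \<Psi>\<^sub>0 powr (- \<theta>) * GNS_plus_rhs N p a \<theta> h"
      using sharp(3) lhs[of h] rhs[of h] I_pos Z_pos by (simp only: pow_int_\<beta>_h pow_int_\<gamma>_h)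
  qed
qed

lemma GNS_minus_sharp:
  assumes pa: "a < p"
    and \<theta>: "0 \<le> \<theta>" "- 1 / \<gamma> = \<theta> * ((a - nn) / nn)"
  shows "\<exists>D. GNS_minus N p a \<theta> D \<and> (\<forall>C. GNS_minus N p a \<theta> C \<longrightarrow> D \<le> C) \<and>
    GNS_minus_lhs p a h = D * GNS_minus_rhs N p a \<theta> h"
proof -
  have \<gamma>: "\<gamma> \<noteq> 0" using pa a1 p by (simp add: \<gamma>_def)
  have v: "0 - (1 - \<theta>) / \<beta> = \<theta> * ((\<gamma> * ((a - nn) / nn) + 1) / \<beta>)"
  proof -
    have "\<theta> * (\<gamma> * ((a - nn) / nn)) = \<gamma> * (- 1 / \<gamma>)" unfolding \<theta>(2) by simp
    then have "\<theta> * (\<gamma> * ((a - nn) / nn) + 1) = - (1 - \<theta>)" using \<gamma> by (simp add: distrib_left)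
    then show ?thesis by (simp only: times_divide_eq_right diff_0 minus_divide_left)
  qed
  have u: "0 - 1 / \<gamma> = \<theta> * ((a - nn) / nn)" using \<theta>(2) by simp
  note sharp = sharp_constant[OF \<theta>(1) u v]
  have lhs: "GNS_minus_lhs p a f = pow_int \<gamma> f powr (1 / \<gamma>) * pow_int \<beta> f powr 0"
    and rhs: "GNS_minus_rhs N p a \<theta> f = grad_int N p f powr (\<theta> / p) *
      (pow_int \<gamma> f powr 0 * pow_int \<beta> f powr ((1 - \<theta>) / \<beta>))"
    if "0 < pow_int \<gamma> f" "0 < pow_int \<beta> f" for f :: "'a \<Rightarrow> real"
    using that by (simp_all add: GNS_minus_lhs_def GNS_minus_rhs_def \<beta>_def \<gamma>_def mult.commute)
  show ?thesis
  proof (intro exI[of _ "\<Psi>\<^sub>0 powr (- \<theta>)"] conjI allI impI)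
    show "GNS_minus N p a \<theta> (\<Psi>\<^sub>0 powr (- \<theta>))"
      unfolding GNS_minus_def
    proof (intro allI impI, elim conjE)
      fix f assume f: "smooth f" "\<forall>x. 0 < f x" "finite_integrals N p a f"
      then have f': "0 < f x" for x by blast
      note P = pow_int_pos[OF f(1) f' f(3)]
      show "GNS_minus_lhs p a f \<le> \<Psi>\<^sub>0 powr (- \<theta>) * GNS_minus_rhs N p a \<theta> f"
        unfolding lhs[OF P] rhs[OF P]
        using f P by (intro sharp(1)) (auto intro: less_imp_le)
    qed
    show "\<Psi>\<^sub>0 powr (- \<theta>) \<le> C" if C: "GNS_minus N p a \<theta> C" for C
    proof (rule sharp(2))
      fix f :: "'a \<Rightarrow> real" assume f: "smooth f" "\<And>x. 0 < f x" "finite_integrals N p a f"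
      have "GNS_minus_lhs p a f \<le> C * GNS_minus_rhs N p a \<theta> f"
        using C f unfolding GNS_minus_def by auto
      then show "pow_int \<gamma> f powr (1 / \<gamma>) * pow_int \<beta> f powr 0 \<le> C * (grad_int N p f powr (\<theta> / p) *
          (pow_int \<gamma> f powr 0 * pow_int \<beta> f powr ((1 - \<theta>) / \<beta>)))"
        unfolding lhs[OF pow_int_pos[OF f]] rhs[OF pow_int_pos[OF f]] .
    qed
    show "GNS_minus_lhs p a h = \<Psi>\<^sub>0 powr (- \<theta>) * GNS_minus_rhs N p a \<theta> h"
      using sharp(3) lhs[of h] rhs[of h] I_pos Z_pos by (simp only: pow_int_\<beta>_h pow_int_\<gamma>_h)
  qed
qed

end

section \<open>Arithmetic of the exponents\<close>

lemma affine_combination_eq_iff: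
  fixes X Y :: real
  assumes "L - Y = \<theta> * (X - Y)" "X \<noteq> Y"
  shows "L = t * X + (1 - t) * Y \<longleftrightarrow> t = \<theta>"
proof -
  have "L = t * X + (1 - t) * Y \<longleftrightarrow> L - Y = t * (X - Y)" by (simp add: algebra_simps)
  then show ?thesis using assms by auto
qed

text \<open>\<open>s\<close> is p - 1 times the gap in \<open>dim_less\<close>. It is affine in
  \<open>p\<close>, and where it decreases it stays above its value (a - 1) (a - n) at p = a. The
  equation for \<open>t\<close> has slope - s / (n (a - 1)), so positivity of \<open>s\<close> also
  gives uniqueness.\<close>

lemma GNS_plus_exponent:
  fixes n a p :: real
  assumes n: "1 \<le> n" and a: "n < a" and p: "1 < p" "p < a"
  defines "s \<equiv> p * (a - 1 - n) + n"
  defines "\<theta> \<equiv> (a - p) * n / (a * s)"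
  shows "0 < s" "0 \<le> \<theta>" "\<theta> \<le> 1"
    and "(1 - \<theta>) / (p * (a - 1) / (a - p)) = \<theta> * ((a - n) / n)"
    and "(a - p) / a = t * ((n - p) / n) + (1 - t) * ((a - p) / (a - 1)) \<longleftrightarrow> t = \<theta>"
proof -
  have a1: "1 < a" using n a by linarith
  have pos: "0 < (a - 1) * (a - n)" using a1 a by simp
  show s: "0 < s"
  proof (cases "0 \<le> a - 1 - n")
    case True
    then have "0 \<le> p * (a - 1 - n)" using p by simp
    then show ?thesis using n unfolding s_def by linarith
  next
    case False
    then have "a * (a - 1 - n) \<le> p * (a - 1 - n)" using p by (intro mult_right_mono_neg) auto
    moreover have "a * (a - 1 - n) + n = (a - 1) * (a - n)" by (simp add: algebra_simps)
    ultimately show ?thesis using pos unfolding s_def by linarith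
  qed
  have as: "0 < a * s" using a1 s by simp
  have \<theta>: "\<theta> * (a * s) = (a - p) * n" using as unfolding \<theta>_def by (metis less_irrefl nonzero_eq_divide_eq)
  show "0 \<le> \<theta>" unfolding \<theta>_def using as p n by (intro divide_nonneg_pos mult_nonneg_nonneg) auto
  have "a * s - (a - p) * n = p * ((a - 1) * (a - n))" unfolding s_def by (simp add: algebra_simps)
  then have \<theta>': "(1 - \<theta>) * (a * s) = p * ((a - 1) * (a - n))" using \<theta> by (simp add: algebra_simps)
  have "0 \<le> p * ((a - 1) * (a - n))" using p pos by simp
  then have "0 \<le> (1 - \<theta>) * (a * s)" using \<theta>' by simp
  then show "\<theta> \<le> 1" using as by (simp add: zero_le_mult_iff)
  have e: "1 - \<theta> = p * ((a - 1) * (a - n)) / (a * s)" using \<theta>' as by (metis less_irrefl nonzero_eq_divide_eq)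
  show "(1 - \<theta>) / (p * (a - 1) / (a - p)) = \<theta> * ((a - n) / n)"
  proof -
    have "(1 - \<theta>) / (p * (a - 1) / (a - p)) = (a - n) * (a - p) / (a * s)"
      unfolding e using p a1 by simp
    also have "\<dots> = \<theta> * ((a - n) / n)" unfolding \<theta>_def using n by (simp add: mult.commute)
    finally show ?thesis .
  qed
  have X: "(n - p) / n - (a - p) / (a - 1) = - s / (n * (a - 1))"
    using n a1 by (simp add: s_def divide_simps) (simp add: algebra_simps)
  have "(a - p) / a - (a - p) / (a - 1) = - ((a - p) / (a * (a - 1)))"
    using a1 by (simp add: divide_simps) (simp add: algebra_simps)
  also have "\<dots> = \<theta> * (- s / (n * (a - 1)))" unfolding \<theta>_def using s n by simp
  finally show "(a - p) / a = t * ((n - p) / n) + (1 - t) * ((a - p) / (a - 1)) \<longleftrightarrow> t = \<theta>"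
    using X s n a1 by (intro affine_combination_eq_iff) (simp_all, force)
qed

text \<open>The denominator of \<theta> exceeds its numerator by a (p (a - 1 - n) + n), so the
  assumption \<open>s\<close>, which expresses \<open>dim_less\<close>, also gives \<theta> \<le>
  1.\<close>

lemma GNS_minus_exponent:
  fixes n a p :: real
  assumes n: "1 \<le> n" and a: "n < a" and p: "a < p" and s: "0 < p * (a - 1 - n) + n"
  defines "\<theta> \<equiv> n * (p - a) / (p * (a - 1) * (a - n))"
  shows "0 \<le> \<theta>" "\<theta> \<le> 1"
    and "- 1 / (p * (a - 1) / (a - p)) = \<theta> * ((a - n) / n)"
    and "(p - a) / (a - 1) = t * ((p - n) / n) + (1 - t) * ((p - a) / a) \<longleftrightarrow> t = \<theta>"
proof -
  have a1: "1 < a" using n a by linarith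
  have d: "0 < p * (a - 1) * (a - n)" using a1 a p by simp
  show "0 \<le> \<theta>" unfolding \<theta>_def using d p n by (intro divide_nonneg_pos mult_nonneg_nonneg) auto
  have "p * (a - 1) * (a - n) - n * (p - a) = a * (p * (a - 1 - n) + n)" by (simp add: algebra_simps)
  moreover have "0 < a * (p * (a - 1 - n) + n)" using a1 s by simp
  ultimately have "n * (p - a) \<le> p * (a - 1) * (a - n)" by linarith
  then show "\<theta> \<le> 1" unfolding \<theta>_def using d by simp
  show "- 1 / (p * (a - 1) / (a - p)) = \<theta> * ((a - n) / n)"
  proof -
    have "- 1 / (p * (a - 1) / (a - p)) = (p - a) / (p * (a - 1))" by (simp add: minus_divide_left)
    also have "\<dots> = \<theta> * ((a - n) / n)" unfolding \<theta>_def using a n by simp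
    finally show ?thesis .
  qed
  have X: "(p - n) / n - (p - a) / a = p * (a - n) / (n * a)"
    using n a1 by (simp add: divide_simps) (simp add: algebra_simps)
  have "(p - a) / (a - 1) - (p - a) / a = (p - a) / (a * (a - 1))"
    using a1 by (simp add: divide_simps) (simp add: algebra_simps)
  also have "\<dots> = \<theta> * (p * (a - n) / (n * a))" unfolding \<theta>_def using a p n by (simp add: mult_ac)
  finally show "(p - a) / (a - 1) = t * ((p - n) / n) + (1 - t) * ((p - a) / a) \<longleftrightarrow> t = \<theta>"
    using X a n p by (intro affine_combination_eq_iff) (simp_all, force)
qed

theorem theorem10:
  fixes N :: "real ^ 'n \<Rightarrow> real" and a p q :: real
  assumes "is_norm N" and "real CARD('n) < a" and "1 / p + 1 / q = 1"
  shows
    "(1 < p \<and> p < a \<longrightarrow>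
      (\<exists>\<theta>\<in>{0..1}.
        (\<forall>t. (a - p) / a = t * ((real CARD('n) - p) / real CARD('n)) + (1 - t) * ((a - p) / (a - 1))
              \<longleftrightarrow> t = \<theta>) \<and>
        (\<exists>D. GNS_plus N p a \<theta> D \<and>
             (\<forall>C. GNS_plus N p a \<theta> C \<longrightarrow> D \<le> C) \<and>
             admissible_extremal N p a (extremal N p q a) \<and>
             GNS_plus_lhs p a (extremal N p q a) = D * GNS_plus_rhs N p a \<theta> (extremal N p q a)))) \<and>
    ((real CARD('n) + 1 \<le> a \<and> a < p) \<or>
     (real CARD('n) \<le> a \<and> a < real CARD('n) + 1 \<and>
        a < p \<and> p < real CARD('n) / (real CARD('n) + 1 - a)) \<longrightarrow>
      p * (a - 1) / (a - p) < 0 \<and> a * p / (a - p) < 0 \<and>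
      (\<exists>\<theta>\<in>{0..1}.
        (\<forall>t. (p - a) / (a - 1) = t * ((p - real CARD('n)) / real CARD('n)) + (1 - t) * ((p - a) / a)
              \<longleftrightarrow> t = \<theta>) \<and>
        (\<exists>D. GNS_minus N p a \<theta> D \<and>
             (\<forall>C. GNS_minus N p a \<theta> C \<longrightarrow> D \<le> C) \<and>
             admissible_extremal N p a (extremal N p q a) \<and>
             GNS_minus_lhs p a (extremal N p q a) = D * GNS_minus_rhs N p a \<theta> (extremal N p q a))))"
proof -
  let ?n = "real CARD('n)"
  have n: "1 \<le> ?n" by (simp add: Suc_leI)
  have a1: "1 < a" using n assms(2) by linarith
  \<comment> \<open>The third premise is \<open>dim_less\<close> multiplied by p - 1.\<close>
  have setting: "GNS_setting N a p q" if "1 < p" "p \<noteq> a" "0 < p * (a - 1 - ?n) + ?n"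
  proof
    show "is_norm N" by fact
    show "real DIM(real ^ 'n) < a" using assms(2) by simp
    show "1 < p" "p \<noteq> a" "1 / p + 1 / q = 1" by fact+
    have "q \<noteq> 0" using assms(3) \<open>1 < p\<close> by auto
    then have q: "q = p / (p - 1)" using assms(3) \<open>1 < p\<close> by (simp add: field_simps)
    have "?n * (p - 1) < p * (a - 1)" using that(3) by (simp add: algebra_simps)
    then show "real DIM(real ^ 'n) < q * (a - 1)"
      using \<open>1 < p\<close> unfolding q by (simp add: pos_less_divide_eq)
  qed
  have pos: "0 < p * (a - 1 - ?n) + ?n"
    if "(?n + 1 \<le> a \<and> a < p) \<or> (?n \<le> a \<and> a < ?n + 1 \<and> a < p \<and> p < ?n / (?n + 1 - a))"
    using that
  proof (elim disjE conjE)
    assume "?n + 1 \<le> a" "a < p"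
    then have "0 \<le> p * (a - 1 - ?n)" using a1 by (intro mult_nonneg_nonneg) auto
    then show ?thesis using n by linarith
  next
    assume "a < ?n + 1" "p < ?n / (?n + 1 - a)"
    then have "p * (?n + 1 - a) < ?n" by (simp add: pos_less_divide_eq)
    then show ?thesis by (simp add: algebra_simps)
  qed
  show ?thesis
  proof (intro conjI impI, goal_cases)
    case 1
    then have hp: "1 < p" "p < a" by auto
    note ex = GNS_plus_exponent[OF n assms(2) hp]
    let ?\<theta> = "(a - p) * ?n / (a * (p * (a - 1 - ?n) + ?n))"
    interpret GNS_setting N a p q using setting ex(1) hp by auto
    have nn: "nn = ?n" by (simp add: nn_def)
    have "(1 - ?\<theta>) / \<gamma> = ?\<theta> * ((a - nn) / nn)" unfolding nn \<gamma>_def by (rule ex(4))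
    from GNS_plus_sharp[OF hp(2) ex(2) this] admissible_extremal ex(2,3,5)
    show ?case by (intro bexI[of _ ?\<theta>]) auto
  next
    case 2
    then show ?case using a1 by (auto intro!: divide_pos_neg mult_pos_pos)
  next
    case 3
    then show ?case using a1 by (auto intro!: divide_pos_neg mult_pos_pos)
  next
    case 4
    then have hp: "a < p" by auto
    note ex = GNS_minus_exponent[OF n assms(2) hp pos[OF 4]]
    let ?\<theta> = "?n * (p - a) / (p * (a - 1) * (a - ?n))"
    interpret GNS_setting N a p q using setting pos[OF 4] hp a1 by auto
    have nn: "nn = ?n" by (simp add: nn_def)
    have "- 1 / \<gamma> = ?\<theta> * ((a - nn) / nn)" unfolding nn \<gamma>_def by (rule ex(3))
    from GNS_minus_sharp[OF hp ex(1) this] admissible_extremal ex(1,2,4)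
    show ?case by (intro bexI[of _ ?\<theta>]) auto
  qed
qed

end
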